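(* Let $\Bbbk$ be an algebraically closed field of characteristic zero. (a) Let $A=\Bbbk[x,y,z]$ be a quadratic Poisson algebra with nontrivial (i.e. not identically zero) Poisson bracket. Then the $d$th Veronese Poisson subalgebra $A^{(d)}$ is Poisson cancellative for every $d\ge 1$. In particular, $A$ is Poisson cancellative. (b) Let $\mathfrak g$ be a non-abelian Lie algebra over $\Bbbk$ of dimension $\le 3$. Then the symmetric algebra $S(\mathfrak g)$ equipped with the Kostant-Kirillov bracket is Poisson cancellative.
   Context: All algebras are over $\Bbbk$. A Poisson algebra is a commutative $\Bbbk$-algebra with a $\Bbbk$-bilinear bracket $\{-,-\}$ that is a Lie bracket and a biderivation; isomorphisms of Poisson algebras are $\Bbbk$-algebra isomorphisms preserving brackets. For a Poisson algebra $A$, the polynomial algebra $A[t]$ carries the Poisson bracket extending that of $A$ with $\{t,-\}=0$. $A$ is Poisson cancellative if for every Poisson algebra $B$, a Poisson isomorphism $A[t]\cong B[s]$ implies $A\cong B$ as Poisson algebras. A Poisson bracket on a polynomial ring $A=\Bbbk[x_1,\dots,x_n]$ is quadratic if $\{x_i,x_j\}\in A_2$ for all $i,j$, where $A=\bigoplus_{m\ge0} A_m$ is the standard grading ($\deg x_i=1$). The $d$th Veronese subalgebra is $A^{(d)}=\bigoplus_{m\ge 0}A_{dm}$, which is a Poisson subalgebra. For a Lie algebra $\mathfrak g$ with basis $x_1,\dots,x_n$, the Kostant-Kirillov bracket on $S(\mathfrak g)=\Bbbk[x_1,\dots,x_n]$ is the Poisson bracket determined by $\{x_i,x_j\}=[x_i,x_j]$.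 *)

theory Defs
  imports
    "HOL-Algebra.UnivPoly"
    "HOL-Algebra.QuotRing"
    "HOL-Algebra.Algebraic_Closure_Type"
    "HOL-Library.Poly_Mapping"
begin

section \<open>Poisson algebras\<close>

record ('k, 'a) poisson = "('k, 'a) module" +
  pbracket :: "'a \<Rightarrow> 'a \<Rightarrow> 'a"

text \<open>
  The ground field is a type of class \<^class>\<open>field\<close>; \<^const>\<open>ring_of_type_algebra\<close> is the
  HOL-Algebra ring on that type. The zero algebra is allowed.
\<close>

locale poisson_algebra = algebra "ring_of_type_algebra :: 'k::field ring" A
  for A :: "('k::field, 'a) poisson" (structure) +
  assumes bracket_closed:
      "\<lbrakk>x \<in> carrier A; y \<in> carrier A\<rbrakk> \<Longrightarrow> pbracket A x y \<in> carrier A"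
    and bracket_add_left:
      "\<lbrakk>x \<in> carrier A; y \<in> carrier A; z \<in> carrier A\<rbrakk>
        \<Longrightarrow> pbracket A (x \<oplus> y) z = pbracket A x z \<oplus> pbracket A y z"
    and bracket_add_right:
      "\<lbrakk>x \<in> carrier A; y \<in> carrier A; z \<in> carrier A\<rbrakk>
        \<Longrightarrow> pbracket A x (y \<oplus> z) = pbracket A x y \<oplus> pbracket A x z"
    and bracket_scale_left:
      "\<lbrakk>x \<in> carrier A; y \<in> carrier A\<rbrakk> \<Longrightarrow> pbracket A (c \<odot> x) y = c \<odot> pbracket A x y"
    and bracket_scale_right:
      "\<lbrakk>x \<in> carrier A; y \<in> carrier A\<rbrakk> \<Longrightarrow> pbracket A x (c \<odot> y) = c \<odot> pbracket A x y"
    and bracket_alternating: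
      "x \<in> carrier A \<Longrightarrow> pbracket A x x = \<zero>"
    and bracket_jacobi:
      "\<lbrakk>x \<in> carrier A; y \<in> carrier A; z \<in> carrier A\<rbrakk>
        \<Longrightarrow> pbracket A x (pbracket A y z) \<oplus> pbracket A y (pbracket A z x)
              \<oplus> pbracket A z (pbracket A x y) = \<zero>"
    and bracket_leibniz_left:
      "\<lbrakk>x \<in> carrier A; y \<in> carrier A; z \<in> carrier A\<rbrakk>
        \<Longrightarrow> pbracket A (x \<otimes> y) z = (x \<otimes> pbracket A y z) \<oplus> (pbracket A x z \<otimes> y)"
    and bracket_leibniz_right:
      "\<lbrakk>x \<in> carrier A; y \<in> carrier A; z \<in> carrier A\<rbrakk>
        \<Longrightarrow> pbracket A x (y \<otimes> z) = (y \<otimes> pbracket A x z) \<oplus> (pbracket A x y \<otimes> z)"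

definition poisson_iso :: "('k, 'a) poisson \<Rightarrow> ('k, 'b) poisson \<Rightarrow> ('a \<Rightarrow> 'b) set" where
  "poisson_iso A B = {h \<in> ring_iso A B.
     (\<forall>c. \<forall>x\<in>carrier A. h (c \<odot>\<^bsub>A\<^esub> x) = c \<odot>\<^bsub>B\<^esub> h x) \<and>
     (\<forall>x\<in>carrier A. \<forall>y\<in>carrier A. h (pbracket A x y) = pbracket B (h x) (h y))}"

definition poisson_isomorphic :: "('k, 'a) poisson \<Rightarrow> ('k, 'b) poisson \<Rightarrow> bool" where
  "poisson_isomorphic A B \<longleftrightarrow> poisson_iso A B \<noteq> {}"

text \<open>
  The polynomial algebra $A[t]$. Its ring part is that of \<^const>\<open>UP\<close>, whose elements are
  coefficient sequences. The bracket extending the one of $A$ with $\{t,-\} = 0$ is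
  $\{\sum_i a_i t^i, \sum_j b_j t^j\} = \sum_{i,j} \{a_i,b_j\} t^{i+j}$.
\<close>

definition poisson_poly :: "('k, 'a) poisson \<Rightarrow> ('k, nat \<Rightarrow> 'a) poisson" where
  "poisson_poly A = \<lparr>
     carrier = carrier (UP A),
     monoid.mult = monoid.mult (UP A),
     one = one (UP A),
     ring.zero = ring.zero (UP A),
     add = add (UP A),
     module.smult = (\<lambda>c p n. c \<odot>\<^bsub>A\<^esub> p n),
     pbracket = (\<lambda>p q n. \<Oplus>\<^bsub>A\<^esub>i\<in>{..n}. pbracket A (p i) (q (n - i)))\<rparr>"

text \<open>
  HOL cannot quantify over types inside a formula, so the type \<open>'b\<close> carrying the competitor $B$
  is a parameter. A theorem about \<open>poisson_cancellative TYPE('b) A\<close> with \<open>'b\<close> a type variable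
  that does not occur in \<open>A\<close> speaks about all Poisson algebras $B$.
\<close>

definition poisson_cancellative :: "'b itself \<Rightarrow> ('k::field, 'a) poisson \<Rightarrow> bool" where
  "poisson_cancellative ty A \<longleftrightarrow> poisson_algebra A \<and>
     (\<forall>B :: ('k, 'b) poisson. poisson_algebra B \<longrightarrow>
        poisson_isomorphic (poisson_poly A) (poisson_poly B) \<longrightarrow> poisson_isomorphic A B)"


section \<open>Poisson brackets on polynomial rings\<close>

type_synonym 'k mpol = "(nat \<Rightarrow>\<^sub>0 nat) \<Rightarrow>\<^sub>0 'k"

definition pvar :: "nat \<Rightarrow> 'k::field mpol" where
  "pvar i = Poly_Mapping.single (Poly_Mapping.single i 1) 1"

definition pconst :: "'k \<Rightarrow> 'k::field mpol" where
  "pconst c = Poly_Mapping.single 0 c"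

text \<open>The elements of \<^typ>\<open>'k mpol\<close> in the variables \<open>pvar i\<close>, \<open>i < n\<close>.\<close>

definition polys :: "nat \<Rightarrow> 'k::field mpol set" where
  "polys n = {p. \<forall>m\<in>Poly_Mapping.keys p. Poly_Mapping.keys m \<subseteq> {..<n}}"

definition poly_alg ::
    "nat \<Rightarrow> ('k::field mpol \<Rightarrow> 'k mpol \<Rightarrow> 'k mpol) \<Rightarrow> ('k, 'k mpol) poisson" where
  "poly_alg n br = \<lparr>
     carrier = polys n,
     monoid.mult = (*),
     one = 1,
     ring.zero = 0,
     add = (+),
     module.smult = (\<lambda>c p. pconst c * p),
     pbracket = br\<rparr>"

definition mon_deg :: "(nat \<Rightarrow>\<^sub>0 nat) \<Rightarrow> nat" where
  "mon_deg m = (\<Sum>i\<in>Poly_Mapping.keys m. Poly_Mapping.lookup m i)"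

definition hom_part :: "nat \<Rightarrow> nat \<Rightarrow> 'k::field mpol set" where
  "hom_part n e = {p \<in> polys n. \<forall>m\<in>Poly_Mapping.keys p. mon_deg m = e}"

definition quadratic_bracket ::
    "nat \<Rightarrow> ('k::field mpol \<Rightarrow> 'k mpol \<Rightarrow> 'k mpol) \<Rightarrow> bool" where
  "quadratic_bracket n br \<longleftrightarrow> (\<forall>i<n. \<forall>j<n. br (pvar i) (pvar j) \<in> hom_part n 2)"

definition nontrivial_bracket ::
    "nat \<Rightarrow> ('k::field mpol \<Rightarrow> 'k mpol \<Rightarrow> 'k mpol) \<Rightarrow> bool" where
  "nontrivial_bracket n br \<longleftrightarrow> (\<exists>p\<in>polys n. \<exists>q\<in>polys n. br p q \<noteq> 0)"

definition veronese_carrier :: "nat \<Rightarrow> nat \<Rightarrow> 'k::field mpol set" where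
  "veronese_carrier n d = {(\<Sum>e\<le>N. f e) | f N. \<forall>e\<le>N. f e \<in> hom_part n (d * e)}"

definition veronese ::
    "nat \<Rightarrow> ('k::field mpol \<Rightarrow> 'k mpol \<Rightarrow> 'k mpol) \<Rightarrow> nat \<Rightarrow> ('k, 'k mpol) poisson" where
  "veronese n br d = (poly_alg n br)\<lparr>carrier := veronese_carrier n d\<rparr>"


section \<open>Lie algebras and the Kostant-Kirillov bracket\<close>

locale lie_algebra = vector_space scale
  for scale :: "'k::field \<Rightarrow> 'g::ab_group_add \<Rightarrow> 'g" +
  fixes lie :: "'g \<Rightarrow> 'g \<Rightarrow> 'g"
  assumes lie_add_left: "lie (u + v) w = lie u w + lie v w"
    and lie_add_right: "lie u (v + w) = lie u v + lie u w"
    and lie_scale_left: "lie (scale c u) v = scale c (lie u v)"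
    and lie_scale_right: "lie u (scale c v) = scale c (lie u v)"
    and lie_alternating: "lie u u = 0"
    and lie_jacobi: "lie u (lie v w) + lie v (lie w u) + lie w (lie u v) = 0"
begin

definition nonabelian :: bool where
  "nonabelian \<longleftrightarrow> (\<exists>u v. lie u v \<noteq> 0)"

definition ordered_basis :: "nat \<Rightarrow> (nat \<Rightarrow> 'g) \<Rightarrow> bool" where
  "ordered_basis n b \<longleftrightarrow>
     inj_on b {..<n} \<and> independent (b ` {..<n}) \<and> span (b ` {..<n}) = UNIV"

text \<open>The linear form in $S(\mathfrak{g})$ given by an element of $\mathfrak{g}$, where
  \<open>pvar i\<close> stands for the basis vector \<open>b i\<close>.\<close>

definition linear_form :: "nat \<Rightarrow> (nat \<Rightarrow> 'g) \<Rightarrow> 'g \<Rightarrow> 'k mpol" where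
  "linear_form n b v = (\<Sum>i<n. pconst (representation (b ` {..<n}) v (b i)) * pvar i)"

text \<open>A Poisson bracket on a polynomial ring is determined by its values on the variables; hence this
  predicate pins down \<open>br\<close> on \<open>polys n\<close>; values outside \<open>polys n\<close> play no role.\<close>

definition kostant_kirillov ::
    "nat \<Rightarrow> (nat \<Rightarrow> 'g) \<Rightarrow> ('k mpol \<Rightarrow> 'k mpol \<Rightarrow> 'k mpol) \<Rightarrow> bool" where
  "kostant_kirillov n b br \<longleftrightarrow> poisson_algebra (poly_alg n br) \<and>
     (\<forall>i<n. \<forall>j<n. br (pvar i) (pvar j) = linear_form n b (lie (b i) (b j)))"

end

end

theory Submission
  imports Defs "Berlekamp_Zassenhaus.Unique_Factorization_Poly"
begin

text \<open>
  Let $A$ be a Veronese subalgebra of $k[x_1,\dots,x_n]$, $n \le 3$, with a nonzero bracket such that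
  all $\{x_i,x_j\}$ are homogeneous of one degree $r$; quadratic brackets have $r = 2$, and a
  Kostant-Kirillov bracket has $r = 1$. Suppose $R = A[t] = B[s]$. The derivation $D = d/ds$ of
  $R$ is a Poisson derivation that kills $B$, and the proof asks how $D$ acts on the Poisson centre
  $Z$ of $A$.

  The centre is small. The bracket being nonzero and $n$ at most 3, the gradients of two central
  elements are parallel (\<open>central_jacobian\<close>), so that central elements that are homogeneous of the
  same degree are proportional (\<open>central_homogeneous_proportional\<close>).

  If $D$ kills $Z$, then $s$, a polynomial in $t$ over $Z$, and $t$, a polynomial in $s$ over $B$,
  are inverse to each other under composition over $B$. Both are linear, and $A$ and $B$ are both
  the quotient of $R$ by $s$ (\<open>equiv_if_centre_in_base\<close>).

  If $D$ does not kill $Z$, let $f \in Z$ be homogeneous of the least positive degree $e$. All central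
  homogeneous elements of positive degree have powers proportional to powers of $f$, hence
  vanish at each root of $f$ at least as often as $f$ does, where $f$ is read as a polynomial in $s$.
  The derivative $D f$ vanishes less often. Therefore the coefficients of $D f$ do not all lie in
  the ideal of positive degree (\<open>derivative_has_constant_term\<close>): $D$ has a nonzero homogeneous
  component that lowers the degree in $A$ by $e$. A derivation of a polynomial ring lowers degrees
  by at most 1, and a Veronese subalgebra with $d \ge 2$ has no such component at all
  (\<open>e_eq_d\<close>, \<open>d_eq_1\<close>). So $d = e = 1$, the component is a constant vector field
  with $f \mapsto 1$, and as the lowest component of a Poisson derivation it is a Poisson
  derivation (\<open>bracket_translation_invariant\<close>). The bracket is thus invariant under translation,
  and $A$ is the tensor product of a Poisson algebra and $k[f]$.

  In this last case the centre of $R$ is $k[f,t] = C[s]$, where $C$ is the centre of $B$. Cancellation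
  for the affine line, a theorem of Abhyankar, Eakin and Heinzer, gives $C = k[g]$
  (\<open>base_is_polynomial_ring\<close>), and mapping $f$ to $g$ gives $A \cong B$ (\<open>equiv_if_centre_moved\<close>).

  All of this takes place inside the ring of polynomials in $t$ over the type of multivariate
  polynomials: the competitor is pulled back along the given isomorphism and becomes a
  subring $B$ of $R$ (\<open>two_presentations_B\<close>).
\<close>

(* These names of univariate polynomials over HOL-Algebra rings would hide those of the type poly. *)
hide_const (open) up_ring.monom up_ring.coeff UnivPoly.bound

section \<open>Adjoining a free variable to a subring\<close>

definition coeffs_in :: "'a::zero set \<Rightarrow> 'a poly \<Rightarrow> bool" where
  "coeffs_in B F \<longleftrightarrow> (\<forall>i. coeff F i \<in> B)"

locale subring_set =
  fixes B :: "'a::idom set"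
  assumes zero_mem: "0 \<in> B" and one_mem: "1 \<in> B"
    and add_mem: "a \<in> B \<Longrightarrow> b \<in> B \<Longrightarrow> a + b \<in> B"
    and mult_mem: "a \<in> B \<Longrightarrow> b \<in> B \<Longrightarrow> a * b \<in> B"
    and uminus_mem: "a \<in> B \<Longrightarrow> - a \<in> B"
begin

lemma diff_mem: "a \<in> B \<Longrightarrow> b \<in> B \<Longrightarrow> a - b \<in> B"
  using add_mem[of a "-b"] uminus_mem[of b] by simp

lemma sum_mem: "(\<And>i. i \<in> I \<Longrightarrow> f i \<in> B) \<Longrightarrow> sum f I \<in> B"
  by (induction I rule: infinite_finite_induct) (auto intro: zero_mem add_mem)

lemma power_mem: "a \<in> B \<Longrightarrow> a ^ n \<in> B"
  by (induction n) (auto intro: one_mem mult_mem)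

lemma of_nat_mem: "of_nat n \<in> B"
  by (induction n) (auto intro: one_mem add_mem zero_mem)

lemma poly_mem: "coeffs_in B F \<Longrightarrow> a \<in> B \<Longrightarrow> poly F a \<in> B"
  unfolding poly_altdef coeffs_in_def by (intro sum_mem mult_mem power_mem) auto

lemma coeffs_in_0: "coeffs_in B 0"
  by (simp add: coeffs_in_def zero_mem)

lemma coeffs_in_pCons: "coeffs_in B (pCons a F) \<longleftrightarrow> a \<in> B \<and> coeffs_in B F"
  unfolding coeffs_in_def
proof safe
  assume "\<forall>i. coeff (pCons a F) i \<in> B"
  thus "a \<in> B" "\<And>i. coeff F i \<in> B" by (metis coeff_pCons_0, metis coeff_pCons_Suc)
qed (auto simp: coeff_pCons split: nat.splits)

lemma coeffs_in_add: "coeffs_in B F \<Longrightarrow> coeffs_in B G \<Longrightarrow> coeffs_in B (F + G)"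
  by (auto simp: coeffs_in_def add_mem)

lemma coeffs_in_mult: "coeffs_in B F \<Longrightarrow> coeffs_in B G \<Longrightarrow> coeffs_in B (F * G)"
  by (auto simp: coeffs_in_def coeff_mult intro!: sum_mem mult_mem)

lemma coeffs_in_uminus: "coeffs_in B F \<Longrightarrow> coeffs_in B (- F)"
  by (auto simp: coeffs_in_def uminus_mem)

lemma coeffs_in_monom: "a \<in> B \<Longrightarrow> coeffs_in B (monom a n)"
  by (auto simp: coeffs_in_def zero_mem)

lemma coeffs_in_pderiv: "coeffs_in B F \<Longrightarrow> coeffs_in B (pderiv F)"
  unfolding coeffs_in_def coeff_pderiv by (auto intro!: mult_mem simp: of_nat_mem simp del: of_nat_Suc)

lemma coeffs_in_1: "coeffs_in B 1"
  using coeffs_in_pCons[of 1 0] one_mem coeffs_in_0 by (simp only: pCons_one)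

lemma coeffs_in_subring: "subring_set {F. coeffs_in B F}"
  by unfold_locales
    (simp_all add: coeffs_in_add coeffs_in_mult coeffs_in_uminus coeffs_in_0 coeffs_in_1)

lemma coeffs_in_pcompose: "coeffs_in B F \<Longrightarrow> coeffs_in B G \<Longrightarrow> coeffs_in B (pcompose F G)"
  by (induction F) (auto simp: pcompose_pCons coeffs_in_pCons coeffs_in_0 zero_mem
      intro!: coeffs_in_add coeffs_in_mult)

end

text \<open>
  A subring $B$ and an element $s$ of a domain such that $R$ is the polynomial ring $B[s]$. The
  variable of a polynomial ring over $B$ is the typical $s$; here it is one of several ways of
  presenting one and the same $R$.
\<close>

locale free_adjunction = subring_set B for B :: "'a::idom set" +
  fixes R :: "'a set" and s :: 'a
  assumes poly_in: "coeffs_in B F \<Longrightarrow> poly F s \<in> R"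
    and ex_poly: "r \<in> R \<Longrightarrow> \<exists>F. coeffs_in B F \<and> poly F s = r"
    and poly_inj: "coeffs_in B F \<Longrightarrow> poly F s = 0 \<Longrightarrow> F = 0"
begin

definition expand :: "'a \<Rightarrow> 'a poly" where
  "expand r = (SOME F. coeffs_in B F \<and> poly F s = r)"

lemma expand: assumes "r \<in> R" shows coeffs_in_expand: "coeffs_in B (expand r)"
  and poly_expand: "poly (expand r) s = r"
  using someI_ex[OF ex_poly[OF assms]] unfolding expand_def by auto

lemma expand_unique: assumes "coeffs_in B F" shows "expand (poly F s) = F"
proof -
  have "poly F s \<in> R" using assms by (rule poly_in)
  hence "expand (poly F s) - F = 0"
    using expand assms by (intro poly_inj) (auto simp: coeffs_in_def diff_mem)
  thus ?thesis by simp
qed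

lemma base_subset: "B \<subseteq> R"
  using poly_in[of "[:b:]" for b] by (force simp: coeffs_in_pCons coeffs_in_0)

lemma gen_mem: "s \<in> R"
  using poly_in[of "[:0,1:]"]
  by (simp add: coeffs_in_pCons coeffs_in_0 zero_mem one_mem del: pCons_one)

sublocale R: subring_set R
proof
  show "0 \<in> R" "1 \<in> R" using base_subset zero_mem one_mem by auto
next
  fix a b assume ab: "a \<in> R" "b \<in> R"
  show "a + b \<in> R" using poly_in[OF coeffs_in_add[OF expand(1) expand(1)], OF ab]
    by (simp add: expand(2) ab)
  show "a * b \<in> R" using poly_in[OF coeffs_in_mult[OF expand(1) expand(1)], OF ab]
    by (simp add: expand(2) ab)
next
  fix a assume a: "a \<in> R"
  show "- a \<in> R" using poly_in[OF coeffs_in_uminus[OF expand(1)], OF a]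
    by (simp add: expand(2) a)
qed

lemma expand_add: "a \<in> R \<Longrightarrow> b \<in> R \<Longrightarrow> expand (a + b) = expand a + expand b"
  using expand_unique[OF coeffs_in_add[OF expand(1) expand(1)], of a b] by (simp add: expand(2))

lemma expand_mult: "a \<in> R \<Longrightarrow> b \<in> R \<Longrightarrow> expand (a * b) = expand a * expand b"
  using expand_unique[OF coeffs_in_mult[OF expand(1) expand(1)], of a b] by (simp add: expand(2))

lemma expand_base: "b \<in> B \<Longrightarrow> expand b = [:b:]"
  using expand_unique[of "[:b:]"] by (simp add: coeffs_in_pCons coeffs_in_0)

lemma expand_gen: "expand s = [:0, 1:]"
  using expand_unique[of "[:0,1:]"]
  by (simp add: coeffs_in_pCons coeffs_in_0 zero_mem one_mem del: pCons_one)

lemma expand_0: "expand 0 = 0" and expand_1: "expand 1 = 1"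
  using expand_unique[OF coeffs_in_0] expand_unique[OF coeffs_in_1] by simp_all

lemma expand_power: "a \<in> R \<Longrightarrow> expand (a ^ n) = expand a ^ n"
  by (induction n) (auto simp: expand_1 expand_mult R.power_mem)

lemma expand_sum: "(\<And>i. i \<in> I \<Longrightarrow> f i \<in> R) \<Longrightarrow> expand (sum f I) = (\<Sum>i\<in>I. expand (f i))"
  by (induction I rule: infinite_finite_induct) (auto simp: expand_0 expand_add R.sum_mem)

lemma expand_eq_0_iff: "a \<in> R \<Longrightarrow> expand a = 0 \<longleftrightarrow> a = 0"
  using expand(2)[of a] expand_0 by auto

lemma mem_base_iff: "a \<in> R \<Longrightarrow> a \<in> B \<longleftrightarrow> degree (expand a) = 0"
proof
  assume a: "a \<in> R" "degree (expand a) = 0"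
  then obtain c where c: "expand a = [:c:]" by (metis degree_eq_zeroE)
  with expand[OF a(1)] show "a \<in> B" by (simp add: coeffs_in_pCons)
qed (auto simp: expand_base)

text \<open>Degrees in $s$ add up, so the factors of an element of degree 0 have degree 0.\<close>

lemma base_factor_closed:
  assumes "a \<in> R" "b \<in> R" "a * b \<in> B" "a * b \<noteq> 0" shows "a \<in> B"
proof -
  have "degree (expand a * expand b) = 0"
    using assms mem_base_iff[of "a*b"] R.mult_mem by (simp add: expand_mult)
  moreover have "expand a \<noteq> 0" "expand b \<noteq> 0" using assms by (auto simp: expand_eq_0_iff)
  ultimately have "degree (expand a) = 0" by (simp add: degree_mult_eq)
  thus ?thesis using assms mem_base_iff by auto
qed

end

section \<open>Cancelling a variable from the polynomial ring in two variables\<close>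

text \<open>By Gaussian elimination of one equation and one unknown.\<close>

lemma underdetermined_system:
  fixes M :: "'i \<Rightarrow> 'j \<Rightarrow> 'k::field"
  assumes "finite J" "finite I" "card J < card I"
  shows "\<exists>c. (\<exists>i\<in>I. c i \<noteq> 0) \<and> (\<forall>j\<in>J. (\<Sum>i\<in>I. c i * M i j) = 0)"
  using assms
proof (induction J arbitrary: I M rule: finite_induct)
  case empty
  then obtain i where "i \<in> I" by (metis card.empty card_gt_0_iff ex_in_conv)
  thus ?case by (intro exI[of _ "\<lambda>_. 1"]) auto
next
  case (insert j J)
  show ?case
  proof (cases "\<forall>i\<in>I. M i j = 0")
    case True
    have "card J < card I" using insert by auto
    from insert.IH[OF \<open>finite I\<close> this, of M] obtain c where
      c: "\<exists>i\<in>I. c i \<noteq> 0" "\<forall>k\<in>J. (\<Sum>i\<in>I. c i * M i k) = 0" by blast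
    have "(\<Sum>i\<in>I. c i * M i j) = 0" using True by (intro sum.neutral) simp
    with c show ?thesis by (intro exI[of _ c]) simp
  next
    case False
    then obtain i0 where i0: "i0 \<in> I" "M i0 j \<noteq> 0" by auto
    define I' where "I' = I - {i0}"
    have I': "finite I'" "card J < card I'" "I = insert i0 I'" "i0 \<notin> I'"
      using insert.prems insert.hyps i0(1) by (simp_all add: I'_def insert_absorb)
    define M' where "M' = (\<lambda>i k. M i k - M i j / M i0 j * M i0 k)"
    from insert.IH[OF I'(1,2), of M'] obtain c where
      c: "\<exists>i\<in>I'. c i \<noteq> 0" "\<And>k. k \<in> J \<Longrightarrow> (\<Sum>i\<in>I'. c i * M' i k) = 0" by auto
    define S where "S = (\<Sum>i\<in>I'. c i * (M i j / M i0 j))"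
    define c' where "c' = c(i0 := - S)"
    have *: "(\<Sum>i\<in>I. c' i * M i k) = (\<Sum>i\<in>I'. c i * M' i k)" for k
    proof -
      have "(\<Sum>i\<in>I. c' i * M i k) = - S * M i0 k + (\<Sum>i\<in>I'. c i * M i k)"
        unfolding I'(3) using I'(1,4) by (simp add: c'_def) (intro sum.cong; auto)
      also have "S * M i0 k = (\<Sum>i\<in>I'. c i * (M i j / M i0 j * M i0 k))"
        unfolding S_def sum_distrib_right by (intro sum.cong) auto
      then have "- S * M i0 k + (\<Sum>i\<in>I'. c i * M i k) = (\<Sum>i\<in>I'. c i * M' i k)"
        by (simp add: M'_def right_diff_distrib sum_subtractf)
      finally show ?thesis .
    qed
    have "(\<Sum>i\<in>I'. c i * M' i j) = 0" using i0 by (simp add: M'_def)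
    hence "\<forall>k\<in>insert j J. (\<Sum>i\<in>I. c' i * M i k) = 0" using * c by auto
    moreover have "\<exists>i\<in>I. c' i \<noteq> 0" using c(1) I' by (auto simp: c'_def)
    ultimately show ?thesis by blast
  qed
qed

text \<open>
  Over an algebraically closed field a polynomial splits into linear factors, and a prime divisor of
  its value divides one of them.
\<close>

lemma (in idom_hom) prime_dvd_eval_imp_dvd_linear:
  assumes "prime_elem P" "q \<noteq> 0" "P dvd poly (map_poly hom q) a"
    and closed: "\<And>p :: 'a poly. degree p > 0 \<Longrightarrow> \<exists>x. poly p x = 0"
    and unit: "\<And>c. c \<noteq> 0 \<Longrightarrow> hom c dvd 1"
  shows "\<exists>c. P dvd a - hom c"
  using assms(2,3)
proof (induction "degree q" arbitrary: q)
  interpret mp: map_poly_idom_hom hom ..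
  case 0
  then obtain c where c: "q = [:c:]" by (metis degree_eq_zeroE)
  with 0 have "c \<noteq> 0" "P dvd hom c" by (auto simp: map_poly_pCons_hom)
  hence "P dvd 1" using unit dvd_trans by blast
  thus ?case using assms(1) by (simp add: prime_elem_def)
next
  interpret mp: map_poly_idom_hom hom ..
  case (Suc n)
  then obtain x where x: "poly q x = 0" using closed[of q] by auto
  then obtain r where r: "q = [:-x, 1:] * r" by (auto simp: poly_eq_0_iff_dvd)
  hence r0: "r \<noteq> 0" using Suc by auto
  have "poly (map_poly hom q) a = (a - hom x) * poly (map_poly hom r) a"
    by (simp only: r mp.hom_mult poly_mult) (simp add: map_poly_pCons_hom hom_distribs)
  with Suc.prems assms(1) consider "P dvd a - hom x" | "P dvd poly (map_poly hom r) a"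
    by (metis prime_elem_dvd_multD)
  thus ?case
  proof cases
    case 2
    have "n = degree r" using Suc.hyps(2) r0 unfolding r by (subst (asm) degree_mult_eq) simp_all
    from Suc.hyps(1)[OF this r0 2] show ?thesis .
  qed auto
qed

definition const2 :: "'k::zero \<Rightarrow> 'k poly poly" where
  "const2 c = [:[:c:]:]"

interpretation const2: idom_hom "const2 :: 'k::field \<Rightarrow> _"
  by unfold_locales (simp_all add: const2_def)

interpretation const2_poly: map_poly_idom_hom "const2 :: 'k::field \<Rightarrow> _" ..

lemma const2_mult_coeff: "coeff (coeff (const2 c * w) u) v = c * coeff (coeff w u) v"
  by (simp add: const2_def)

definition bidegree_le :: "nat \<Rightarrow> 'k::zero poly poly \<Rightarrow> bool" where
  "bidegree_le d w \<longleftrightarrow> (\<forall>u v. u > d \<or> v > d \<longrightarrow> coeff (coeff w u) v = 0)"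

lemma bidegree_le_mono: "bidegree_le d w \<Longrightarrow> d \<le> e \<Longrightarrow> bidegree_le e w"
  by (auto simp: bidegree_le_def)

lemma bidegree_le_mult:
  fixes w z :: "'k::comm_semiring_0 poly poly"
  assumes "bidegree_le d w" "bidegree_le e z" shows "bidegree_le (d + e) (w * z)"
  unfolding bidegree_le_def
proof (intro allI impI)
  fix u v assume uv: "u > d + e \<or> v > d + e"
  have "coeff (coeff w i) j * coeff (coeff z (u - i)) (v - j) = 0" if "i \<le> u" "j \<le> v" for i j
  proof -
    have "i > d \<or> u - i > e \<or> j > d \<or> v - j > e" using uv that by linarith
    thus ?thesis using assms unfolding bidegree_le_def by auto
  qed
  thus "coeff (coeff (w * z) u) v = 0"
    by (auto simp: coeff_mult coeff_sum intro!: sum.neutral)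
qed

lemma bidegree_le_power:
  fixes w :: "'k::comm_semiring_1 poly poly"
  assumes "bidegree_le d w" shows "bidegree_le (n * d) (w ^ n)"
proof (induction n)
  case 0
  show ?case by (auto simp: bidegree_le_def coeff_1)
next
  case (Suc n)
  from bidegree_le_mult[OF assms Suc] show ?case by simp
qed

lemma ex_bidegree_le: "\<exists>d. bidegree_le d (w :: 'k::zero poly poly)"
proof (intro exI)
  let ?d = "degree w + (\<Sum>i\<le>degree w. degree (coeff w i))"
  show "bidegree_le ?d w"
    unfolding bidegree_le_def
  proof (intro allI impI)
    fix u v assume uv: "?d < u \<or> ?d < v"
    show "coeff (coeff w u) v = 0"
    proof (cases "u \<le> degree w")
      case True
      have "degree (coeff w u) \<le> (\<Sum>i\<le>degree w. degree (coeff w i))"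
        using True by (intro member_le_sum) auto
      with uv True show ?thesis by (intro coeff_eq_0) linarith
    qed (simp add: coeff_eq_0)
  qed
qed

text \<open>
  The monomials $a^i b^j s^l$ with exponents at most $N$ are of the order of $N^3$ many, but lie in a
  space of polynomials of bidegree $O(N)$, which has dimension $O(N^2)$.
\<close>

lemma three_elements_dependent:
  fixes a b s :: "'k::field poly poly"
  obtains N c where "\<exists>i\<le>N. \<exists>j\<le>N. \<exists>l\<le>N. c i j l \<noteq> 0"
    and "(\<Sum>l\<le>N. \<Sum>j\<le>N. \<Sum>i\<le>N. const2 (c i j l) * a ^ i * b ^ j * s ^ l) = 0"
proof -
  obtain d1 d2 d3 where d123: "bidegree_le d1 a" "bidegree_le d2 b" "bidegree_le d3 s"
    by (metis ex_bidegree_le)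
  define d where "d = d1 + d2 + d3"
  have d: "bidegree_le d a" "bidegree_le d b" "bidegree_le d s"
    using d123 by (auto simp: d_def elim: bidegree_le_mono)
  \<comment> \<open>With this \<open>N\<close> and \<open>K = 3 N d\<close>, the bound \<open>(K + 1)\<^sup>2 \<le> (3 N (d + 1))\<^sup>2 = N ^ 3\<close> holds.\<close>
  define N where "N = 9 * (d + 1)\<^sup>2"
  define K where "K = 3 * N * d"
  define I where "I = {..N} \<times> {..N} \<times> {..N}"
  define J where "J = {..K} \<times> {..K}"
  define mono where "mono = (\<lambda>(i,j,l). a ^ i * b ^ j * s ^ l)"
  define M where "M = (\<lambda>x (u,v). coeff (coeff (mono x) u) v)"
  have "K + 1 \<le> 3 * N * (d + 1)" by (simp add: K_def N_def power2_eq_square)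
  hence "(K + 1)\<^sup>2 \<le> (3 * N * (d + 1))\<^sup>2" by (intro power_mono) auto
  also have "\<dots> = N ^ 3" by (simp add: N_def power2_eq_square power3_eq_cube algebra_simps)
  also have "\<dots> < (N + 1) ^ 3" by (intro power_strict_mono) auto
  finally have "card J < card I"
    by (simp add: I_def J_def card_cartesian_product power2_eq_square power3_eq_cube algebra_simps)
  from underdetermined_system[OF _ _ this, of M] obtain c where
    c: "\<exists>x\<in>I. c x \<noteq> 0" "\<And>y. y \<in> J \<Longrightarrow> (\<Sum>x\<in>I. c x * M x y) = 0"
    by (auto simp: I_def J_def)
  have bd: "bidegree_le K (mono x)" if xI: "x \<in> I" for x
  proof -
    obtain i j l where x: "x = (i,j,l)" "i \<le> N" "j \<le> N" "l \<le> N" using xI by (auto simp: I_def)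
    have "bidegree_le (i * d + j * d + l * d) (mono x)"
      unfolding x mono_def prod.case by (intro bidegree_le_mult bidegree_le_power d)
    moreover have "i * d + j * d + l * d \<le> N * d + N * d + N * d"
      using x by (intro add_mono mult_right_mono) auto
    ultimately show ?thesis by (elim bidegree_le_mono) (simp add: K_def)
  qed
  have "(\<Sum>x\<in>I. const2 (c x) * mono x) = 0" (is "?S = 0")
  proof (intro poly_eqI)
    fix u v
    have *: "coeff (coeff ?S u) v = (\<Sum>x\<in>I. c x * coeff (coeff (mono x) u) v)"
      by (simp add: coeff_sum const2_mult_coeff)
    show "coeff (coeff ?S u) v = coeff (coeff 0 u) v"
    proof (cases "(u,v) \<in> J")
      case True
      from c(2)[OF this] show ?thesis by (simp add: * M_def)
    next
      case False
      hence "u > K \<or> v > K" by (auto simp: J_def)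
      hence "coeff (coeff (mono x) u) v = 0" if "x \<in> I" for x
        using bd[OF that] by (auto simp: bidegree_le_def)
      thus ?thesis unfolding * by simp
    qed
  qed
  also have "?S = (\<Sum>i\<le>N. \<Sum>j\<le>N. \<Sum>l\<le>N. const2 (c (i,j,l)) * a ^ i * b ^ j * s ^ l)"
    unfolding I_def by (simp add: sum.cartesian_product' mono_def mult.assoc)
  also have "\<dots> = (\<Sum>i\<le>N. \<Sum>l\<le>N. \<Sum>j\<le>N. const2 (c (i,j,l)) * a ^ i * b ^ j * s ^ l)"
    by (intro sum.cong refl sum.swap)
  also have "\<dots> = (\<Sum>l\<le>N. \<Sum>i\<le>N. \<Sum>j\<le>N. const2 (c (i,j,l)) * a ^ i * b ^ j * s ^ l)"
    by (rule sum.swap)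
  also have "\<dots> = (\<Sum>l\<le>N. \<Sum>j\<le>N. \<Sum>i\<le>N. const2 (c (i,j,l)) * a ^ i * b ^ j * s ^ l)"
    by (intro sum.cong refl sum.swap)
  finally have "(\<Sum>l\<le>N. \<Sum>j\<le>N. \<Sum>i\<le>N. const2 (c (i,j,l)) * a ^ i * b ^ j * s ^ l) = 0" by simp
  moreover have "\<exists>i\<le>N. \<exists>j\<le>N. \<exists>l\<le>N. c (i,j,l) \<noteq> 0" using c(1) by (auto simp: I_def)
  ultimately show thesis by (intro that[of N "\<lambda>i j l. c (i,j,l)"])
qed

text \<open>
  A substitute for the total degree: it is additive on products as well, and only constants have
  degree 0.
\<close>

definition lexdeg :: "'k::zero poly poly \<Rightarrow> nat" where
  "lexdeg w = degree w + degree (lead_coeff w)"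

lemma lexdeg_mult: "w \<noteq> 0 \<Longrightarrow> z \<noteq> 0 \<Longrightarrow> lexdeg (w * z) = lexdeg w + lexdeg (z :: 'k::field poly poly)"
  unfolding lexdeg_def lead_coeff_mult by (simp add: degree_mult_eq)

lemma lexdeg_eq_0: "lexdeg w = 0 \<Longrightarrow> \<exists>c. w = const2 c"
  unfolding lexdeg_def const2_def
  by (metis add_is_0 coeff_pCons_0 degree_eq_zeroE)

text \<open>The situation of cancelling a variable from the affine plane: $k[z,t] = C[s]$.\<close>

locale plane_adjunction = free_adjunction C UNIV s
  for C :: "'k::alg_closed_field poly poly set" and s +
  assumes const2_mem: "const2 c \<in> C"
begin

text \<open>
  For a prime element $p$ of $C$ the residue ring $C/(p)$ is the field $k$: an element $a$ of $C$ is
  algebraically dependent on $p$, because $a$, $p$ and $s$ are dependent and $s$ is free over $C$. A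
  relation between $a$ and $p$ that is not divisible by $p$ becomes modulo $p$ an equation for $a$
  over $k$.
\<close>

lemma prime_dvd_linear:
  assumes a: "a \<in> C" and p: "p \<in> C" "prime_elem p"
  shows "\<exists>c. p dvd a - const2 c"
proof -
  obtain N c where c: "\<exists>i\<le>N. \<exists>j\<le>N. \<exists>l\<le>N. c i j l \<noteq> 0"
    and eq: "(\<Sum>l\<le>N. \<Sum>j\<le>N. \<Sum>i\<le>N. const2 (c i j l) * a ^ i * p ^ j * s ^ l) = 0"
    by (rule three_elements_dependent)
  from c obtain l where l: "l \<le> N" and cl: "\<exists>i\<le>N. \<exists>j\<le>N. c i j l \<noteq> 0" by blast
  define S where "S = (\<lambda>l. \<Sum>j\<le>N. \<Sum>i\<le>N. const2 (c i j l) * a ^ i * p ^ j)"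
  define F where "F = (\<Sum>l\<le>N. monom (S l) l)"
  have "S l \<in> C" for l unfolding S_def
    by (intro sum_mem mult_mem power_mem a p const2_mem)
  hence FC: "coeffs_in C F"
    by (auto simp: F_def coeffs_in_def coeff_sum intro!: sum_mem zero_mem)
  have "poly F s = 0" unfolding F_def using eq
    by (simp add: poly_sum poly_monom S_def sum_distrib_right)
  with FC have "F = 0" by (rule poly_inj)
  hence "coeff F l = 0" by simp
  hence Sl: "S l = 0" using l by (simp add: F_def coeff_sum)
  \<comment> \<open>Dividing the relation by \<open>p ^ j0\<close> leaves a relation with a nonzero part free of \<open>p\<close>.\<close>
  define j0 where "j0 = (LEAST j. \<exists>i\<le>N. j \<le> N \<and> c i j l \<noteq> 0)"
  have "\<exists>i\<le>N. j0 \<le> N \<and> c i j0 l \<noteq> 0" unfolding j0_def by (rule LeastI_ex) (use cl in blast)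
  then obtain i0 where i0: "i0 \<le> N" "j0 \<le> N" "c i0 j0 l \<noteq> 0" by blast
  define T where "T = (\<lambda>j. \<Sum>i\<le>N. const2 (c i j l) * a ^ i)"
  have T0: "T j = 0" if "j < j0" for j
  proof -
    have "c i j l = 0" if "i \<le> N" for i
      using not_less_Least[OF \<open>j < j0\<close>[unfolded j0_def]] that \<open>j < j0\<close> i0 by auto
    thus ?thesis by (simp add: T_def)
  qed
  have "0 = (\<Sum>j\<le>N. T j * p ^ j)" using Sl by (simp add: S_def T_def sum_distrib_right)
  also have "\<dots> = (\<Sum>j\<in>{j0..N}. T j * p ^ j)"
    by (intro sum.mono_neutral_right) (auto simp: T0)
  also have "\<dots> = p ^ j0 * (\<Sum>j\<in>{j0..N}. T j * p ^ (j - j0))"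
    by (simp add: sum_distrib_left mult.left_commute flip: power_add)
  finally have "(\<Sum>j\<in>{j0..N}. T j * p ^ (j - j0)) = 0" using p by (auto simp: prime_elem_def)
  also have "{j0..N} = insert j0 {j0<..N}" using i0 by auto
  finally have "T j0 = - (\<Sum>j\<in>{j0<..N}. T j * p ^ (j - j0))" by (simp add: eq_neg_iff_add_eq_0)
  moreover have "p dvd (\<Sum>j\<in>{j0<..N}. T j * p ^ (j - j0))"
    by (intro dvd_sum dvd_mult) (auto intro: dvd_power)
  ultimately have dvd: "p dvd T j0" by simp
  define q where "q = (\<Sum>i\<le>N. monom (c i j0 l) i)"
  have "coeff q i0 \<noteq> 0" using i0 by (simp add: q_def coeff_sum)
  hence "q \<noteq> 0" by auto
  moreover have "T j0 = poly (map_poly const2 q) a"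
    by (simp add: T_def q_def const2_poly.hom_sum poly_sum poly_monom const2.map_poly_hom_monom)
  moreover have "const2 x dvd 1" if "x \<noteq> 0" for x :: 'k
    using that by (auto simp: const2_def)
  ultimately show ?thesis
    using const2.prime_dvd_eval_imp_dvd_linear[OF p(2), of q a] dvd alg_closed_imp_poly_has_root by auto
qed

text \<open>
  If $C = k$, then $z$ and $t$ are polynomials in $s$ over $k$. As $z$ has degree 0 in $t$, so has
  $s$, and then also $t$.
\<close>

lemma base_not_const: "\<exists>h\<in>C. h \<notin> range const2"
proof (rule ccontr)
  assume "\<not> ?thesis"
  hence C: "C \<subseteq> range const2" by auto
  have *: "\<exists>f. degree w = degree f * degree s
      \<and> w = poly (map_poly const2 f) s" for w
  proof -
    define F where "F = expand w"
    have "coeffs_in C F" and w: "w = poly F s" using expand[of w] by (auto simp: F_def)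
    hence "\<forall>i. \<exists>c. coeff F i = const2 c" using C by (auto simp: coeffs_in_def)
    then obtain f where f: "\<And>i. coeff F i = const2 (f i)" by metis
    define g where "g = Abs_poly f"
    have "eventually (\<lambda>i. f i = 0) cofinite"
      using MOST_coeff_eq_0[of F] by eventually_elim (use f in \<open>auto simp: const2_def\<close>)
    hence "coeff g = f" by (simp add: g_def Abs_poly_inverse)
    hence "F = map_poly const2 g" by (intro poly_eqI) (simp add: f)
    with w have w: "w = poly (map_poly const2 g) s" by simp
    have "poly (map_poly const2 g) s = pcompose (map_poly (\<lambda>c. [:c:]) g) s"
      by (simp add: pcompose_altdef map_poly_map_poly o_def const2_def [abs_def])
    moreover have "degree (map_poly (\<lambda>c. [:c:]) g) = degree g"
      by (intro degree_map_poly) auto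
    ultimately show ?thesis using w by (metis degree_pcompose)
  qed
  obtain f where f: "degree ([:[:0,1:]:] :: 'k poly poly)
      = degree f * degree s"
    "[:[:0,1:]:] = poly (map_poly const2 f) s" using *[of "[:[:0,1:]:]"] by blast
  obtain g :: "'k poly" where g: "degree ([:0,1:] :: 'k poly poly)
      = degree g * degree s"
    using *[of "[:0,1:]"] by blast
  from g have "degree s \<noteq> 0" by auto
  with f have "degree f = 0" by simp
  then obtain c where "f = [:c:]" by (metis degree_eq_zeroE)
  with f(2) show False by (simp add: const2_def const2.map_poly_pCons_hom)
qed

text \<open>
  As $C$ is closed under taking factors in the factorial ring
  $k[z,t]$, it contains a prime element $p$. Every element of $C$ is congruent to a constant modulo
  $p$, and the quotient has smaller degree; by induction $C = k[p]$.
\<close>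

theorem base_is_polynomial_ring:
  "\<exists>g\<in>C. g \<notin> range const2 \<and> (\<forall>a\<in>C. \<exists>f. a = poly (map_poly const2 f) g)"
proof -
  obtain h where h: "h \<in> C" "h \<notin> range const2" using base_not_const by blast
  have h0: "h \<noteq> 0" using h const2.hom_zero by (metis rangeI)
  have "\<not> h dvd 1"
  proof
    assume "h dvd 1"
    then obtain u where u: "1 = h * u" by auto
    hence "lexdeg h + lexdeg u = lexdeg (1 :: 'k poly poly)"
      using lexdeg_mult[of h u] h0 by (metis mult_zero_right zero_neq_one)
    moreover have "lexdeg (1 :: 'k poly poly) = 0" by (simp add: lexdeg_def)
    ultimately have "lexdeg h = 0" by linarith
    with h lexdeg_eq_0 show False by blast
  qed
  then obtain p where p: "p dvd h" "prime_elem p"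
  proof -
    from mset_factors_exist[OF h0] \<open>\<not> h dvd 1\<close> obtain M where M: "mset_factors M h" by blast
    then obtain p where "p \<in># M" unfolding mset_factors_def by (meson multiset_nonemptyE)
    moreover from this M have "p dvd h" by (auto simp: mset_factors_def dvd_prod_mset)
    ultimately show thesis using M by (intro that[of p]) (auto simp: mset_factors_def prime_elem_iff_irreducible)
  qed
  have p0: "p \<noteq> 0" using p by (auto simp: prime_elem_def)
  have pC: "p \<in> C" using p h h0 by (auto intro: base_factor_closed elim!: dvdE)
  have pconst: "p \<notin> range const2"
  proof
    assume "p \<in> range const2"
    then obtain c where "p = const2 c" by auto
    hence "p dvd 1" using p0 by (auto simp: const2_def)
    thus False using p by (simp add: prime_elem_def)
  qed
  have "\<exists>f. a = poly (map_poly const2 f) p" if "a \<in> C" for a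
    using that
  proof (induction "lexdeg a" arbitrary: a rule: less_induct)
    case less
    obtain c where "p dvd a - const2 c" using prime_dvd_linear[OF less.prems pC p(2)] by blast
    then obtain b where b: "a - const2 c = p * b" by (elim dvdE)
    show ?case
    proof (cases "b = 0")
      case True
      hence "a = poly (map_poly const2 [:c:]) p" using b by (simp add: const2.map_poly_pCons_hom)
      thus ?thesis by blast
    next
      case False
      have bC: "b \<in> C" using b False p0 base_factor_closed[of b p] less.prems const2_mem diff_mem
        by (metis UNIV_I mult.commute no_zero_divisors)
      have "lexdeg p \<noteq> 0" using pconst lexdeg_eq_0 by blast
      moreover have "lexdeg (a - const2 c) = lexdeg p + lexdeg b"
        unfolding b using lexdeg_mult[OF p0 False] .
      moreover have "lexdeg (a - const2 c) \<le> lexdeg a"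
      proof (cases "degree a = 0")
        case True
        then obtain a' where "a = [:a':]" by (metis degree_eq_zeroE)
        thus ?thesis using degree_diff_le[of a' "degree a'" "[:c:]"]
          by (simp add: const2_def lexdeg_def)
      next
        case False
        have "degree (a - const2 c) = degree a" 
          using degree_add_eq_left[of "- const2 c" a] False
          unfolding add_uminus_conv_diff by (simp add: const2_def)
        moreover have "coeff (a - const2 c) (degree a) = coeff a (degree a)"
          using False by (simp add: const2_def coeff_pCons split: nat.splits)
        ultimately show ?thesis by (simp add: lexdeg_def)
      qed
      ultimately have "lexdeg b < lexdeg a" by linarith
      from less.hyps[OF this bC] obtain f where f: "b = poly (map_poly const2 f) p" by blast
      have "a = const2 c + p * b" using b by (simp add: algebra_simps)
      hence "a = poly (map_poly const2 (pCons c f)) p"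
        using f by (simp add: const2.map_poly_pCons_hom)
      thus ?thesis by blast
    qed
  qed
  with pC pconst show ?thesis by blast
qed

end

section \<open>Polynomials in several variables\<close>

abbreviation "lookup \<equiv> Poly_Mapping.lookup"
abbreviation "keys \<equiv> Poly_Mapping.keys"
abbreviation "single \<equiv> Poly_Mapping.single"

subsection \<open>Evaluation\<close>

definition mon_eval :: "(nat \<Rightarrow> 'r::comm_ring_1) \<Rightarrow> (nat \<Rightarrow>\<^sub>0 nat) \<Rightarrow> 'r" where
  "mon_eval \<xi> m = (\<Prod>i\<in>keys m. \<xi> i ^ lookup m i)"

definition evalp :: "('k::field \<Rightarrow> 'r::comm_ring_1) \<Rightarrow> (nat \<Rightarrow> 'r) \<Rightarrow> 'k mpol \<Rightarrow> 'r" where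
  "evalp h \<xi> p = (\<Sum>m\<in>keys p. h (lookup p m) * mon_eval \<xi> m)"

lemma mon_eval_superset:
  assumes "finite S" "keys m \<subseteq> S" shows "mon_eval \<xi> m = (\<Prod>i\<in>S. \<xi> i ^ lookup m i)"
  unfolding mon_eval_def using assms
  by (intro prod.mono_neutral_left) (auto simp: in_keys_iff)

lemma mon_eval_0 [simp]: "mon_eval \<xi> 0 = 1" by (simp add: mon_eval_def)

lemma mon_eval_add: "mon_eval \<xi> (a + b) = mon_eval \<xi> a * mon_eval \<xi> b"
proof -
  let ?S = "keys a \<union> keys b"
  have "keys (a + b) \<subseteq> ?S" by (rule Poly_Mapping.keys_add)
  thus ?thesis
    using mon_eval_superset[of ?S "a + b" \<xi>] mon_eval_superset[of ?S a \<xi>] mon_eval_superset[of ?S b \<xi>]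
    by (simp add: lookup_add power_add prod.distrib)
qed

lemma mon_eval_single [simp]: "mon_eval \<xi> (single i n) = \<xi> i ^ n"
  by (cases "n = 0") (simp_all add: mon_eval_def)

lemma exponent_sum: "m = (\<Sum>i\<in>keys m. single i (lookup m i))"
  by (rule poly_mapping_eqI)
    (auto simp: lookup_sum lookup_single when_def in_keys_iff)

lemma exponent_induct [case_names zero single add]:
  assumes "P 0" "\<And>i. P (single i (1::nat))" "\<And>a b. P a \<Longrightarrow> P b \<Longrightarrow> P (a + b)"
  shows "P m"
proof -
  have sg: "P (single i n)" for i n
  proof (induction n)
    case (Suc n)
    have "single i (Suc n) = single i n + single i (1::nat)" by (simp flip: single_add)
    with Suc assms show ?case by metis
  qed (simp add: assms)
  have "P (\<Sum>i\<in>S. single i (lookup m i))" for S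
    by (induction S rule: infinite_finite_induct) (simp_all add: assms sg)
  thus ?thesis using exponent_sum[of m] by metis
qed

lemma mpol_sum: "p = (\<Sum>m\<in>keys p. single m (lookup p m))"
  by (rule poly_mapping_eqI) (auto simp: lookup_sum lookup_single when_def in_keys_iff)

lemma mult_eq_sum_single:
  fixes p q :: "'k::field mpol"
  shows "p * q = (\<Sum>a\<in>keys p. \<Sum>b\<in>keys q. single (a + b) (lookup p a * lookup q b))"
proof -
  have "(\<Sum>a\<in>keys p. single a (lookup p a)) * (\<Sum>b\<in>keys q. single b (lookup q b)) = p * q"
    by (simp only: mpol_sum [symmetric])
  thus ?thesis unfolding sum_product mult_single by (rule sym)
qed

lemma lookup_mult_sum:
  fixes p q :: "'k::field mpol"
  shows "lookup (p * q) m =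
    (\<Sum>a\<in>keys p. \<Sum>b\<in>keys q. if a + b = m then lookup p a * lookup q b else 0)"
  unfolding mult_eq_sum_single lookup_sum lookup_single when_def by (rule refl)

lemma lookup_single_mult:
  fixes q :: "'k::field mpol"
  shows "lookup (single a c * q) (a + m) = c * lookup q m"
proof (cases "c = 0")
  case False
  have "lookup (single a c * q) (a + m) = (\<Sum>b\<in>keys q. if b = m then c * lookup q b else 0)"
    unfolding lookup_mult_sum using False by (simp cong: if_cong)
  thus ?thesis by (simp add: in_keys_iff)
qed simp

lemma lookup_pconst_mult: "lookup (pconst c * q) m = c * lookup q m"
  using lookup_single_mult[of 0 c q m] by (simp add: pconst_def)

lemma pconst_0 [simp]: "pconst 0 = 0" and pconst_1 [simp]: "pconst 1 = 1"
  by (simp_all add: pconst_def)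

lemma pconst_add: "pconst (a + b) = pconst a + pconst b"
  by (simp add: pconst_def single_add)

lemma pconst_mult: "pconst (a * b) = pconst a * pconst b"
  by (simp add: pconst_def mult_single)

interpretation pconst: idom_hom "pconst :: 'k::field \<Rightarrow> _"
  by unfold_locales (simp_all add: pconst_add pconst_mult)

lemma pconst_inj [simp]: "pconst a = pconst b \<longleftrightarrow> a = b"
  by (metis lookup_single_eq pconst_def)

lemma pconst_eq_0_iff [simp]: "pconst a = 0 \<longleftrightarrow> a = 0"
  using pconst_inj[of a 0] by simp

lemma mon_eval_pvar: "mon_eval pvar m = single m (1::'k::field)"
proof (induction m rule: exponent_induct)
  case (single i)
  show ?case by (simp add: pvar_def)
next
  case (add a b)
  thus ?case by (simp add: mon_eval_add mult_single)
qed simp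

lemma single_eq_monomial: "single m c = pconst c * mon_eval pvar m"
  by (simp add: mon_eval_pvar pconst_def mult_single)

context
  fixes h :: "'k::field \<Rightarrow> 'r::comm_ring_1"
  assumes h: "comm_ring_hom h"
begin

interpretation h: comm_ring_hom h by (rule h)

lemma evalp_superset:
  assumes "finite S" "keys p \<subseteq> S" shows "evalp h \<xi> p = (\<Sum>m\<in>S. h (lookup p m) * mon_eval \<xi> m)"
  unfolding evalp_def using assms
  by (intro sum.mono_neutral_left) (auto simp: in_keys_iff)

lemma evalp_single: "evalp h \<xi> (single m c) = h c * mon_eval \<xi> m"
  by (cases "c = 0") (simp_all add: evalp_def)

lemma evalp_add: "evalp h \<xi> (p + q) = evalp h \<xi> p + evalp h \<xi> q"
proof -
  let ?S = "keys p \<union> keys q"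
  have "keys (p + q) \<subseteq> ?S" by (rule Poly_Mapping.keys_add)
  thus ?thesis
    using evalp_superset[of ?S "p + q" \<xi>] evalp_superset[of ?S p \<xi>] evalp_superset[of ?S q \<xi>]
    by (simp add: lookup_add h.hom_add distrib_right sum.distrib)
qed

lemma evalp_0: "evalp h \<xi> 0 = 0" by (simp add: evalp_def)

lemma evalp_sum: "evalp h \<xi> (sum f S) = (\<Sum>i\<in>S. evalp h \<xi> (f i))"
  by (induction S rule: infinite_finite_induct) (simp_all add: evalp_add evalp_0)

lemma evalp_mult: "evalp h \<xi> (p * q) = evalp h \<xi> p * evalp h \<xi> q"
proof -
  have "evalp h \<xi> (p * q) = (\<Sum>a\<in>keys p. \<Sum>b\<in>keys q.
      (h (lookup p a) * mon_eval \<xi> a) * (h (lookup q b) * mon_eval \<xi> b))"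
    unfolding mult_eq_sum_single evalp_sum evalp_single mon_eval_add h.hom_mult
    by (simp add: mult_ac)
  thus ?thesis unfolding evalp_def[of h \<xi> p] evalp_def[of h \<xi> q] sum_product .
qed

lemma evalp_pconst: "evalp h \<xi> (pconst c) = h c"
  unfolding pconst_def evalp_single by simp

lemma evalp_pvar: "evalp h \<xi> (pvar i) = \<xi> i"
  unfolding pvar_def evalp_single by simp

lemma comm_ring_hom_evalp: "comm_ring_hom (evalp h \<xi>)"
  using evalp_pconst[of \<xi> 1] by unfold_locales (simp_all add: evalp_add evalp_mult evalp_0)

end

lemma evalp_id [simp]: "evalp pconst pvar p = p"
  unfolding evalp_def single_eq_monomial[symmetric] by (rule mpol_sum[symmetric])

lemma hom_evalp:
  assumes "comm_ring_hom \<phi>"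
  shows "\<phi> (evalp h \<xi> p) = evalp (\<lambda>c. \<phi> (h c)) (\<lambda>i. \<phi> (\<xi> i)) p"
proof -
  interpret comm_ring_hom \<phi> by fact
  show ?thesis unfolding evalp_def mon_eval_def by (simp add: hom_distribs)
qed

subsection \<open>The ring of polynomials in the first variables\<close>

lemma pconst_in_polys: "pconst c \<in> polys n"
  by (cases "c = 0") (auto simp: polys_def pconst_def)

lemma pvar_in_polys: "i < n \<Longrightarrow> pvar i \<in> polys n"
  by (auto simp: polys_def pvar_def)

lemma single_in_polys: "keys m \<subseteq> {..<n} \<Longrightarrow> single m c \<in> polys n"
  by (cases "c = 0") (auto simp: polys_def)

interpretation polys: subring_set "polys n :: 'k::field mpol set" for n
proof
  show "(0 :: 'k mpol) \<in> polys n" "(1 :: 'k mpol) \<in> polys n" by (auto simp: polys_def)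
next
  fix p q :: "'k mpol" assume pq: "p \<in> polys n" "q \<in> polys n"
  show "p + q \<in> polys n" using pq Poly_Mapping.keys_add[of p q] by (auto simp: polys_def)
  show "p * q \<in> polys n" unfolding polys_def
  proof safe
    fix m x assume "m \<in> keys (p * q)" and x: "x \<in> keys m"
    then obtain a b where ab: "a \<in> keys p" "b \<in> keys q" "m = a + b"
      using Poly_Mapping.keys_mult[of p q] by auto
    with x have "x \<in> keys a \<union> keys b" using Poly_Mapping.keys_add[of a b] by auto
    with ab pq show "x < n" by (auto simp: polys_def)
  qed
next
  fix p :: "'k mpol" assume "p \<in> polys n"
  thus "- p \<in> polys n" by (auto simp: polys_def in_keys_iff)
qed

lemma polys_induct [consumes 1, case_names pconst pvar add mult]:
  assumes "p \<in> polys n" "\<And>c. P (pconst c)" "\<And>i. i < n \<Longrightarrow> P (pvar i)"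
    and add: "\<And>p q. p \<in> polys n \<Longrightarrow> q \<in> polys n \<Longrightarrow> P p \<Longrightarrow> P q \<Longrightarrow> P (p + q)"
    and mult: "\<And>p q. p \<in> polys n \<Longrightarrow> q \<in> polys n \<Longrightarrow> P p \<Longrightarrow> P q \<Longrightarrow> P (p * q)"
  shows "P (p :: 'k::field mpol)"
proof -
  have one: "1 \<in> polys n \<and> P 1" using assms(2)[of 1] polys.one_mem by simp
  have zero: "0 \<in> polys n \<and> P 0" using assms(2)[of 0] polys.zero_mem by simp
  have pow: "(pvar i :: 'k mpol) ^ k \<in> polys n \<and> P (pvar i ^ k)" if "i < n" for i k
  proof (induction k)
    case (Suc k)
    thus ?case
      using mult[OF pvar_in_polys[OF that], of "pvar i ^ k"] assms(3)[OF that]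
      by (simp add: polys.mult_mem pvar_in_polys that)
  qed (use one in simp)
  have prd: "(\<And>i. i \<in> S \<Longrightarrow> f i \<in> polys n \<and> P (f i)) \<Longrightarrow> prod f S \<in> polys n \<and> P (prod f S)"
    for f and S :: "nat set"
    by (induction S rule: infinite_finite_induct) (use one in \<open>auto intro!: mult polys.mult_mem\<close>)
  have sm: "(\<And>i. i \<in> S \<Longrightarrow> f i \<in> polys n \<and> P (f i)) \<Longrightarrow> sum f S \<in> polys n \<and> P (sum f S)"
    for f and S :: "(nat \<Rightarrow>\<^sub>0 nat) set"
    by (induction S rule: infinite_finite_induct) (use zero in \<open>auto intro!: add polys.add_mem\<close>)
  have "(mon_eval pvar m :: 'k mpol) \<in> polys n \<and> P (mon_eval pvar m)" if "m \<in> keys p" for m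
    unfolding mon_eval_def using assms(1) that by (intro prd pow) (auto simp: polys_def)
  hence "(evalp pconst pvar p :: 'k mpol) \<in> polys n \<and> P (evalp pconst pvar p)"
    unfolding evalp_def by (intro sm) (auto intro!: polys.mult_mem mult pconst_in_polys assms(2))
  thus ?thesis by simp
qed

subsection \<open>The grading\<close>

text \<open>
  Multiplying every variable by the variable of a univariate polynomial ring separates the
  homogeneous components: they become the coefficients.
\<close>

definition grade :: "'k::field mpol \<Rightarrow> 'k mpol poly" where
  "grade = evalp (\<lambda>c. [:pconst c:]) (\<lambda>i. monom (pvar i) 1)"

lemma hom_const_pconst: "comm_ring_hom (\<lambda>c :: 'k::field. [:pconst c:])"
  by unfold_locales (simp_all add: pconst_add pconst_mult)

interpretation grade: comm_ring_hom grade
  unfolding grade_def by (intro comm_ring_hom_evalp hom_const_pconst)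

lemma mon_deg_superset:
  "finite S \<Longrightarrow> keys m \<subseteq> S \<Longrightarrow> mon_deg m = (\<Sum>i\<in>S. lookup m i)"
  unfolding mon_deg_def by (intro sum.mono_neutral_left) (auto simp: in_keys_iff)

lemma mon_deg_add: "mon_deg (a + b) = mon_deg a + mon_deg b"
proof -
  let ?S = "keys a \<union> keys b"
  have "keys (a + b) \<subseteq> ?S" by (rule Poly_Mapping.keys_add)
  thus ?thesis
    using mon_deg_superset[of ?S "a + b"] mon_deg_superset[of ?S a] mon_deg_superset[of ?S b]
    by (simp add: lookup_add sum.distrib)
qed

lemma mon_deg_0 [simp]: "mon_deg 0 = 0" by (simp add: mon_deg_def)

lemma mon_deg_single [simp]: "mon_deg (single i n) = n"
  by (cases "n = 0") (simp_all add: mon_deg_def)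

lemma mon_deg_eq_0_iff: "mon_deg m = 0 \<longleftrightarrow> m = 0"
proof
  assume "mon_deg m = 0"
  hence "lookup m i = 0" for i by (cases "i \<in> keys m") (auto simp: mon_deg_def in_keys_iff)
  thus "m = 0" by (intro poly_mapping_eqI) simp
qed simp

lemma grade_single: "grade (single m c) = monom (single m c) (mon_deg m)"
proof -
  have *: "mon_eval (\<lambda>i. monom (pvar i) 1) m = monom (mon_eval pvar m) (mon_deg m)"
    by (induction m rule: exponent_induct) (simp_all add: mon_eval_add mon_deg_add mult_monom)
  show ?thesis
    unfolding grade_def evalp_single[OF hom_const_pconst] *
    by (simp add: single_eq_monomial[of m c] smult_monom)
qed

lemma grade_pconst: "grade (pconst c) = [:pconst c:]"
  by (simp add: pconst_def grade_single monom_0)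

lemma grade_pvar: "grade (pvar i) = monom (pvar i) 1"
  by (simp add: pvar_def grade_single)

definition hcomp :: "nat \<Rightarrow> 'k::field mpol \<Rightarrow> 'k mpol" where
  "hcomp e p = coeff (grade p) e"

lemma lookup_hcomp: "lookup (hcomp e p) m = (if mon_deg m = e then lookup p m else 0)"
proof -
  have "hcomp e p = (\<Sum>m\<in>keys p. if mon_deg m = e then single m (lookup p m) else 0)"
  proof -
    have "grade p = grade (\<Sum>m\<in>keys p. single m (lookup p m))" by (simp only: mpol_sum [symmetric])
    thus ?thesis unfolding hcomp_def by (simp add: grade.hom_sum coeff_sum grade_single)
  qed
  hence "lookup (hcomp e p) m =
      (\<Sum>x\<in>keys p. lookup (if mon_deg x = e then single x (lookup p x) else 0) m)"
    by (simp add: lookup_sum)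
  also have "\<dots> =
      (\<Sum>x\<in>keys p. if x = m then (if mon_deg m = e then lookup p m else 0) else 0)"
    by (intro sum.cong refl) (simp add: lookup_single when_def)
  finally show ?thesis by (simp add: in_keys_iff)
qed

lemma hcomp_in_hom_part: "p \<in> polys n \<Longrightarrow> hcomp e p \<in> hom_part n e"
  by (auto simp: hom_part_def polys_def in_keys_iff lookup_hcomp split: if_splits)

lemma hcomp_in_polys: "p \<in> polys n \<Longrightarrow> hcomp e p \<in> polys n"
  using hcomp_in_hom_part by (auto simp: hom_part_def)

lemma hcomp_of_hom: "p \<in> hom_part n e \<Longrightarrow> hcomp k p = (if k = e then p else 0)"
  by (rule poly_mapping_eqI) (auto simp: hom_part_def lookup_hcomp in_keys_iff)

lemma grade_of_hom: "p \<in> hom_part n e \<Longrightarrow> grade p = monom p e"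
  by (rule poly_eqI) (simp add: hcomp_of_hom flip: hcomp_def)

lemma hom_part_iff_grade: "p \<in> hom_part n e \<longleftrightarrow> p \<in> polys n \<and> grade p = monom p e"
proof
  assume p: "p \<in> polys n \<and> grade p = monom p e"
  hence "hcomp e p = p" by (simp add: hcomp_def)
  with p hcomp_in_hom_part[of p n e] show "p \<in> hom_part n e" by simp
qed (auto simp: grade_of_hom hom_part_def)

lemma hcomp_add: "hcomp e (p + q) = hcomp e p + hcomp e q"
  by (simp add: hcomp_def grade.hom_add)

lemma hcomp_0 [simp]: "hcomp e 0 = 0"
  by (simp add: hcomp_def grade.hom_zero)

lemma hcomp_sum: "hcomp e (sum f S) = (\<Sum>i\<in>S. hcomp e (f i))"
  by (simp add: hcomp_def grade.hom_sum coeff_sum)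

lemma hcomp_hom_mult: "p \<in> hom_part n k \<Longrightarrow> hcomp (k + e) (p * q) = p * hcomp e q"
  by (simp add: hcomp_def grade.hom_mult grade_of_hom coeff_monom_mult)

lemma sum_hcomp: "p = (\<Sum>e\<le>degree (grade p). hcomp e p)"
proof -
  have "comm_ring_hom (\<lambda>P :: 'a mpol poly. poly P 1)" by unfold_locales simp_all
  from hom_evalp[OF this, of "\<lambda>c. [:pconst c:]" "\<lambda>i. monom (pvar i) 1" p]
  have "poly (grade p) 1 = p" unfolding grade_def by (simp add: poly_monom)
  thus ?thesis by (simp add: poly_altdef hcomp_def)
qed

lemma hom_part_mult:
  "p \<in> hom_part n a \<Longrightarrow> q \<in> hom_part n b \<Longrightarrow> p * q \<in> hom_part n (a + b)"
  unfolding hom_part_iff_grade by (auto simp: grade.hom_mult mult_monom polys.mult_mem)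

lemma hom_part_power: "p \<in> hom_part n a \<Longrightarrow> p ^ k \<in> hom_part n (k * a)"
  unfolding hom_part_iff_grade by (auto simp: grade.hom_power monom_power polys.power_mem mult.commute)

lemma hom_part_add: "p \<in> hom_part n a \<Longrightarrow> q \<in> hom_part n a \<Longrightarrow> p + q \<in> hom_part n a"
  unfolding hom_part_iff_grade by (auto simp: grade.hom_add add_monom polys.add_mem)

lemma zero_in_hom_part: "0 \<in> hom_part n a" by (simp add: hom_part_def polys.zero_mem)

lemma hom_part_sum: "(\<And>i. i \<in> S \<Longrightarrow> f i \<in> hom_part n a) \<Longrightarrow> sum f S \<in> hom_part n a"
  by (induction S rule: infinite_finite_induct) (auto intro: hom_part_add zero_in_hom_part)

lemma hom_part_subset: "p \<in> hom_part n a \<Longrightarrow> p \<in> polys n" by (simp add: hom_part_def)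

lemma pconst_in_hom_part: "pconst c \<in> hom_part n 0"
  by (simp add: hom_part_iff_grade pconst_in_polys grade_pconst monom_0)

lemma pconst_mult_in_hom_part: "p \<in> hom_part n e \<Longrightarrow> pconst c * p \<in> hom_part n e"
  using hom_part_mult[OF pconst_in_hom_part] by fastforce

lemma pvar_in_hom_part: "i < n \<Longrightarrow> pvar i \<in> hom_part n 1"
  by (simp add: hom_part_iff_grade pvar_in_polys grade_pvar)

lemma hom_part_0: "p \<in> hom_part n 0 \<Longrightarrow> p = pconst (lookup p 0)"
  by (rule poly_mapping_eqI)
    (auto simp: hom_part_def pconst_def lookup_single when_def mon_deg_eq_0_iff in_keys_iff)

lemma hcomp_zero: "hcomp 0 p = pconst (lookup p 0)"
  by (rule poly_mapping_eqI)
    (auto simp: lookup_hcomp pconst_def lookup_single when_def mon_deg_eq_0_iff)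

lemma lookup_0_mult: "lookup (p * q) 0 = lookup p 0 * lookup (q :: 'k::field mpol) 0"
proof -
  have "hcomp 0 (p * q) = hcomp 0 p * hcomp 0 q"
    by (simp add: hcomp_def grade.hom_mult coeff_mult)
  thus ?thesis by (simp add: hcomp_zero flip: pconst_mult)
qed

subsection \<open>Partial derivatives\<close>

text \<open>The partial derivative is the linear coefficient of the Taylor expansion.\<close>

definition shift :: "nat \<Rightarrow> 'k::field mpol \<Rightarrow> 'k mpol poly" where
  "shift k = evalp (\<lambda>c. [:pconst c:]) (\<lambda>i. if i = k then [:pvar i, 1:] else [:pvar i:])"

interpretation shift: comm_ring_hom "shift k" for k
  unfolding shift_def by (intro comm_ring_hom_evalp hom_const_pconst)

definition pd :: "nat \<Rightarrow> 'k::field mpol \<Rightarrow> 'k mpol" where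
  "pd k p = coeff (shift k p) 1"

lemma coeff_shift_0: "coeff (shift k p) 0 = p"
proof -
  have "comm_ring_hom (\<lambda>P :: 'a mpol poly. poly P 0)" by unfold_locales simp_all
  note hom_evalp[OF this, of "\<lambda>c. [:pconst c:]" "\<lambda>i. if i = k then [:pvar i, 1:] else [:pvar i:]" p]
  also have "(\<lambda>i. poly (if i = k then [:pvar i, 1:] else [:pvar i:]) 0) = pvar" by auto
  finally have "poly (shift k p) 0 = p" unfolding shift_def by simp
  thus ?thesis by (simp add: poly_0_coeff_0)
qed

lemma pd_add: "pd k (p + q) = pd k p + pd k q" by (simp add: pd_def shift.hom_add)

lemma pd_mult: "pd k (p * q) = p * pd k q + q * pd k p"
  by (simp add: pd_def shift.hom_mult coeff_mult coeff_shift_0)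

lemma pd_pconst [simp]: "pd k (pconst c) = 0"
  by (simp add: pd_def shift_def evalp_pconst[OF hom_const_pconst])

lemma pd_pvar: "pd k (pvar i) = (if i = k then 1 else 0)"
  by (simp add: pd_def shift_def evalp_pvar[OF hom_const_pconst])

lemma pd_sum: "pd k (sum f S) = (\<Sum>i\<in>S. pd k (f i))"
  by (simp add: pd_def shift.hom_sum coeff_sum)

lemma pd_in_polys: "p \<in> polys n \<Longrightarrow> pd k p \<in> polys n"
  by (induction p rule: polys_induct)
    (auto simp: pd_add pd_mult pd_pvar polys.zero_mem polys.one_mem intro!: polys.add_mem polys.mult_mem)

lemma theta_single: "pvar k * pd k (single m c) = of_nat (lookup m k) * single m (c :: 'k::field)"
proof -
  have "pvar k * pd k (single m 1) = of_nat (lookup m k) * single m (1 :: 'k)"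
  proof (induction m rule: exponent_induct)
    case zero
    show ?case using pd_pconst[of k "1::'k"] by simp
  next
    case (single i)
    show ?case using pd_pvar[of k i, where ?'a = 'k] by (simp add: pvar_def lookup_single when_def)
  next
    case (add a b)
    have ab: "single (a + b) (1::'k) = single a 1 * single b 1" by (simp add: mult_single)
    have "pvar k * pd k (single (a + b) (1::'k)) = single a 1 * (pvar k * pd k (single b 1))
        + single b 1 * (pvar k * pd k (single a 1))"
      unfolding ab pd_mult by (simp add: algebra_simps)
    thus ?case unfolding add ab by (simp add: lookup_add algebra_simps)
  qed
  hence "pvar k * pd k (pconst c * single m 1) = of_nat (lookup m k) * (pconst c * single m 1)"
    by (simp add: pd_mult algebra_simps)
  thus ?thesis by (simp add: pconst_def mult_single)
qed

text \<open>
  The Euler derivation $x_k\partial_k$ is diagonal on monomials, so it does not enlarge supports; this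
  makes it more convenient than $\partial_k$ where coefficients are compared.
\<close>

lemma lookup_theta: "lookup (pvar k * pd k p) m = of_nat (lookup m k) * lookup p m"
proof -
  have "pvar k * pd k p = (\<Sum>x\<in>keys p. of_nat (lookup x k) * single x (lookup p x))"
  proof -
    have "pd k p = pd k (\<Sum>m\<in>keys p. single m (lookup p m))" by (simp only: mpol_sum [symmetric])
    thus ?thesis by (simp add: pd_sum sum_distrib_left theta_single)
  qed
  also have "\<dots> = (\<Sum>x\<in>keys p. single x (of_nat (lookup x k) * lookup p x))"
    by (intro sum.cong refl) (simp add: mult_single flip: single_of_nat)
  finally have "lookup (pvar k * pd k p) m =
      (\<Sum>x\<in>keys p. if x = m then of_nat (lookup m k) * lookup p m else 0)"
    by (simp add: lookup_sum lookup_single when_def cong: if_cong)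
  thus ?thesis by (simp add: in_keys_iff)
qed

lemma lookup_pd: "lookup (pd k p) m = of_nat (Suc (lookup m k)) * lookup p (single k 1 + m)"
  using lookup_theta[of k p "single k 1 + m"] lookup_single_mult[of "single k 1" 1 "pd k p" m]
  by (simp add: pvar_def lookup_add)

lemma pd_hom_part:
  assumes "p \<in> hom_part n (Suc e)" shows "pd k p \<in> hom_part n e"
proof -
  have "mon_deg m = e" if "m \<in> keys (pd k p)" for m
  proof -
    have "single k 1 + m \<in> keys p" using that by (auto simp: in_keys_iff lookup_pd)
    hence "mon_deg (single k 1 + m) = Suc e" using assms by (auto simp: hom_part_def)
    thus ?thesis by (simp add: mon_deg_add)
  qed
  thus ?thesis using assms by (simp add: hom_part_def pd_in_polys)
qed

lemma euler:
  assumes "p \<in> hom_part n e" shows "(\<Sum>i<n. pvar i * pd i p) = of_nat e * p"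
proof (rule poly_mapping_eqI)
  fix m
  have "lookup (\<Sum>i<n. pvar i * pd i p) m = of_nat (\<Sum>i<n. lookup m i) * lookup p m"
    by (simp add: lookup_sum lookup_theta sum_distrib_right)
  also have "\<dots> = of_nat e * lookup p m"
  proof (cases "m \<in> keys p")
    case True
    hence "keys m \<subseteq> {..<n}" "mon_deg m = e" using assms by (auto simp: hom_part_def polys_def)
    thus ?thesis using mon_deg_superset[of "{..<n}" m] by simp
  qed (simp add: in_keys_iff)
  also have "\<dots> = lookup (of_nat e * p) m"
    using lookup_single_mult[of 0 "of_nat e" p m] by simp
  finally show "lookup (\<Sum>i<n. pvar i * pd i p) m = lookup (of_nat e * p) m" .
qed

text \<open>
  The monomial order is that of the type class. It is compatible with addition, so the product of the
  leading terms is not met by other terms.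
\<close>

lemma lookup_mult_top:
  fixes p q :: "'k::field mpol"
  assumes "\<And>m. m \<in> keys p \<Longrightarrow> m \<le> a" "\<And>m. m \<in> keys q \<Longrightarrow> m \<le> b"
  shows "lookup (p * q) (a + b) = lookup p a * lookup q b"
proof -
  have *: "x + y = a + b \<longleftrightarrow> x = a \<and> y = b" if "x \<in> keys p" "y \<in> keys q" for x y
    using assms(1)[OF that(1)] assms(2)[OF that(2)]
    by (metis add_le_less_mono add_less_le_mono order.not_eq_order_implies_strict order_less_irrefl)
  have "lookup (p * q) (a + b) =
      (\<Sum>x\<in>keys p. \<Sum>y\<in>keys q. if x = a \<and> y = b then lookup p a * lookup q b else 0)"
    unfolding lookup_mult_sum by (intro sum.cong refl) (auto simp: *)
  also have "\<dots> = (\<Sum>x\<in>keys p. if x = a then lookup p a * lookup q b else 0)"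
    by (intro sum.cong refl) (auto simp: in_keys_iff)
  also have "\<dots> = lookup p a * lookup q b" by (simp add: in_keys_iff)
  finally show ?thesis .
qed

text \<open>
  Subtract a multiple of $g$ from $f$ such that the coefficient of the leading monomial of $g$ becomes
  zero. The difference $h$ satisfies the same equations as $f$, and comparing leading coefficients in
  $h\,x_j\partial_j g = g\,x_j\partial_j h$ shows that the leading monomials of $g$ and $h$ have the
  same exponents, unless $h = 0$.
\<close>

lemma proportional_if_equal_log_derivatives:
  fixes f g :: "'k::field_char_0 mpol"
  assumes fg: "f \<in> polys n" "g \<in> polys n" and g0: "g \<noteq> 0"
    and eq: "\<And>j. j < n \<Longrightarrow> f * pd j g = g * pd j f"
  shows "\<exists>c. f = pconst c * g"
proof -
  define M where "M = Max (keys g)"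
  have fin: "finite (keys g)" "keys g \<noteq> {}" using g0 by auto
  have M: "M \<in> keys g" "\<And>m. m \<in> keys g \<Longrightarrow> m \<le> M" using fin by (auto simp: M_def)
  define h where "h = f - pconst (lookup f M / lookup g M) * g"
  have hM: "lookup h M = 0" using M by (simp add: h_def lookup_minus lookup_pconst_mult in_keys_iff)
  have hp: "h \<in> polys n" unfolding h_def
    by (intro polys.diff_mem polys.mult_mem pconst_in_polys fg)
  have eqh: "h * pd j g = g * pd j h" if "j < n" for j
  proof -
    have "pd j (h + pconst (lookup f M / lookup g M) * g) = pd j f" by (simp add: h_def)
    hence pdh: "pd j h = pd j f - pconst (lookup f M / lookup g M) * pd j g"
      unfolding pd_add pd_mult by (simp add: eq_diff_eq)
    show ?thesis unfolding pdh using eq[OF that] by (simp add: h_def algebra_simps)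
  qed
  have "h = 0"
  proof (rule ccontr)
    assume h0: "h \<noteq> 0"
    define L where "L = Max (keys h)"
    have finh: "finite (keys h)" "keys h \<noteq> {}" using h0 by auto
    have L: "L \<in> keys h" "\<And>m. m \<in> keys h \<Longrightarrow> m \<le> L" using finh by (auto simp: L_def)
    have kth: "m \<in> keys p" if "m \<in> keys (pvar j * pd j p)" for m j and p :: "'k mpol"
      using that by (auto simp: in_keys_iff lookup_theta)
    have "lookup L j = lookup M j" for j
    proof (cases "j < n")
      case True
      have "h * (pvar j * pd j g) = g * (pvar j * pd j h)" using eqh[OF True] by (simp add: ac_simps)
      from arg_cong[OF this, of "\<lambda>p. lookup p (L + M)"]
      have "lookup (h * (pvar j * pd j g)) (L + M) = lookup (g * (pvar j * pd j h)) (M + L)"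
        by (simp only: add.commute)
      hence "lookup h L * (of_nat (lookup M j) * lookup g M)
          = lookup g M * (of_nat (lookup L j) * lookup h L)"
        using L M kth
        by (subst (asm) lookup_mult_top, blast, blast, subst (asm) lookup_mult_top, blast, blast)
          (simp add: lookup_theta)
      thus ?thesis using L(1) M(1) by (simp add: in_keys_iff)
    next
      case False
      have "j \<notin> keys L" "j \<notin> keys M" using False hp fg L M by (auto simp: polys_def)
      thus ?thesis by (simp add: in_keys_iff)
    qed
    hence "L = M" by (intro poly_mapping_eqI)
    with L hM show False by (simp add: in_keys_iff)
  qed
  thus ?thesis unfolding h_def by auto
qed

lemma derivation_formula:
  fixes \<delta> :: "'k::field mpol \<Rightarrow> 'k mpol"
  assumes "p \<in> polys n"
    and "\<And>p q. p \<in> polys n \<Longrightarrow> q \<in> polys n \<Longrightarrow> \<delta> (p + q) = \<delta> p + \<delta> q"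
    and "\<And>p q. p \<in> polys n \<Longrightarrow> q \<in> polys n \<Longrightarrow> \<delta> (p * q) = p * \<delta> q + q * \<delta> p"
    and "\<And>c. \<delta> (pconst c) = 0"
  shows "\<delta> p = (\<Sum>k<n. pd k p * \<delta> (pvar k))"
  using assms(1)
proof (induction p rule: polys_induct)
  case (pvar i)
  have "(\<Sum>k<n. pd k (pvar i) * \<delta> (pvar k)) = (\<Sum>k<n. if k = i then \<delta> (pvar i) else 0)"
    by (intro sum.cong) (auto simp: pd_pvar)
  thus ?case using pvar by simp
qed (simp_all add: assms pd_add pd_mult distrib_right sum.distrib sum_distrib_left mult.assoc)

text \<open>
  Along a line in the direction $w$ the polynomial $p$ is a univariate polynomial with zero derivative,
  which in characteristic zero is constant.
\<close>

lemma evalp_translate: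
  fixes h :: "'k::field_char_0 \<Rightarrow> 'r::comm_ring_1"
  assumes h: "comm_ring_hom h" and p: "p \<in> polys n"
    and inv: "(\<Sum>k<n. pconst (w k) * pd k p) = 0"
  shows "evalp h (\<lambda>i. \<xi> i + Y * h (w i)) p = evalp h \<xi> p"
proof -
  define S :: "'k mpol \<Rightarrow> 'k mpol poly"
    where "S = evalp (\<lambda>c. [:pconst c:]) (\<lambda>i. [:pvar i, pconst (w i):])"
  interpret S: comm_ring_hom S
    unfolding S_def by (intro comm_ring_hom_evalp hom_const_pconst)
  have Sc: "S (pconst c) = [:pconst c:]" and Sv: "S (pvar i) = [:pvar i, pconst (w i):]" for c i
    by (simp_all add: S_def evalp_pconst[OF hom_const_pconst]
        evalp_pvar[OF hom_const_pconst])
  have chain: "pderiv (S q) = (\<Sum>k<n. [:pconst (w k):] * S (pd k q))" if "q \<in> polys n" for q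
    using that
  proof (induction q rule: polys_induct)
    case (pconst c)
    show ?case by (simp add: Sc pderiv_pCons S.hom_zero)
  next
    case (pvar i)
    have "(\<Sum>k<n. [:pconst (w k):] * S (pd k (pvar i)))
        = (\<Sum>k<n. if k = i then [:pconst (w i):] else 0)"
      by (intro sum.cong) (auto simp: pd_pvar S.hom_zero S.hom_one)
    thus ?case using pvar by (simp add: Sv pderiv_pCons)
  next
    case (add q r)
    thus ?case by (simp add: S.hom_add pd_add pderiv_add algebra_simps sum.distrib)
  next
    case (mult q r)
    thus ?case
      by (simp add: S.hom_add S.hom_mult pd_mult pderiv_mult algebra_simps sum.distrib sum_distrib_left
        del: mult_pCons_left)
  qed
  have "pderiv (S p) = S (\<Sum>k<n. pconst (w k) * pd k p)"
    using chain[OF p] by (simp add: S.hom_sum S.hom_mult Sc)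
  hence "pderiv (S p) = 0" by (simp add: inv S.hom_zero)
  then obtain a where a: "S p = [:a:]" by (metis degree_eq_zeroE pderiv_eq_0_iff)
  have "comm_ring_hom (\<lambda>P :: 'k mpol poly. poly P 0)" by unfold_locales simp_all
  from hom_evalp[OF this, of "\<lambda>c. [:pconst c:]" "\<lambda>i. [:pvar i, pconst (w i):]" p]
  have "poly (S p) 0 = p" unfolding S_def by simp
  with a have Sp: "S p = [:p:]" by simp
  interpret h: comm_ring_hom h by (rule h)
  interpret ev: comm_ring_hom "evalp h \<xi>" by (rule comm_ring_hom_evalp[OF h])
  interpret mp: map_poly_comm_ring_hom "evalp h \<xi>" ..
  have "comm_ring_hom (\<lambda>P. poly (map_poly (evalp h \<xi>) P) Y)"
    by unfold_locales (simp_all add: mp.hom_add mp.hom_mult)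
  from hom_evalp[OF this, of "\<lambda>c. [:pconst c:]" "\<lambda>i. [:pvar i, pconst (w i):]" p]
  have "poly (map_poly (evalp h \<xi>) (S p)) Y
      = evalp h (\<lambda>i. \<xi> i + Y * h (w i)) p"
    unfolding S_def by (simp add: evalp_pconst[OF h] evalp_pvar[OF h] ev.map_poly_pCons_hom)
  thus ?thesis by (simp add: Sp ev.map_poly_pCons_hom)
qed

section \<open>Extending a bracket to polynomials\<close>

lemma (in subring_set) coeffs_in_induct [consumes 1, case_names monom add]:
  assumes "coeffs_in B P" "\<And>a i. a \<in> B \<Longrightarrow> Q (monom a i)"
    and "\<And>P P'. coeffs_in B P \<Longrightarrow> coeffs_in B P' \<Longrightarrow> Q P \<Longrightarrow> Q P' \<Longrightarrow> Q (P + P')"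
  shows "Q P"
proof -
  have "coeffs_in B (\<Sum>i\<in>S. monom (coeff P i) i) \<and> Q (\<Sum>i\<in>S. monom (coeff P i) i)" for S
  proof (induction S rule: infinite_finite_induct)
    case (insert i S)
    have "coeffs_in B (monom (coeff P i) i)" "Q (monom (coeff P i) i)"
      using assms(1,2) by (auto simp: coeffs_in_def zero_mem)
    with insert assms(3) show ?case by (simp add: coeffs_in_add)
  qed (use assms(2)[of 0 0] in \<open>auto simp: coeffs_in_0 zero_mem\<close>)
  from this[of "{..degree P}"] show ?thesis by (simp add: poly_as_sum_of_monoms)
qed

text \<open>The extension of a bracket to polynomials under which the variable is central.\<close>

definition lift_bracket :: "('a::comm_monoid_add \<Rightarrow> 'a \<Rightarrow> 'a) \<Rightarrow> 'a poly \<Rightarrow> 'a poly \<Rightarrow> 'a poly" where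
  "lift_bracket b P Q = (\<Sum>k\<le>degree P + degree Q.
     monom (\<Sum>i\<le>k. b (coeff P i) (coeff Q (k - i))) k)"

locale poisson_subring = subring_set V for V :: "'a::idom set" +
  fixes b :: "'a \<Rightarrow> 'a \<Rightarrow> 'a"
  assumes bracket_mem: "x \<in> V \<Longrightarrow> y \<in> V \<Longrightarrow> b x y \<in> V"
    and bracket_anti: "x \<in> V \<Longrightarrow> y \<in> V \<Longrightarrow> b x y = - b y x"
    and bracket_add: "x \<in> V \<Longrightarrow> y \<in> V \<Longrightarrow> z \<in> V \<Longrightarrow> b (x + y) z = b x z + b y z"
    and bracket_mult: "x \<in> V \<Longrightarrow> y \<in> V \<Longrightarrow> z \<in> V \<Longrightarrow> b (x * y) z = x * b y z + y * b x z"
begin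

lemma bracket_add_right: "x \<in> V \<Longrightarrow> y \<in> V \<Longrightarrow> z \<in> V \<Longrightarrow> b z (x + y) = b z x + b z y"
  using bracket_add[of x y z] bracket_anti[of z] add_mem by (metis minus_add_distrib)

lemma bracket_mult_right: "x \<in> V \<Longrightarrow> y \<in> V \<Longrightarrow> z \<in> V \<Longrightarrow> b z (x * y) = x * b z y + y * b z x"
  using bracket_mult[of x y z] bracket_anti[of z] mult_mem by (simp add: algebra_simps)

lemma bracket_0: "x \<in> V \<Longrightarrow> b 0 x = 0" "x \<in> V \<Longrightarrow> b x 0 = 0"
  using bracket_add[OF zero_mem zero_mem] bracket_add_right[OF zero_mem zero_mem]
  by (metis add_0_left add_cancel_right_right)+

lemma bracket_1: "x \<in> V \<Longrightarrow> b 1 x = 0" "x \<in> V \<Longrightarrow> b x 1 = 0"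
  using bracket_mult[OF one_mem one_mem] bracket_mult_right[OF one_mem one_mem]
  by (metis mult_1_left add_cancel_right_right)+

lemma bracket_uminus: "x \<in> V \<Longrightarrow> y \<in> V \<Longrightarrow> b (- x) y = - b x y"
  using bracket_add[of x "- x" y] uminus_mem[of x] bracket_0 by (simp add: eq_neg_iff_add_eq_0 add.commute)

lemma bracket_of_nat: "x \<in> V \<Longrightarrow> y \<in> V \<Longrightarrow> b (of_nat k * x) y = of_nat k * b x y"
proof (induction k)
  case (Suc k)
  hence "b (x + of_nat k * x) y = b x y + b (of_nat k * x) y"
    by (intro bracket_add mult_mem of_nat_mem)
  with Suc show ?case by (simp add: algebra_simps)
qed (simp add: bracket_0)

lemma bracket_power_eq_0: "x \<in> V \<Longrightarrow> y \<in> V \<Longrightarrow> b x y = 0 \<Longrightarrow> b (x ^ k) y = 0"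
  by (induction k) (simp_all add: bracket_1 bracket_mult power_mem)

lemma bracket_sum: "(\<And>i. i \<in> I \<Longrightarrow> f i \<in> V) \<Longrightarrow> y \<in> V \<Longrightarrow> b (sum f I) y = (\<Sum>i\<in>I. b (f i) y)"
  by (induction I rule: infinite_finite_induct) (simp_all add: bracket_0 bracket_add sum_mem)

lemma bracket_sum_right: "(\<And>i. i \<in> I \<Longrightarrow> f i \<in> V) \<Longrightarrow> y \<in> V \<Longrightarrow> b y (sum f I) = (\<Sum>i\<in>I. b y (f i))"
  by (induction I rule: infinite_finite_induct) (simp_all add: bracket_0 bracket_add_right sum_mem)

lemma coeff_lift_bracket:
  assumes "coeffs_in V P" "coeffs_in V Q"
  shows "coeff (lift_bracket b P Q) k = (\<Sum>i\<le>k. b (coeff P i) (coeff Q (k - i)))"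
proof (cases "k \<le> degree P + degree Q")
  case True
  thus ?thesis by (simp add: lift_bracket_def coeff_sum)
next
  case False
  have "b (coeff P i) (coeff Q (k - i)) = 0" for i
  proof (cases "i > degree P")
    case True
    thus ?thesis using assms by (simp add: coeff_eq_0 bracket_0 coeffs_in_def)
  next
    case 2: False
    with False have "k - i > degree Q" by linarith
    thus ?thesis using assms by (simp add: coeff_eq_0 bracket_0 coeffs_in_def)
  qed
  with False show ?thesis by (simp add: lift_bracket_def coeff_sum)
qed

lemma lift_bracket_add:
  assumes "coeffs_in V P" "coeffs_in V P'" "coeffs_in V Q"
  shows "lift_bracket b (P + P') Q = lift_bracket b P Q + lift_bracket b P' Q"
  using assms
  by (intro poly_eqI) (simp add: coeff_lift_bracket coeffs_in_add bracket_add coeffs_in_def add_mem sum.distrib)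

lemma lift_bracket_anti:
  assumes "coeffs_in V P" "coeffs_in V Q"
  shows "lift_bracket b P Q = - lift_bracket b Q P"
proof (intro poly_eqI)
  fix k
  have "(\<Sum>i\<le>k. b (coeff P i) (coeff Q (k - i))) = (\<Sum>i\<le>k. b (coeff P (k - i)) (coeff Q i))"
    by (rule sum.reindex_bij_witness[of _ "\<lambda>i. k - i" "\<lambda>i. k - i"]) auto
  also have "\<dots> = (\<Sum>i\<le>k. - b (coeff Q i) (coeff P (k - i)))"
    using assms by (intro sum.cong bracket_anti refl) (auto simp: coeffs_in_def)
  finally show "coeff (lift_bracket b P Q) k = coeff (- lift_bracket b Q P) k"
    using assms by (simp add: coeff_lift_bracket sum_negf)
qed

lemma lift_bracket_monom:
  assumes "x \<in> V" "y \<in> V"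
  shows "lift_bracket b (monom x i) (monom y j) = monom (b x y) (i + j)"
proof (intro poly_eqI)
  fix k
  have "coeff (lift_bracket b (monom x i) (monom y j)) k
      = (\<Sum>l\<le>k. b (coeff (monom x i) l) (coeff (monom y j) (k - l)))"
    by (intro coeff_lift_bracket coeffs_in_monom assms)
  also have "\<dots> = (\<Sum>l\<le>k. if l = i then (if k = i + j then b x y else 0) else 0)"
  proof (intro sum.cong refl)
    fix l assume "l \<in> {..k}"
    thus "b (coeff (monom x i) l) (coeff (monom y j) (k - l))
        = (if l = i then (if k = i + j then b x y else 0) else 0)"
      by (cases "l = i") (use assms in \<open>auto simp: bracket_0 zero_mem\<close>)
  qed
  finally show "coeff (lift_bracket b (monom x i) (monom y j)) k = coeff (monom (b x y) (i + j)) k"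
    by auto
qed

lemma lift_bracket_mem:
  assumes "coeffs_in V P" "coeffs_in V Q" shows "coeffs_in V (lift_bracket b P Q)"
  using assms coeff_lift_bracket[OF assms] by (auto simp: coeffs_in_def intro!: sum_mem bracket_mem)

lemma lift_bracket_add_right:
  assumes "coeffs_in V P" "coeffs_in V P'" "coeffs_in V Q"
  shows "lift_bracket b Q (P + P') = lift_bracket b Q P + lift_bracket b Q P'"
  using assms by (simp add: lift_bracket_anti[of Q] lift_bracket_add coeffs_in_add)

lemma lift_bracket_mult:
  assumes "coeffs_in V P" "coeffs_in V P'" "coeffs_in V Q"
  shows "lift_bracket b (P * P') Q = P * lift_bracket b P' Q + P' * lift_bracket b P Q"
  using assms(1)
proof (induction P rule: coeffs_in_induct)
  case (monom x i)
  show ?case using assms(2)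
  proof (induction P' rule: coeffs_in_induct)
    case (monom y j)
    show ?case using assms(3)
    proof (induction Q rule: coeffs_in_induct)
      case (monom z l)
      thus ?case using \<open>x \<in> V\<close> \<open>y \<in> V\<close>
        by (simp add: mult_monom lift_bracket_monom mult_mem bracket_mult add_monom ac_simps)
    next
      case (add Q Q')
      moreover have "coeffs_in V (monom x i * monom y j)"
        using \<open>x \<in> V\<close> \<open>y \<in> V\<close> by (intro coeffs_in_mult coeffs_in_monom)
      ultimately show ?case using \<open>x \<in> V\<close> \<open>y \<in> V\<close>
        by (simp add: lift_bracket_add_right coeffs_in_monom algebra_simps)
    qed
  next
    case (add P P')
    thus ?case using \<open>x \<in> V\<close> assms(3)
      by (simp add: lift_bracket_add coeffs_in_monom coeffs_in_mult algebra_simps)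
  qed
next
  case (add P P'')
  thus ?case using assms(2,3)
    by (simp add: lift_bracket_add coeffs_in_mult algebra_simps)
qed

lemma poisson_subring_lift: "poisson_subring {P. coeffs_in V P} (lift_bracket b)"
proof -
  interpret L: subring_set "{P. coeffs_in V P}" by (rule coeffs_in_subring)
  show ?thesis
    by unfold_locales
      (auto simp: lift_bracket_mem lift_bracket_add lift_bracket_mult intro: lift_bracket_anti)
qed

lemma pderiv_lift_bracket:
  assumes "coeffs_in V P" "coeffs_in V Q"
  shows "pderiv (lift_bracket b P Q) = lift_bracket b (pderiv P) Q + lift_bracket b P (pderiv Q)"
  using assms(1)
proof (induction P rule: coeffs_in_induct)
  case (monom x i)
  show ?case using assms(2)
  proof (induction Q rule: coeffs_in_induct)
    case (monom y j)
    have nat: "of_nat k * x \<in> V" "of_nat k * y \<in> V" for k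
      using \<open>x \<in> V\<close> \<open>y \<in> V\<close> by (simp_all add: mult_mem of_nat_mem)
    have "b x (of_nat j * y) = of_nat j * b x y"
      using bracket_of_nat[of y x j] bracket_anti[of x] \<open>x \<in> V\<close> \<open>y \<in> V\<close> nat by simp
    moreover have "monom (of_nat i * b x y) (i - 1 + j) = monom (of_nat i * b x y) (i + j - 1)"
      "monom (of_nat j * b x y) (i + (j - 1)) = monom (of_nat j * b x y) (i + j - 1)"
      by (cases i; simp) (cases j; simp)
    ultimately show ?case
      unfolding pderiv_monom lift_bracket_monom[OF \<open>x \<in> V\<close> \<open>y \<in> V\<close>]
        lift_bracket_monom[OF nat(1) \<open>y \<in> V\<close>] lift_bracket_monom[OF \<open>x \<in> V\<close> nat(2)]
        bracket_of_nat[OF \<open>x \<in> V\<close> \<open>y \<in> V\<close>]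
      by (simp only: add_monom of_nat_add distrib_right)
  next
    case (add Q Q')
    thus ?case using \<open>x \<in> V\<close>
      by (simp add: lift_bracket_add_right coeffs_in_monom coeffs_in_pderiv pderiv_add)
  qed
next
  case (add P P')
  thus ?case using assms(2)
    by (simp add: lift_bracket_add coeffs_in_pderiv pderiv_add)
qed

end

section \<open>Homogeneous Poisson brackets on polynomial rings\<close>

locale poly_poisson =
  fixes n :: nat and br :: "'k::{alg_closed_field, field_char_0} mpol \<Rightarrow> 'k mpol \<Rightarrow> 'k mpol"
  assumes poisson: "poisson_algebra (poly_alg n br)"
begin

lemma scale_left: "p \<in> polys n \<Longrightarrow> q \<in> polys n \<Longrightarrow> br (pconst c * p) q = pconst c * br p q"
  using poisson_algebra.bracket_scale_left[OF poisson, of p q c] by (simp add: poly_alg_def)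

lemma alternating: "p \<in> polys n \<Longrightarrow> br p p = 0"
  using poisson_algebra.bracket_alternating[OF poisson, of p] by (simp add: poly_alg_def)

sublocale P: poisson_subring "polys n" br
proof
  fix p q :: "'k mpol" assume pq: "p \<in> polys n" "q \<in> polys n"
  show "br p q \<in> polys n"
    using poisson_algebra.bracket_closed[OF poisson, of p q] pq by (simp add: poly_alg_def)
  have "br (p + q) (p + q) = 0" by (intro alternating polys.add_mem pq)
  moreover have "br (p + q) (p + q) = br p p + br q p + (br p q + br q q)"
    using poisson_algebra.bracket_add_left[OF poisson, of p q "p + q"]
      poisson_algebra.bracket_add_right[OF poisson, of p p q]
      poisson_algebra.bracket_add_right[OF poisson, of q p q] pq
    by (simp add: poly_alg_def polys.add_mem)
  ultimately show "br p q = - br q p" using pq by (simp add: alternating eq_neg_iff_add_eq_0 add.commute)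
next
  fix p q s :: "'k mpol" assume "p \<in> polys n" "q \<in> polys n" "s \<in> polys n"
  thus "br (p + q) s = br p s + br q s" "br (p * q) s = p * br q s + q * br p s"
    using poisson_algebra.bracket_add_left[OF poisson, of p q s]
      poisson_algebra.bracket_leibniz_left[OF poisson, of p q s] by (simp_all add: poly_alg_def mult.commute)
qed

lemma br_pconst: "q \<in> polys n \<Longrightarrow> br (pconst c) q = 0"
  using scale_left[OF polys.one_mem, of q c] P.bracket_1[of q] by simp

lemma br_formula: "p \<in> polys n \<Longrightarrow> q \<in> polys n \<Longrightarrow> br p q = (\<Sum>k<n. pd k p * br (pvar k) q)"
  by (rule derivation_formula[where \<delta> = "\<lambda>p. br p q"])
    (simp_all add: P.bracket_add P.bracket_mult br_pconst)

definition central :: "'k mpol \<Rightarrow> bool" where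
  "central f \<longleftrightarrow> f \<in> polys n \<and> (\<forall>q\<in>polys n. br f q = 0)"

lemma centralI:
  assumes "f \<in> polys n" "\<And>j. j < n \<Longrightarrow> br f (pvar j) = 0" shows "central f"
proof -
  have "br f q = 0" if "q \<in> polys n" for q
  proof -
    have "br q f = (\<Sum>k<n. pd k q * br (pvar k) f)" by (rule br_formula[OF that assms(1)])
    also have "\<dots> = 0"
      using assms P.bracket_anti[OF pvar_in_polys assms(1)] by (intro sum.neutral) simp
    finally show ?thesis using P.bracket_anti[OF assms(1) that] by simp
  qed
  with assms show ?thesis by (simp add: central_def)
qed

lemma central_polys: "central f \<Longrightarrow> f \<in> polys n" and central_br: "central f \<Longrightarrow> q \<in> polys n \<Longrightarrow> br f q = 0"
  by (simp_all add: central_def)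

lemma central_br_right: "central f \<Longrightarrow> q \<in> polys n \<Longrightarrow> br q f = 0"
  using P.bracket_anti[of q f] by (simp add: central_def)

lemma central_subring: "subring_set {f. central f}"
proof
  fix f g assume "f \<in> {f. central f}" "g \<in> {f. central f}"
  thus "f + g \<in> {f. central f}" "f * g \<in> {f. central f}"
    by (simp_all add: central_def P.bracket_add P.bracket_mult polys.add_mem polys.mult_mem)
next
  fix f assume "f \<in> {f. central f}"
  thus "- f \<in> {f. central f}" by (simp add: central_def P.bracket_uminus polys.uminus_mem)
qed (simp_all add: central_def polys.zero_mem polys.one_mem P.bracket_0 P.bracket_1)

lemma central_pconst: "central (pconst c)"
  by (simp add: central_def pconst_in_polys br_pconst)

end

lemma parallel_to_common_vector:
  fixes f g w :: "'i \<Rightarrow> 'a::idom"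
  assumes k: "w k \<noteq> 0" "k \<in> I" and ij: "i \<in> I" "j \<in> I"
    and f: "\<And>i j. i \<in> I \<Longrightarrow> j \<in> I \<Longrightarrow> f i * w j = f j * w i"
    and g: "\<And>i j. i \<in> I \<Longrightarrow> j \<in> I \<Longrightarrow> g i * w j = g j * w i"
  shows "f i * g j = f j * g i"
proof -
  have "(f i * g j) * (w k * w k) = (f i * w k) * (g j * w k)" by (simp only: mult_ac)
  also have "\<dots> = (f k * w j) * (g k * w i)" 
    unfolding f[OF ij(1) k(2)] g[OF ij(2) k(2)] by (simp only: mult_ac)
  also have "\<dots> = (f j * g i) * (w k * w k)"
    unfolding f[OF k(2) ij(2)] g[OF k(2) ij(1)] by (simp only: mult_ac)
  finally show ?thesis using k by simp
qed

locale homogeneous_poisson = poly_poisson n br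
  for n and br :: "'k::{alg_closed_field, field_char_0} mpol \<Rightarrow> 'k mpol \<Rightarrow> 'k mpol" +
  fixes r :: nat
  assumes n_le_3: "n \<le> 3" and r_pos: "r \<ge> 1"
    and bracket_var_hom: "i < n \<Longrightarrow> j < n \<Longrightarrow> br (pvar i) (pvar j) \<in> hom_part n r"
    and nontrivial: "\<exists>p\<in>polys n. \<exists>q\<in>polys n. br p q \<noteq> 0"
begin

lemma grade_mem: "p \<in> polys n \<Longrightarrow> coeffs_in (polys n) (grade p)"
  unfolding coeffs_in_def hcomp_def[symmetric] by (simp add: hcomp_in_polys)

lemma lift_bracket_const:
  assumes "coeffs_in (polys n) Q" shows "lift_bracket br [:pconst c:] Q = 0"
proof (intro poly_eqI)
  fix k
  have "br (coeff [:pconst c:] i) (coeff Q (k - i)) = 0" for i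
    using assms by (cases i) (auto simp: coeffs_in_def br_pconst P.bracket_0)
  thus "coeff (lift_bracket br [:pconst c:] Q) k = coeff 0 k"
    using assms by (subst P.coeff_lift_bracket) (auto simp: polys.coeffs_in_pCons polys.coeffs_in_0 pconst_in_polys)
qed

text \<open>
  The homogeneity of the bracket as one identity: both sides are biderivations in $p$ and $q$, and
  they agree on variables. The factors $T^r$ and $T^2$ express the shift of degrees by $r - 2$, which
  may be negative.
\<close>

lemma grade_bracket:
  assumes "p \<in> polys n" "q \<in> polys n"
  shows "monom 1 r * lift_bracket br (grade p) (grade q) = monom 1 2 * grade (br p q)"
  using assms(1)
proof (induction p rule: polys_induct)
  case (pconst c)
  show ?case using assms(2)
    by (simp add: grade_pconst lift_bracket_const grade_mem br_pconst grade.hom_zero)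
next
  case (pvar i)
  show ?case using assms(2)
  proof (induction q rule: polys_induct)
    case (pconst c)
    have "lift_bracket br (grade (pvar i)) (grade (pconst c)) = 0"
      using P.lift_bracket_anti[OF grade_mem grade_mem, of "pvar i" "pconst c"] pvar
      by (simp add: pvar_in_polys pconst_in_polys grade_pconst lift_bracket_const grade_mem)
    moreover have "br (pvar i) (pconst c) = 0"
      using P.bracket_anti[of "pvar i" "pconst c"] pvar
      by (simp add: pvar_in_polys pconst_in_polys br_pconst)
    ultimately show ?case by (simp add: grade.hom_zero)
  next
    case (pvar j)
    have "lift_bracket br (monom (pvar i) 1) (monom (pvar j) 1) = monom (br (pvar i) (pvar j)) (1 + 1)"
      using \<open>i < n\<close> \<open>j < n\<close> by (intro P.lift_bracket_monom pvar_in_polys)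
    thus ?case using grade_of_hom[OF bracket_var_hom[OF \<open>i < n\<close> \<open>j < n\<close>]]
      by (simp add: grade_pvar mult_monom add.commute)
  next
    case (add q q')
    thus ?case using pvar
      by (simp add: grade.hom_add P.bracket_add_right P.lift_bracket_add_right grade_mem
          pvar_in_polys distrib_left)
  next
    case (mult q q')
    have "lift_bracket br (grade (pvar i)) (grade q * grade q')
        = grade q * lift_bracket br (grade (pvar i)) (grade q')
        + grade q' * lift_bracket br (grade (pvar i)) (grade q)"
      by (rule poisson_subring.bracket_mult_right[OF P.poisson_subring_lift])
        (use mult pvar in \<open>auto simp: grade_mem pvar_in_polys\<close>)
    moreover have "br (pvar i) (q * q') = q * br (pvar i) q' + q' * br (pvar i) q"
      using mult pvar by (simp add: P.bracket_mult_right pvar_in_polys)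
    ultimately show ?case using mult.IH
      by (simp add: grade.hom_add grade.hom_mult distrib_left mult.left_commute)
  qed
next
  case (add p p')
  thus ?case using assms(2)
    by (simp add: grade.hom_add P.bracket_add P.lift_bracket_add grade_mem distrib_left)
next
  case (mult p p')
  thus ?case using assms(2)
    by (simp add: grade.hom_add grade.hom_mult P.bracket_mult P.lift_bracket_mult grade_mem
        distrib_left mult.left_commute)
qed

lemma hcomp_bracket:
  assumes "p \<in> hom_part n a" "q \<in> hom_part n c"
  shows "hcomp e (br p q) = (if e + 2 = a + c + r then br p q else 0)"
proof -
  have pq: "p \<in> polys n" "q \<in> polys n" using assms by (simp_all add: hom_part_subset)
  have "monom 1 2 * grade (br p q) = monom (br p q) (r + (a + c))"
    using grade_bracket[OF pq] assms pq by (simp add: grade_of_hom P.lift_bracket_monom mult_monom)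
  hence "coeff (monom 1 2 * grade (br p q)) (2 + e) = coeff (monom (br p q) (r + (a + c))) (2 + e)"
    by (rule arg_cong)
  hence "hcomp e (br p q) = (if r + (a + c) = 2 + e then br p q else 0)"
    by (simp add: coeff_monom_mult hcomp_def)
  thus ?thesis by (auto simp: add_ac)
qed

lemma hcomp_bracket_hom_right:
  assumes p: "p \<in> polys n" and q: "q \<in> hom_part n c" and "e + 2 = a + c + r"
  shows "hcomp e (br p q) = br (hcomp a p) q"
proof -
  let ?N = "degree (grade p)"
  have "br p q = br (\<Sum>i\<le>?N. hcomp i p) q" using sum_hcomp[of p] by simp
  also have "\<dots> = (\<Sum>i\<le>?N. br (hcomp i p) q)"
    using p q by (intro P.bracket_sum) (auto simp: hcomp_in_polys hom_part_subset)
  finally have "hcomp e (br p q) = (\<Sum>i\<le>?N. hcomp e (br (hcomp i p) q))" by (simp add: hcomp_sum)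
  also have "\<dots> = (\<Sum>i\<le>?N. if i = a then br (hcomp a p) q else 0)"
    using assms by (intro sum.cong refl) (auto simp: hcomp_bracket[OF hcomp_in_hom_part[OF p] q])
  also have "\<dots> = br (hcomp a p) q"
  proof (cases "a \<le> ?N")
    case False
    hence "hcomp a p = 0" by (simp add: hcomp_def coeff_eq_0)
    with q show ?thesis using False by (simp add: P.bracket_0 hom_part_subset)
  qed simp
  finally show ?thesis .
qed

text \<open>
  The bracket with a variable shifts all degrees by the same amount, so it vanishes on $f$ only if it
  vanishes on each component of $f$.
\<close>

lemma central_hcomp:
  assumes "central f" shows "central (hcomp e f)"
proof (rule centralI)
  show "hcomp e f \<in> polys n" using assms by (simp add: central_polys hcomp_in_polys)
  fix j assume j: "j < n"
  have "hcomp (e + r - 1) (br f (pvar j)) = br (hcomp e f) (pvar j)"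
    using r_pos by (intro hcomp_bracket_hom_right[OF central_polys[OF assms] pvar_in_hom_part[OF j]]) simp
  thus "br (hcomp e f) (pvar j) = 0" using assms j by (simp add: central_br pvar_in_polys)
qed

text \<open>
  In at most three variables the bracket is given by a vector $u$ through
  $\{p,x_j\} = (\nabla p \times u)_j$ up to sign. Gradients of central elements are parallel to $u$.
\<close>

lemma central_jacobian:
  assumes "central f" "central g" "i < n" "j < n"
  shows "pd i f * pd j g = pd j f * pd i g"
proof -
  define w where "w = (\<lambda>i j. if i < n \<and> j < n then br (pvar i) (pvar j) else 0)"
  have w_anti: "w i j = - w j i" for i j
    using P.bracket_anti[OF pvar_in_polys pvar_in_polys, of i j] by (simp add: w_def)
  have w0: "w i i = 0" for i by (simp add: w_def alternating pvar_in_polys)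
  have ext: "(\<Sum>k<3. pd k f * w k j) = 0" if "central f" for f j
  proof (cases "j < n")
    case True
    have "(\<Sum>k<3. pd k f * w k j) = (\<Sum>k<n. pd k f * w k j)"
      using n_le_3 by (intro sum.mono_neutral_right) (auto simp: w_def)
    also have "\<dots> = br f (pvar j)"
      using br_formula[OF central_polys[OF that] pvar_in_polys[OF True]] True by (simp add: w_def)
    finally show ?thesis using that True by (simp add: central_br pvar_in_polys)
  qed (simp add: w_def)
  have ext3: "pd 0 f * w 0 j + pd 1 f * w 1 j + pd 2 f * w 2 j = 0" if "central f" for f j
    using ext[OF that, of j] by (simp add: numeral_3_eq_3 numeral_2_eq_2)
  define u where "u = (\<lambda>i::nat. if i = 0 then w 1 2 else if i = 1 then w 2 0 else w 0 1)"
  have par: "pd i f * u j = pd j f * u i" if "central f" "i \<in> {0,1,2}" "j \<in> {0,1,2}" for f i j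
  proof -
    have "pd 2 f * w 2 0 = pd 1 f * w 0 1"
      using ext3[OF that(1), of 0] unfolding w0 w_anti[of 1 0] by (simp add: algebra_simps)
    moreover have "pd 0 f * w 0 1 = pd 2 f * w 1 2"
      using ext3[OF that(1), of 1] unfolding w0 w_anti[of 2 1] by (simp add: algebra_simps)
    moreover have "pd 1 f * w 1 2 = pd 0 f * w 2 0"
      using ext3[OF that(1), of 2] unfolding w0 w_anti[of 0 2] by (simp add: algebra_simps)
    ultimately show ?thesis using that(2,3) unfolding u_def by (elim insertE emptyE) simp_all
  qed
  have "w 0 1 \<noteq> 0 \<or> w 1 2 \<noteq> 0 \<or> w 2 0 \<noteq> 0"
  proof (rule ccontr)
    assume *: "\<not> ?thesis"
    have "w i j = 0" if "i < 3" "j < 3" for i j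
    proof -
      have "i \<in> {0,1,2}" "j \<in> {0,1,2}" using that by auto
      thus ?thesis using * w0 w_anti[of 1 0] w_anti[of 2 1] w_anti[of 0 2] by auto
    qed
    hence w: "br (pvar i) (pvar j) = 0" if "i < n" "j < n" for i j
      using that n_le_3 by (metis (mono_tags, lifting) order_less_le_trans w_def)
    have "br p q = 0" if "p \<in> polys n" "q \<in> polys n" for p q
    proof -
      have "br (pvar i) q = 0" if "i < n" for i
        using central_br[OF centralI, of "pvar i" q] w that pvar_in_polys \<open>q \<in> polys n\<close> by blast
      thus ?thesis using br_formula[OF that] by simp
    qed
    with nontrivial show False by blast
  qed
  hence "u 0 \<noteq> 0 \<or> u 1 \<noteq> 0 \<or> u 2 \<noteq> 0" by (auto simp: u_def)
  then obtain k where k: "u k \<noteq> 0" "k \<in> {0,1,2}" by blast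
  have ij: "i \<in> {0,1,2}" "j \<in> {0,1,2}" using assms n_le_3 by auto
  show ?thesis
    by (rule parallel_to_common_vector[where f = "\<lambda>i. pd i f" and g = "\<lambda>i. pd i g" and w = u, OF k ij])
      (use par assms(1,2) in blast)+
qed

text \<open>
  By Euler's identity the vanishing of the Jacobian minors says that $f$ and $g$ have the same
  logarithmic derivatives.
\<close>

lemma central_homogeneous_proportional:
  assumes f: "central f" "f \<in> hom_part n e" and g: "central g" "g \<in> hom_part n e" "g \<noteq> 0"
  shows "\<exists>c. f = pconst c * g"
proof (cases "e = 0")
  case True
  from f g obtain a c where "f = pconst a" "g = pconst c" using hom_part_0 True by metis
  with g have "f = pconst (a / c) * g" by (simp flip: pconst_mult)
  thus ?thesis by blast
next
  case False
  show ?thesis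
  proof (rule proportional_if_equal_log_derivatives)
    fix j assume j: "j < n"
    have "of_nat e * (f * pd j g) = (\<Sum>i<n. pvar i * pd i f) * pd j g"
      using euler[OF f(2)] by simp
    also have "\<dots> = (\<Sum>i<n. pvar i * pd i g) * pd j f"
      unfolding sum_distrib_right
    proof (intro sum.cong refl)
      fix i assume "i \<in> {..<n}"
      hence "pd i f * pd j g = pd j f * pd i g" using central_jacobian[OF f(1) g(1) _ j] by simp
      thus "pvar i * pd i f * pd j g = pvar i * pd i g * pd j f" by (simp add: ac_simps)
    qed
    also have "\<dots> = of_nat e * (g * pd j f)" using euler[OF g(2)] by simp
    finally show "f * pd j g = g * pd j f" using False by simp
  qed (use f g in \<open>auto simp: central_polys\<close>)
qed

lemma central_power: "central f \<Longrightarrow> central (f ^ k)"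
  using subring_set.power_mem[OF central_subring] by simp

lemma central_homogeneous_powers:
  assumes f: "central f" "f \<in> hom_part n e" "f \<noteq> 0" and g: "central g" "g \<in> hom_part n e'" "g \<noteq> 0"
  obtains c where "c \<noteq> 0" "f ^ e' = pconst c * g ^ e"
proof -
  have "f ^ e' \<in> hom_part n (e' * e)" "g ^ e \<in> hom_part n (e' * e)"
    using hom_part_power[OF f(2), of e'] hom_part_power[OF g(2), of e] by (simp_all add: mult.commute)
  then obtain c where c: "f ^ e' = pconst c * g ^ e"
    using central_homogeneous_proportional[OF central_power[OF f(1)] _ central_power[OF g(1)]] g(3)
    by (metis power_not_zero)
  moreover have "c \<noteq> 0" using c f(3) by (auto simp: power_0_left)
  ultimately show thesis by (rule that[rotated])
qed

end

subsection \<open>Veronese subrings\<close>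

lemma mem_veronese_iff:
  assumes "d \<ge> 1"
  shows "p \<in> veronese_carrier n d \<longleftrightarrow> p \<in> polys n \<and> (\<forall>e. hcomp e p \<noteq> 0 \<longrightarrow> d dvd e)"
proof safe
  assume "p \<in> veronese_carrier n d"
  then obtain f N where fN: "p = (\<Sum>e\<le>N. f e)" "\<And>e. e \<le> N \<Longrightarrow> f e \<in> hom_part n (d * e)"
    by (auto simp: veronese_carrier_def)
  thus "p \<in> polys n" by (auto intro!: polys.sum_mem hom_part_subset[OF fN(2)])
  fix e assume "hcomp e p \<noteq> 0"
  then obtain i where "i \<le> N" "hcomp e (f i) \<noteq> 0"
    unfolding fN(1) hcomp_sum by (metis atMost_iff sum.neutral)
  hence "e = d * i" using hcomp_of_hom[OF fN(2), of i e] by (auto split: if_splits)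
  thus "d dvd e" by simp
next
  assume p: "p \<in> polys n" "\<forall>e. hcomp e p \<noteq> 0 \<longrightarrow> d dvd e"
  let ?N = "degree (grade p)"
  have "p = (\<Sum>e\<le>?N. hcomp (d * e) p)"
  proof (rule poly_mapping_eqI)
    fix m
    have "lookup (\<Sum>e\<le>?N. hcomp (d * e) p) m
        = (\<Sum>e\<le>?N. if d * e = mon_deg m then lookup p m else 0)"
      unfolding lookup_sum lookup_hcomp by (intro sum.cong) auto
    also have "\<dots> = lookup p m"
    proof (cases "lookup p m = 0")
      case False
      hence 0: "hcomp (mon_deg m) p \<noteq> 0" using lookup_hcomp[of "mon_deg m" p m] by auto
      hence "mon_deg m \<le> ?N" unfolding hcomp_def by (rule le_degree)
      moreover from 0 p obtain e where e: "mon_deg m = d * e" by auto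
      ultimately have "e \<le> ?N" using assms by (metis One_nat_def le_trans less_eq_nat.simps(1) mult.commute mult_le_mono2 nat_mult_1_right)
      moreover have "d * i = d * e \<longleftrightarrow> i = e" for i using assms by simp
      ultimately show ?thesis unfolding e by simp
    qed (simp cong: if_cong)
    finally show "lookup p m = lookup (\<Sum>e\<le>?N. hcomp (d * e) p) m" by simp
  qed
  thus "p \<in> veronese_carrier n d" unfolding veronese_carrier_def
    using p(1) by (intro CollectI exI[of _ "\<lambda>e. hcomp (d * e) p"] exI[of _ ?N]) (simp add: hcomp_in_hom_part)
qed

lemma veronese_carrier_1: "veronese_carrier n 1 = polys n"
  by (auto simp: mem_veronese_iff)

lemma hom_part_in_veronese: "d \<ge> 1 \<Longrightarrow> p \<in> hom_part n e \<Longrightarrow> d dvd e \<Longrightarrow> p \<in> veronese_carrier n d"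
  by (auto simp: mem_veronese_iff hom_part_subset hcomp_of_hom split: if_splits)

lemma veronese_subring:
  assumes "d \<ge> 1" shows "subring_set (veronese_carrier n d :: 'k::field mpol set)"
proof -
  have const: "pconst c \<in> veronese_carrier n d" for c :: 'k
    using hom_part_in_veronese[OF assms pconst_in_hom_part] by simp
  show ?thesis
  proof
    show "(0 :: 'k mpol) \<in> veronese_carrier n d" "(1 :: 'k mpol) \<in> veronese_carrier n d"
      using const[of 0] const[of 1] by simp_all
  next
    fix p q :: "'k mpol" assume pq: "p \<in> veronese_carrier n d" "q \<in> veronese_carrier n d"
    show "p + q \<in> veronese_carrier n d" using pq assms
      by (auto simp: mem_veronese_iff polys.add_mem hcomp_add) (metis add_0)
    have "d dvd e" if "hcomp e (p * q) \<noteq> 0" for e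
    proof -
      have "(\<Sum>i\<le>e. hcomp i p * hcomp (e - i) q) \<noteq> 0"
        using that by (simp add: hcomp_def grade.hom_mult coeff_mult)
      then obtain i where "i \<le> e" "hcomp i p * hcomp (e - i) q \<noteq> 0"
        by (metis (no_types, lifting) atMost_iff sum.neutral)
      hence "d dvd i" "d dvd e - i" "i \<le> e" using pq assms by (auto simp: mem_veronese_iff)
      thus ?thesis by (metis dvd_add le_add_diff_inverse)
    qed
    thus "p * q \<in> veronese_carrier n d" using pq assms by (auto simp: mem_veronese_iff polys.mult_mem)
  next
    fix p :: "'k mpol" assume "p \<in> veronese_carrier n d"
    thus "- p \<in> veronese_carrier n d" using assms
      by (auto simp: mem_veronese_iff polys.uminus_mem hcomp_def grade.hom_uminus)
  qed
qed

text \<open>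
  For $d \ge 2$ the bracket has to be quadratic in order to preserve divisibility of degrees by $d$.
\<close>

locale veronese_poisson = homogeneous_poisson n br r
  for n and br :: "'k::{alg_closed_field, field_char_0} mpol \<Rightarrow> 'k mpol \<Rightarrow> 'k mpol" and r +
  fixes d :: nat
  assumes d_pos: "d \<ge> 1" and d_cases: "d = 1 \<or> n = 3 \<and> r = 2"
begin

abbreviation V :: "'k mpol set" where "V \<equiv> veronese_carrier n d"

lemmas mem_V_iff = mem_veronese_iff[OF d_pos]

lemma V_polys: "p \<in> V \<Longrightarrow> p \<in> polys n" by (simp add: mem_V_iff)

lemma pconst_in_V: "pconst c \<in> V"
  using hom_part_in_veronese[OF d_pos pconst_in_hom_part] by simp

lemma hcomp_in_V: assumes "p \<in> V" shows "hcomp e p \<in> V"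
proof (cases "hcomp e p = 0")
  case True
  thus ?thesis using pconst_in_V[of 0] by simp
next
  case False
  hence "d dvd e" using assms by (simp add: mem_V_iff)
  thus ?thesis by (rule hom_part_in_veronese[OF d_pos hcomp_in_hom_part[OF V_polys[OF assms]]])
qed

sublocale V: poisson_subring V br
proof -
  interpret subring_set V by (rule veronese_subring[OF d_pos])
  show "poisson_subring V br"
  proof
    fix p q :: "'k mpol" assume pq: "p \<in> V" "q \<in> V"
    have "d dvd e" if e: "hcomp e (br p q) \<noteq> 0" for e
    proof (cases "d = 1")
      case False
      let ?N = "degree (grade q)"
      have "br p q = br p (\<Sum>j\<le>?N. hcomp j q)" using sum_hcomp[of q] by simp
      also have "\<dots> = (\<Sum>j\<le>?N. br p (hcomp j q))"
        using pq by (intro P.bracket_sum_right) (auto simp: hcomp_in_polys V_polys)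
      finally have "(\<Sum>j\<le>?N. hcomp e (br p (hcomp j q))) \<noteq> 0" using e by (simp add: hcomp_sum)
      then obtain j where j: "hcomp e (br p (hcomp j q)) \<noteq> 0"
        by (metis (no_types, lifting) sum.neutral)
      let ?M = "degree (grade p)"
      have "br p (hcomp j q) = br (\<Sum>i\<le>?M. hcomp i p) (hcomp j q)" using sum_hcomp[of p] by simp
      also have "\<dots> = (\<Sum>i\<le>?M. br (hcomp i p) (hcomp j q))"
        using pq by (intro P.bracket_sum) (auto simp: hcomp_in_polys V_polys)
      finally have "(\<Sum>i\<le>?M. hcomp e (br (hcomp i p) (hcomp j q))) \<noteq> 0"
        using j by (simp add: hcomp_sum)
      then obtain i where i: "hcomp e (br (hcomp i p) (hcomp j q)) \<noteq> 0"
        by (metis (no_types, lifting) sum.neutral)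
      hence "e + 2 = i + j + r"
        using hcomp_bracket[OF hcomp_in_hom_part hcomp_in_hom_part, of p q e i j] pq
        by (auto simp: V_polys split: if_splits)
      hence "e = i + j" using False d_cases by simp
      moreover have "hcomp i p \<noteq> 0" "hcomp j q \<noteq> 0"
        using i pq by (auto simp: P.bracket_0 hcomp_in_polys V_polys)
      ultimately show ?thesis using pq by (auto simp: mem_V_iff)
    qed simp
    thus "br p q \<in> V" using pq by (simp add: mem_V_iff P.bracket_mem)
    show "br p q = - br q p" using pq by (intro P.bracket_anti V_polys)
  next
    fix p q s :: "'k mpol" assume "p \<in> V" "q \<in> V" "s \<in> V"
    thus "br (p + q) s = br p s + br q s" "br (p * q) s = p * br q s + q * br p s"
      by (simp_all add: P.bracket_add P.bracket_mult V_polys)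
  qed
qed

text \<open>
  The powers $x_j^d$ lie in the Veronese subring, and $\{x_j^d,f\} = d x_j^{d-1}\{x_j,f\}$.
\<close>

lemma central_if_commutes_with_V:
  assumes "f \<in> V" "\<And>q. q \<in> V \<Longrightarrow> br f q = 0" shows "central f"
proof (rule centralI)
  show f: "f \<in> polys n" using assms V_polys by blast
  fix j assume j: "j < n"
  have "pvar j ^ d \<in> hom_part n (d * 1)" by (rule hom_part_power[OF pvar_in_hom_part[OF j]])
  hence "pvar j ^ d \<in> V" by (intro hom_part_in_veronese[OF d_pos]) auto
  hence 0: "br (pvar j ^ d) f = 0"
    using assms P.bracket_anti[OF V_polys f, of "pvar j ^ d"] by simp
  have pw: "br (pvar j ^ k) f = of_nat k * pvar j ^ (k - 1) * br (pvar j) f" for k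
  proof (induction k)
    case (Suc k)
    have "br (pvar j ^ Suc k) f = pvar j * br (pvar j ^ k) f + pvar j ^ k * br (pvar j) f"
      using j f by (simp add: P.bracket_mult pvar_in_polys polys.power_mem)
    also have "pvar j * br (pvar j ^ k) f = of_nat k * pvar j ^ k * br (pvar j) f"
      unfolding Suc by (cases k) (simp_all add: algebra_simps)
    finally show ?case by (simp add: algebra_simps)
  qed (use f in \<open>simp add: P.bracket_1\<close>)
  have "pvar j \<noteq> (0 :: 'k mpol)"
    by (metis lookup_single_eq lookup_zero pvar_def zero_neq_one)
  with 0 pw[of d] d_pos have "br (pvar j) f = 0" by simp
  thus "br f (pvar j) = 0" using P.bracket_anti[OF f pvar_in_polys[OF j]] by simp
qed

end

section \<open>Two presentations of one Poisson algebra as a polynomial ring\<close>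

instance fract :: ("{idom,ring_char_0}") field_char_0
proof
  show "inj (of_nat :: nat \<Rightarrow> 'a fract)"
    by (rule injI) (simp add: of_nat_fract eq_fract)
qed

lemma order_power: "p \<noteq> 0 \<Longrightarrow> order x (p ^ k) = k * order x (p :: 'a::idom poly)"
  by (induction k) (simp_all add: order_mult)

text \<open>
  At a root of $F$ in an algebraic closure of the fraction field, of multiplicity $m$, each $G_i$
  vanishes to order at least $m$, since $G_i^e$ is a multiple of $F^j$ with $j \ge e$. The derivative of
  $F$ vanishes to order $m - 1$ only.
\<close>

lemma derivative_not_in_span_of_power_divisible:
  fixes F :: "'a::{idom,ring_char_0} poly"
  assumes F: "degree F > 0" and e: "e > 0"
    and der: "pderiv F = (\<Sum>i\<in>I. G i * H i)"
    and G: "\<And>i. i \<in> I \<Longrightarrow> G i = 0 \<or> (\<exists>c j. c \<noteq> 0 \<and> j \<ge> e \<and> G i ^ e = [:c:] * F ^ j)"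
  shows False
proof -
  define \<phi> :: "'a \<Rightarrow> 'a fract alg_closure" where "\<phi> = (\<lambda>x. to_ac (Fract x 1))"
  have Fract_0: "Fract y 1 = 0 \<longleftrightarrow> y = 0" for y :: 'a by (simp add: Zero_fract_def eq_fract)
  interpret \<phi>: inj_idom_hom \<phi>
    by unfold_locales
      (simp_all add: \<phi>_def Zero_fract_def[symmetric] One_fract_def[symmetric] Fract_0
        to_ac_add[symmetric] to_ac_mult[symmetric] del: to_ac_add to_ac_mult)
  interpret mp: map_poly_inj_idom_hom \<phi> ..
  define F' where "F' = map_poly \<phi> F"
  have F': "degree F' > 0" using F by (simp add: F'_def)
  then obtain x where x: "poly F' x = 0" using alg_closed_imp_poly_has_root by blast
  define m where "m = order x F'"
  have F'0: "F' \<noteq> 0" using F' by auto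
  have m: "m = Suc (order x (pderiv F'))" unfolding m_def by (rule order_pderiv[OF F'0 x])
  have "[:-x, 1:] ^ m dvd map_poly \<phi> (G i)" if i: "i \<in> I" for i
  proof (cases "G i = 0")
    case False
    with G[OF i] obtain c j where c: "c \<noteq> 0" "j \<ge> e" "G i ^ e = [:c:] * F ^ j" by blast
    have G0: "map_poly \<phi> (G i) \<noteq> 0" using False by simp
    have "map_poly \<phi> (G i) ^ e = [:\<phi> c:] * F' ^ j"
      unfolding F'_def mp.hom_power[symmetric] c(3) mp.hom_mult by (simp add: \<phi>.map_poly_pCons_hom)
    hence "order x (map_poly \<phi> (G i) ^ e) = order x ([:\<phi> c:] * F' ^ j)" by simp
    also have "\<dots> = order x (F' ^ j)" using c(1) by (simp add: order_smult)
    finally have "e * order x (map_poly \<phi> (G i)) = j * m"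
      by (simp only: order_power[OF G0] order_power[OF F'0] m_def)
    also have "\<dots> \<ge> e * m" using c(2) by simp
    finally have "m \<le> order x (map_poly \<phi> (G i))" using e by simp
    thus ?thesis using order_divides by blast
  qed (simp add: mp.hom_zero)
  hence "[:-x, 1:] ^ m dvd (\<Sum>i\<in>I. map_poly \<phi> (G i) * map_poly \<phi> (H i))"
    by (intro dvd_sum dvd_mult2)
  also have "\<dots> = pderiv F'"
    unfolding F'_def \<phi>.map_poly_pderiv[symmetric] der by (simp add: mp.hom_sum mp.hom_mult)
  finally have "pderiv F' = 0 \<or> m \<le> order x (pderiv F')" by (simp only: order_divides)
  moreover have "pderiv F' \<noteq> 0" using F' by (simp add: pderiv_eq_0_iff)
  ultimately show False using m by simp
qed

lemma exponent_split:
  assumes "k \<le> mon_deg m" shows "\<exists>a b. m = a + b \<and> mon_deg a = k"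
  using assms
proof (induction k)
  case 0
  show ?case by (intro exI[of _ 0] exI[of _ m]) simp
next
  case (Suc k)
  then obtain a b where ab: "m = a + b" "mon_deg a = k" by auto
  with Suc.prems have "mon_deg b \<noteq> 0" by (simp add: mon_deg_add)
  hence "b \<noteq> 0" by auto
  then obtain i where i: "lookup b i \<noteq> 0" by (metis lookup_zero poly_mapping_eqI)
  have "b = single i 1 + (b - single i 1)"
    using i by (intro poly_mapping_eqI) (auto simp: lookup_add lookup_minus lookup_single when_def)
  hence "m = (a + single i 1) + (b - single i 1)" using ab by (metis add.assoc)
  moreover have "mon_deg (a + single i 1) = Suc k" using ab by (simp add: mon_deg_add)
  ultimately show ?case by blast
qed

text \<open>
  Isomorphism of the Poisson algebras carried by the subsets $V$ and $B$ of two types.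
\<close>

definition (in veronese_poisson) poisson_equiv ::
    "'k mpol poly set \<Rightarrow> ('k mpol \<Rightarrow> 'k mpol poly) \<Rightarrow> bool" where
  "poisson_equiv B \<psi> \<longleftrightarrow> bij_betw \<psi> V B \<and> \<psi> 1 = 1 \<and>
     (\<forall>p\<in>V. \<forall>q\<in>V. \<psi> (p + q) = \<psi> p + \<psi> q \<and> \<psi> (p * q) = \<psi> p * \<psi> q
        \<and> \<psi> (br p q) = lift_bracket br (\<psi> p) (\<psi> q)) \<and>
     (\<forall>c. \<forall>p\<in>V. \<psi> (pconst c * p) = [:pconst c:] * \<psi> p)"

text \<open>
  The common algebra $R = A[t] = B[s]$, where $A$ is the Veronese subring. The bracket of $R$ is the
  one extended from $A$; that it is also the one extended from $B$ is the content of the last two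
  assumptions.
\<close>

locale two_presentations =
  veronese_poisson n br r d + free_adjunction B "{P. coeffs_in (veronese_carrier n d) P}" s
  for n and br :: "'k::{alg_closed_field, field_char_0} mpol \<Rightarrow> 'k mpol \<Rightarrow> 'k mpol" and r d
    and B :: "'k mpol poly set" and s :: "'k mpol poly" +
  assumes const_mem: "[:pconst c:] \<in> B"
    and base_bracket_mem: "b \<in> B \<Longrightarrow> b' \<in> B \<Longrightarrow> lift_bracket br b b' \<in> B"
    and gen_bracket: "coeffs_in (veronese_carrier n d) p \<Longrightarrow> lift_bracket br s p = 0"
begin

abbreviation R :: "'k mpol poly set" where "R \<equiv> {P. coeffs_in V P}"
abbreviation rb :: "'k mpol poly \<Rightarrow> 'k mpol poly \<Rightarrow> 'k mpol poly" where "rb \<equiv> lift_bracket br"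

sublocale RB: poisson_subring R rb by (rule V.poisson_subring_lift)

lemma const_in_R: "a \<in> V \<Longrightarrow> [:a:] \<in> R"
  by (simp add: V.coeffs_in_pCons V.coeffs_in_0)

lemma t_in_R: "[:0, 1:] \<in> R"
  by (simp add: V.coeffs_in_pCons V.coeffs_in_0 V.zero_mem V.one_mem del: pCons_one)

lemma base_R: "b \<in> B \<Longrightarrow> b \<in> R" using base_subset by blast

sublocale BB: poisson_subring B rb
proof
  fix x y assume "x \<in> B" "y \<in> B"
  thus "rb x y \<in> B" "rb x y = - rb y x"
    using base_bracket_mem by (blast, intro RB.bracket_anti base_R)
next
  fix x y z assume "x \<in> B" "y \<in> B" "z \<in> B"
  hence xyz: "x \<in> R" "y \<in> R" "z \<in> R" by (auto dest: base_R)
  show "rb (x + y) z = rb x z + rb y z" by (rule RB.bracket_add[OF xyz])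
  show "rb (x * y) z = x * rb y z + y * rb x z" by (rule RB.bracket_mult[OF xyz])
qed

lemma rb_const: "a \<in> V \<Longrightarrow> c \<in> V \<Longrightarrow> rb [:a:] [:c:] = [:br a c:]"
  using V.lift_bracket_monom[of a c 0 0] by (simp add: monom_0)

lemma rb_gen_power: assumes "p \<in> R" shows "rb (s ^ k) p = 0"
  using RB.bracket_power_eq_0[OF gen_mem assms] gen_bracket assms by simp

lemma rb_monom: assumes b: "b \<in> B" and p: "p \<in> R" shows "rb (b * s ^ k) p = s ^ k * rb b p"
  using RB.bracket_mult[OF base_R[OF b] R.power_mem[OF gen_mem] p] rb_gen_power[OF p] by simp

lemma rb_poly:
  assumes "coeffs_in B F" "coeffs_in B G"
  shows "rb (poly F s) (poly G s) = poly (lift_bracket rb F G) s"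
  using assms(1)
proof (induction F rule: coeffs_in_induct)
  case (monom x i)
  show ?case using assms(2)
  proof (induction G rule: coeffs_in_induct)
    case (monom y j)
    have R: "y * s ^ j \<in> R" "x \<in> R" "y \<in> R"
      using monom \<open>x \<in> B\<close> base_R R.mult_mem R.power_mem gen_mem by blast+
    have "rb (x * s ^ i) (y * s ^ j) = s ^ i * rb x (y * s ^ j)"
      by (rule rb_monom[OF \<open>x \<in> B\<close> R(1)])
    also have "rb x (y * s ^ j) = - (s ^ j * rb y x)"
      using RB.bracket_anti[OF R(2,1)] rb_monom[OF monom R(2)] by simp
    also have "\<dots> = s ^ j * rb x y" using RB.bracket_anti[OF R(2,3)] by simp
    finally show ?case
      using BB.lift_bracket_monom[OF \<open>x \<in> B\<close> monom]
      by (simp add: poly_monom power_add ac_simps)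
  next
    case (add G G')
    thus ?case using \<open>x \<in> B\<close>
      by (simp add: RB.bracket_add_right poly_in[simplified] BB.lift_bracket_add_right coeffs_in_monom)
  qed
next
  case (add F F')
  thus ?case using assms(2) by (simp add: RB.bracket_add poly_in[simplified] BB.lift_bracket_add)
qed

lemma expand_bracket:
  assumes "p \<in> R" "q \<in> R"
  shows "expand (rb p q) = lift_bracket rb (expand p) (expand q)"
  using rb_poly[OF expand(1) expand(1), OF assms]
    expand_unique[OF BB.lift_bracket_mem[OF expand(1) expand(1)], OF assms] assms
  by (simp add: expand(2))

text \<open>Differentiation with respect to $s$, a Poisson derivation with kernel $B$.\<close>

definition D :: "'k mpol poly \<Rightarrow> 'k mpol poly" where
  "D p = poly (pderiv (expand p)) s"

text \<open>The homomorphism $R \to R/(s) = B$.\<close>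

definition proj :: "'k mpol poly \<Rightarrow> 'k mpol poly" where
  "proj p = coeff (expand p) 0"

lemma D_mem: "p \<in> R \<Longrightarrow> D p \<in> R"
  unfolding D_def by (intro poly_in coeffs_in_pderiv expand(1))

lemma expand_D: "p \<in> R \<Longrightarrow> expand (D p) = pderiv (expand p)"
  unfolding D_def by (intro expand_unique coeffs_in_pderiv expand(1))

lemma D_add: "p \<in> R \<Longrightarrow> q \<in> R \<Longrightarrow> D (p + q) = D p + D q"
  by (simp add: D_def expand_add pderiv_add)

lemma D_mult: "p \<in> R \<Longrightarrow> q \<in> R \<Longrightarrow> D (p * q) = p * D q + q * D p"
  by (simp add: D_def expand_mult pderiv_mult expand(2))

lemma D_base: "b \<in> B \<Longrightarrow> D b = 0"
  by (simp add: D_def expand_base pderiv_pCons)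

lemma D_bracket: "p \<in> R \<Longrightarrow> q \<in> R \<Longrightarrow> D (rb p q) = rb (D p) q + rb p (D q)"
proof -
  assume pq: "p \<in> R" "q \<in> R"
  have "D (rb p q) = poly (lift_bracket rb (pderiv (expand p)) (expand q)) s
      + poly (lift_bracket rb (expand p) (pderiv (expand q))) s"
    unfolding D_def expand_bracket[OF pq]
    by (simp add: BB.pderiv_lift_bracket[OF expand(1)[OF pq(1)] expand(1)[OF pq(2)]])
  also have "\<dots> = rb (D p) q + rb p (D q)"
    using pq by (simp add: D_def expand(2) coeffs_in_pderiv expand(1) flip: rb_poly)
  finally show ?thesis .
qed

lemma proj_mem: "p \<in> R \<Longrightarrow> proj p \<in> B"
  using expand(1)[of p] by (simp add: proj_def coeffs_in_def)

lemma proj_add: "p \<in> R \<Longrightarrow> q \<in> R \<Longrightarrow> proj (p + q) = proj p + proj q"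
  by (simp add: proj_def expand_add)

lemma proj_mult: "p \<in> R \<Longrightarrow> q \<in> R \<Longrightarrow> proj (p * q) = proj p * proj q"
  by (simp add: proj_def expand_mult coeff_mult)

lemma proj_pCons:
  assumes "a \<in> V" "P \<in> R" shows "proj (pCons a P) = proj [:a:] + proj [:0, 1:] * proj P"
proof -
  have "pCons a P = [:a:] + [:0, 1:] * P" by simp
  hence "proj (pCons a P) = proj ([:a:] + [:0, 1:] * P)" by (rule arg_cong)
  also have "\<dots> = proj [:a:] + proj [:0, 1:] * proj P"
    unfolding proj_add[OF const_in_R[OF assms(1)] R.mult_mem[OF t_in_R assms(2)]]
      proj_mult[OF t_in_R assms(2)] by (rule refl)
  finally show ?thesis .
qed

lemma proj_base: "b \<in> B \<Longrightarrow> proj b = b"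
  by (simp add: proj_def expand_base)

lemma proj_gen: "proj s = 0"
  by (simp add: proj_def expand_gen)

lemma proj_bracket: "p \<in> R \<Longrightarrow> q \<in> R \<Longrightarrow> proj (rb p q) = rb (proj p) (proj q)"
  by (simp only: proj_def expand_bracket BB.coeff_lift_bracket expand(1)) simp

lemma proj_cong_gen: assumes "p \<in> R" obtains q where "q \<in> R" "p = proj p + s * q"
proof -
  obtain a F where F: "expand p = pCons a F" by (metis pCons_cases)
  have "coeffs_in B F" using expand(1)[OF assms] F by (simp add: coeffs_in_pCons)
  moreover have "p = proj p + s * poly F s" using expand(2)[OF assms] F by (simp add: proj_def)
  ultimately show thesis using that poly_in by blast
qed

lemma coeff_rb_const:
  assumes "p \<in> R" "q \<in> V" shows "coeff (rb p [:q:]) i = br (coeff p i) q"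
proof -
  have "coeff (rb p [:q:]) i = (\<Sum>l\<le>i. br (coeff p l) (coeff [:q:] (i - l)))"
    using assms const_in_R by (intro V.coeff_lift_bracket) auto
  also have "\<dots> = (\<Sum>l\<le>i. if l = i then br (coeff p i) q else 0)"
    using assms by (intro sum.cong refl) (auto simp: coeffs_in_def V.bracket_0 coeff_pCons split: nat.splits)
  finally show ?thesis by simp
qed

definition Rcentral :: "'k mpol poly \<Rightarrow> bool" where
  "Rcentral p \<longleftrightarrow> p \<in> R \<and> (\<forall>q\<in>R. rb p q = 0)"

text \<open>
  As $t$ is central, commuting with an element of $A$ is a condition on each coefficient.
\<close>

lemma Rcentral_iff: "Rcentral p \<longleftrightarrow> p \<in> R \<and> (\<forall>i. central (coeff p i))"
proof safe
  assume p: "Rcentral p"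
  hence pR: "p \<in> R" by (simp add: Rcentral_def)
  thus "coeffs_in V p" by simp
  fix i show "central (coeff p i)"
  proof (rule central_if_commutes_with_V)
    show "coeff p i \<in> V" using pR by (simp add: coeffs_in_def)
    fix q assume q: "q \<in> V"
    have "rb p [:q:] = 0" using p const_in_R[OF q] unfolding Rcentral_def by blast
    thus "br (coeff p i) q = 0" using coeff_rb_const[OF pR q, of i] by simp
  qed
next
  assume p: "coeffs_in V p" "\<forall>i. central (coeff p i)"
  have "rb p q = 0" if "q \<in> R" for q
  proof (intro poly_eqI)
    fix k
    have "coeff (rb p q) k = (\<Sum>i\<le>k. br (coeff p i) (coeff q (k - i)))"
      using p that by (intro V.coeff_lift_bracket) auto
    also have "\<dots> = 0" using p that by (intro sum.neutral) (auto simp: central_br coeffs_in_def V_polys)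
    finally show "coeff (rb p q) k = coeff 0 k" by simp
  qed
  with p show "Rcentral p" by (simp add: Rcentral_def)
qed

lemma Rcentral_const: "central a \<Longrightarrow> a \<in> V \<Longrightarrow> Rcentral [:a:]"
  using const_in_R[of a] central_pconst[of 0]
  by (auto simp: Rcentral_iff coeff_pCons split: nat.splits)

lemma Rcentral_gen: "Rcentral s"
  using gen_mem gen_bracket by (simp add: Rcentral_def)

lemma Rcentral_D: "Rcentral p \<Longrightarrow> Rcentral (D p)"
  unfolding Rcentral_def
proof safe
  assume p: "coeffs_in V p" "\<forall>q\<in>R. rb p q = 0"
  show "coeffs_in V (D p)" using D_mem[of p] p by simp
  fix q assume q: "coeffs_in V q"
  have "D (rb p q) = rb (D p) q + rb p (D q)" using p q by (intro D_bracket) auto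
  moreover have "rb p q = 0" "rb p (D q) = 0" using p q D_mem[of q] by auto
  moreover have "D 0 = 0" by (simp add: D_def expand_0)
  ultimately show "rb (D p) q = 0" by simp
qed

text \<open>
  As $s$ is central, commuting with $B$ is a condition on each coefficient in the expansion by $s$, and
  a coefficient that commutes with $B$ and $s$ is central in $R$.
\<close>

lemma Rcentral_expand: assumes "Rcentral p" shows "Rcentral (coeff (expand p) i)"
proof -
  have p: "p \<in> R" "\<And>q. q \<in> R \<Longrightarrow> rb p q = 0" using assms by (auto simp: Rcentral_def)
  let ?b = "coeff (expand p) i"
  have b: "?b \<in> B" using expand(1)[OF p(1)] by (simp add: coeffs_in_def)
  have comm: "rb ?b c = 0" if c: "c \<in> B" for c
  proof -
    have "lift_bracket rb (expand p) [:c:] = 0"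
      using expand_bracket[OF p(1) base_R[OF c]] p(2)[OF base_R[OF c]] c by (simp add: expand_base expand_0)
    hence "0 = (\<Sum>l\<le>i. rb (coeff (expand p) l) (coeff [:c:] (i - l)))"
      using BB.coeff_lift_bracket[OF expand(1)[OF p(1)], of "[:c:]" i] c
      by (simp add: coeffs_in_pCons coeffs_in_0)
    also have "\<dots> = (\<Sum>l\<le>i. if l = i then rb ?b c else 0)"
    proof (intro sum.cong refl)
      fix l assume "l \<in> {..i}"
      moreover have "rb (coeff (expand p) l) 0 = 0"
        using expand(1)[OF p(1)] by (intro BB.bracket_0(2)) (simp add: coeffs_in_def)
      ultimately show "rb (coeff (expand p) l) (coeff [:c:] (i - l)) = (if l = i then rb ?b c else 0)"
        by (auto simp: coeff_pCons split: nat.splits)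
    qed
    finally show ?thesis by simp
  qed
  have "rb ?b q = 0" if q: "q \<in> R" for q
  proof -
    have "rb (poly [:?b:] s) (poly (expand q) s) = poly (lift_bracket rb [:?b:] (expand q)) s"
      using b expand(1)[OF q] by (intro rb_poly) (auto simp: coeffs_in_pCons coeffs_in_0)
    moreover have "lift_bracket rb [:?b:] (expand q) = 0"
    proof (rule poly_eqI)
      fix k
      have "coeff (lift_bracket rb [:?b:] (expand q)) k
          = (\<Sum>l\<le>k. rb (coeff [:?b:] l) (coeff (expand q) (k - l)))"
        using b expand(1)[OF q] by (intro BB.coeff_lift_bracket) (auto simp: coeffs_in_pCons coeffs_in_0)
      also have "\<dots> = 0"
      proof (intro sum.neutral ballI)
        fix l assume "l \<in> {..k}"
        have "coeff (expand q) (k - l) \<in> B" using expand(1)[OF q] by (simp add: coeffs_in_def)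
        thus "rb (coeff [:?b:] l) (coeff (expand q) (k - l)) = 0"
          using comm BB.bracket_0 by (cases l) auto
      qed
      finally show "coeff (lift_bracket rb [:?b:] (expand q)) k = coeff 0 k" by simp
    qed
    ultimately show ?thesis using q by (simp add: expand(2))
  qed
  thus ?thesis using base_R[OF b] by (simp add: Rcentral_def)
qed

lemma Rcentral_proj: "Rcentral p \<Longrightarrow> Rcentral (proj p)"
  unfolding proj_def by (rule Rcentral_expand)

subsection \<open>The centre is contained in the second coefficient ring\<close>

text \<open>
  The coefficients of $s$ as a polynomial $S$ in $t$ are central in $A$, so by assumption they lie in
  $B$. With $t = T(s)$ this gives $S(T(s)) = s$ and hence $S \circ T = X$ over $B$. So both polynomials
  are linear, $s = a_0 + a_1 t$ with a unit $a_1$, and evaluation at the root $c$ of $s$ inverts the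
  map $A \to R/(s) = B$.
\<close>

lemma equiv_if_centre_in_base:
  assumes into_base: "\<And>f. f \<in> V \<Longrightarrow> central f \<Longrightarrow> [:f:] \<in> B"
  shows "\<exists>\<psi>. poisson_equiv B \<psi>"
proof -
  define S where "S = map_poly (\<lambda>a. [:a:]) s"
  define T where "T = expand [:0, 1:]"
  have coeff_S: "coeff S i = [:coeff s i:]" for i by (simp add: S_def coeff_map_poly)
  have SB: "coeffs_in B S"
    using Rcentral_gen by (auto simp: coeffs_in_def coeff_S Rcentral_iff intro!: into_base)
  have TB: "coeffs_in B T" and Ts: "poly T s = [:0, 1:]"
    using expand[OF t_in_R] by (simp_all add: T_def)
  have "poly S [:0, 1:] = s"
    using pcompose_altdef[of s "[:0,1:]"] pcompose_idR[of s] by (simp add: S_def)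
  hence "poly (pcompose S T) s = s" by (simp add: poly_pcompose Ts)
  hence comp: "pcompose S T = [:0, 1:]"
    using expand_unique[OF coeffs_in_pcompose[OF SB TB]] expand_gen by simp
  hence "degree S * degree T = 1"
    using degree_pcompose[of S T] by simp
  hence deg: "degree S = 1" "degree T = 1" by simp_all
  have degs: "degree s = 1" using deg(1) by (simp add: S_def degree_map_poly)
  obtain a0 a1 where s: "s = [:a0, a1:]" "a1 \<noteq> 0"
    using degs by (metis degree1_coeffs)
  obtain T0 T1 where T: "T = [:T0, T1:]" "T1 \<noteq> 0"
    using deg(2) by (metis degree1_coeffs)
  have S: "S = [:[:a0:], [:a1:]:]" using s by (simp add: S_def map_poly_pCons)
  have "coeff (pcompose S T) 1 = 1" by (simp add: comp)
  hence unit: "[:a1:] * T1 = 1" unfolding S T by (simp add: pcompose_pCons)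
  hence "degree T1 = 0"
    using degree_mult_eq[of "[:a1:]" T1] s T by (metis add_0 degree_1 degree_pCons_0 pCons_eq_0_iff)
  then obtain u where u: "T1 = [:u:]" by (metis degree_eq_zeroE)
  have "poly ([:a1:] * T1) 0 = 1" by (simp only: unit poly_1)
  hence ua: "a1 * u = 1" by (simp add: u mult.commute)
  have aV: "a0 \<in> V" "a1 \<in> V" using gen_mem s by (simp_all add: V.coeffs_in_pCons)
  have "T1 \<in> R" using TB base_R by (simp add: T coeffs_in_pCons)
  hence uV: "u \<in> V" by (simp add: u V.coeffs_in_pCons)
  define c where "c = - (u * a0)"
  have cV: "c \<in> V" unfolding c_def by (intro V.uminus_mem V.mult_mem uV aV)
  have t: "[:0, 1:] = [:c:] + [:u:] * s"
    using ua by (simp add: s c_def mult.commute)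
  have proj_t: "proj [:0, 1:] = proj [:c:]"
  proof -
    have "[:u:] * s \<in> R" by (intro R.mult_mem const_in_R uV gen_mem)
    hence "proj [:0, 1:] = proj [:c:] + proj [:u:] * proj s"
      unfolding t by (simp only: proj_add[OF const_in_R[OF cV]] proj_mult[OF const_in_R[OF uV] gen_mem])
    thus ?thesis by (simp add: proj_gen)
  qed
  have ev: "proj P = proj [:poly P c:]" if "coeffs_in V P" for P
    using that
  proof (induction P)
    case (pCons a P)
    hence P: "a \<in> V" "coeffs_in V P" by (auto simp: V.coeffs_in_pCons)
    have "proj (pCons a P) = proj [:a:] + proj [:0, 1:] * proj P"
      using P by (intro proj_pCons) auto
    also have "\<dots> = proj [:a:] + proj [:c:] * proj [:poly P c:]" using pCons.IH[OF P(2)] proj_t by simp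
    also have "\<dots> = proj ([:a:] + [:c:] * [:poly P c:])"
      using P const_in_R cV V.poly_mem R.mult_mem by (simp only: proj_add proj_mult)
    finally show ?case by (simp add: mult.commute)
  qed simp
  define \<psi> where "\<psi> = (\<lambda>a. proj [:a:])"
  have "bij_betw \<psi> V B"
  proof (rule bij_betwI')
    fix p q assume pq: "p \<in> V" "q \<in> V"
    show "(\<psi> p = \<psi> q) = (p = q)"
    proof
      assume eq: "\<psi> p = \<psi> q"
      obtain w where w: "w \<in> R" "[:p - q:] = proj [:p - q:] + s * w"
        using proj_cong_gen[OF const_in_R[OF V.diff_mem[OF pq]]] by blast
      have "proj [:p:] = proj ([:p - q:] + [:q:])" by simp
      also have "\<dots> = proj [:p - q:] + proj [:q:]"
        using pq V.diff_mem const_in_R by (intro proj_add) auto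
      finally have "proj [:p - q:] = 0" using eq by (simp add: \<psi>_def)
      with w have eq': "[:p - q:] = s * w" by simp
      have "w = 0"
      proof (rule ccontr)
        assume "w \<noteq> 0"
        hence "degree (s * w) = 1 + degree w"
          using s degs by (subst degree_mult_eq) auto
        with eq' show False by (metis degree_pCons_0 add_is_0 one_neq_zero)
      qed
      with eq' show "p = q" by simp
    qed simp
  next
    fix p assume "p \<in> V"
    thus "\<psi> p \<in> B" unfolding \<psi>_def using proj_mem const_in_R by blast
  next
    fix b assume b: "b \<in> B"
    have "b = \<psi> (poly b c)" using ev[of b] base_R[OF b] proj_base[OF b] by (simp add: \<psi>_def)
    moreover have "poly b c \<in> V" using base_R[OF b] cV by (intro V.poly_mem) auto
    ultimately show "\<exists>x\<in>V. b = \<psi> x" by blast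
  qed
  moreover have "\<psi> 1 = 1" using proj_base[OF one_mem] by (simp add: \<psi>_def)
  moreover have "\<psi> (p + q) = \<psi> p + \<psi> q \<and> \<psi> (p * q) = \<psi> p * \<psi> q \<and> \<psi> (br p q) = rb (\<psi> p) (\<psi> q)"
    if "p \<in> V" "q \<in> V" for p q
  proof -
    have "[:p + q:] = [:p:] + [:q:]" "[:p * q:] = [:p:] * [:q:]" by simp_all
    thus ?thesis
      unfolding \<psi>_def rb_const[OF that, symmetric]
      by (simp only: proj_add[OF const_in_R const_in_R, OF that] proj_mult[OF const_in_R const_in_R, OF that]
          proj_bracket[OF const_in_R const_in_R, OF that])
  qed
  moreover have "\<psi> (pconst c * p) = [:pconst c:] * \<psi> p" if "p \<in> V" for c p
  proof -
    have "[:pconst c * p:] = [:pconst c:] * [:p:]" by simp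
    hence "\<psi> (pconst c * p) = proj [:pconst c:] * proj [:p:]"
      unfolding \<psi>_def using const_in_R that pconst_in_V by (simp only: proj_mult)
    thus ?thesis using proj_base[OF const_mem] by (simp add: \<psi>_def)
  qed
  ultimately show ?thesis unfolding poisson_equiv_def by blast
qed

end

context two_presentations
begin

lemma const_poly_power: "[:a:] ^ k = [:a ^ k:]" for a :: "'k mpol"
  by (induction k) (simp_all add: one_pCons del: pCons_one)

lemma expand_const_power: "a \<in> V \<Longrightarrow> expand [:a ^ k:] = expand [:a:] ^ k"
  using expand_power[OF const_in_R] by (simp add: const_poly_power)

lemma expand_scaled_power:
  assumes "h \<in> V" "f \<in> V" "f ^ j = pconst c * h ^ k"
  shows "expand [:f:] ^ j = [:[:pconst c:]:] * expand [:h:] ^ k"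
proof -
  have "[:f ^ j:] = [:pconst c:] * [:h ^ k:]" using assms by simp
  hence "expand [:f ^ j:] = expand [:pconst c:] * expand [:h ^ k:]"
    using const_in_R[OF pconst_in_V] const_in_R[OF V.power_mem[OF assms(1)]] by (simp only: expand_mult)
  thus ?thesis
    by (simp only: expand_base[OF const_mem] expand_const_power[OF assms(1)] expand_const_power[OF assms(2)])
qed

text \<open>
  If some central element is moved by $D$, then so is the homogeneous one of least positive degree:
  a power of it is proportional to a power of a homogeneous one that is moved.
\<close>

lemma least_central_homogeneous:
  assumes f0: "f0 \<in> V" "central f0" "[:f0:] \<notin> B"
  obtains f e where "e > 0" "f \<in> V" "central f" "f \<in> hom_part n e" "f \<noteq> 0"
    "degree (expand [:f:]) > 0"
    "\<And>g j. g \<in> V \<Longrightarrow> central g \<Longrightarrow> g \<in> hom_part n j \<Longrightarrow> g \<noteq> 0 \<Longrightarrow> j > 0 \<Longrightarrow> e \<le> j"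
proof -
  have "\<exists>e0. [:hcomp e0 f0:] \<notin> B"
  proof (rule ccontr)
    assume "\<not> ?thesis"
    hence "(\<Sum>j\<le>degree (grade f0). [:hcomp j f0:]) \<in> B" by (intro sum_mem) simp
    also have "(\<Sum>j\<le>degree (grade f0). [:hcomp j f0:])
        = [:\<Sum>j\<le>degree (grade f0). hcomp j f0:]"
      by (rule poly_eqI) (simp add: coeff_sum coeff_pCons split: nat.splits)
    finally show False using f0(3) by (simp flip: sum_hcomp)
  qed
  then obtain e0 where e0: "[:hcomp e0 f0:] \<notin> B" by blast
  define h where "h = hcomp e0 f0"
  have h: "h \<in> V" "central h" "h \<in> hom_part n e0" "[:h:] \<notin> B"
    using f0 e0 by (simp_all add: h_def hcomp_in_V central_hcomp hcomp_in_hom_part V_polys)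
  have h0: "h \<noteq> 0" using h(4) zero_mem by auto
  have e0_pos: "e0 > 0"
  proof (rule ccontr)
    assume "\<not> e0 > 0"
    hence "h = pconst (lookup h 0)" using hom_part_0 h(3) by auto
    thus False using h(4) const_mem by metis
  qed
  define Q where "Q = (\<lambda>e. e > 0 \<and> (\<exists>f. f \<in> V \<and> central f \<and> f \<in> hom_part n e \<and> f \<noteq> 0))"
  define e where "e = (LEAST e. Q e)"
  have "Q e0" using h h0 e0_pos by (auto simp: Q_def)
  hence "Q e" unfolding e_def by (rule LeastI)
  then obtain f where f: "e > 0" "f \<in> V" "central f" "f \<in> hom_part n e" "f \<noteq> 0" by (auto simp: Q_def)
  have min: "e \<le> j" if "g \<in> V" "central g" "g \<in> hom_part n j" "g \<noteq> 0" "j > 0" for g j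
    unfolding e_def by (rule Least_le) (use that in \<open>auto simp: Q_def\<close>)
  obtain c where c: "c \<noteq> 0" "f ^ e0 = pconst c * h ^ e"
    using central_homogeneous_powers[OF f(3-5) h(2,3) h0] by blast
  have "expand [:f:] ^ e0 = [:[:pconst c:]:] * expand [:h:] ^ e"
    by (rule expand_scaled_power[OF h(1) f(2) c(2)])
  hence "degree (expand [:f:] ^ e0) = degree (expand [:h:] ^ e)"
    using c(1) by simp
  moreover have "expand [:h:] \<noteq> 0" "expand [:f:] \<noteq> 0"
    using h0 f const_in_R h(1) by (simp_all add: expand_eq_0_iff)
  ultimately have "e0 * degree (expand [:f:]) = e * degree (expand [:h:])"
    by (simp add: degree_power_eq mult.commute)
  moreover have "degree (expand [:h:]) \<noteq> 0"
    using mem_base_iff[OF const_in_R[OF h(1)]] h(4) by simp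
  ultimately have "degree (expand [:f:]) > 0" using f(1) e0_pos by (metis mult_is_0 neq0_conv)
  from that[OF f this min] show thesis .
qed

text \<open>
  Otherwise all homogeneous components of the coefficients of $D f$ have positive degree $j$, hence
  $j \ge e$, and their $e$-th powers are proportional to $f^j$. This contradicts the count of
  multiplicities for the derivative of $f$ with respect to $s$.
\<close>

lemma derivative_has_constant_term:
  assumes f: "e > 0" "f \<in> V" "central f" "f \<in> hom_part n e" "f \<noteq> 0"
    and deg: "degree (expand [:f:]) > 0"
    and min: "\<And>g j. g \<in> V \<Longrightarrow> central g \<Longrightarrow> g \<in> hom_part n j \<Longrightarrow> g \<noteq> 0 \<Longrightarrow> j > 0 \<Longrightarrow> e \<le> j"
  shows "\<exists>i. lookup (coeff (D [:f:]) i) 0 \<noteq> 0"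
proof (rule ccontr)
  assume no: "\<not> ?thesis"
  define w where "w = D [:f:]"
  have wR: "w \<in> R" unfolding w_def by (intro D_mem const_in_R f)
  have wc: "central (coeff w i)" "coeff w i \<in> V" for i
    using Rcentral_D[OF Rcentral_const[OF f(3,2)]] wR by (auto simp: Rcentral_iff w_def coeffs_in_def)
  define J where "J = (\<lambda>i. {..degree (grade (coeff w i))})"
  define I where "I = (SIGMA i:{..degree w}. J i)"
  define g where "g = (\<lambda>(i,j). hcomp j (coeff w i))"
  have gV: "g x \<in> V" for x by (cases x) (simp add: g_def hcomp_in_V wc)
  have "w = (\<Sum>i\<le>degree w. monom (coeff w i) i)"
    by (rule poly_as_sum_of_monoms[symmetric])
  also have "\<dots> = (\<Sum>i\<le>degree w. \<Sum>j\<in>J i. [:g (i,j):] * [:0,1:] ^ i)"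
  proof (intro sum.cong refl)
    fix i
    have "monom (coeff w i) i = [:coeff w i:] * [:0,1:] ^ i" by (simp add: monom_altdef)
    also have "[:coeff w i:] = [:\<Sum>j\<in>J i. hcomp j (coeff w i):]"
      unfolding J_def using sum_hcomp[of "coeff w i"] by simp
    also have "\<dots> = (\<Sum>j\<in>J i. [:g (i,j):])"
      by (rule poly_eqI) (simp add: coeff_sum g_def coeff_pCons split: nat.splits)
    finally show "monom (coeff w i) i = (\<Sum>j\<in>J i. [:g (i,j):] * [:0,1:] ^ i)"
      by (simp only: sum_distrib_right)
  qed
  also have "\<dots> = (\<Sum>x\<in>I. [:g x:] * [:0,1:] ^ fst x)"
    unfolding I_def by (subst sum.Sigma) (auto simp: J_def case_prod_beta)
  finally have w_eq: "w = (\<Sum>x\<in>I. [:g x:] * [:0,1:] ^ fst x)" .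
  have "pderiv (expand [:f:]) = expand w"
    unfolding w_def by (rule expand_D[OF const_in_R[OF f(2)], symmetric])
  also have "\<dots> = (\<Sum>x\<in>I. expand [:g x:] * expand [:0,1:] ^ fst x)"
  proof -
    have m: "[:g x:] \<in> R" "[:0,1:] ^ fst x \<in> R" for x
      by (rule const_in_R[OF gV], rule R.power_mem[OF t_in_R])
    show ?thesis
      by (subst w_eq, subst expand_sum) (use m R.mult_mem in \<open>simp_all only: expand_mult expand_power[OF t_in_R]\<close>)
  qed
  finally have der: "pderiv (expand [:f:]) = (\<Sum>x\<in>I. expand [:g x:] * expand [:0,1:] ^ fst x)" .
  show False
  proof (rule derivative_not_in_span_of_power_divisible[OF deg f(1) der])
    fix x assume "x \<in> I"
    show "expand [:g x:] = 0 \<or> (\<exists>c j. c \<noteq> 0 \<and> j \<ge> e \<and> expand [:g x:] ^ e = [:c:] * expand [:f:] ^ j)"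
    proof (cases "g x = 0")
      case False
      obtain i j where x: "x = (i, j)" by (cases x)
      have gx: "g x = hcomp j (coeff w i)" by (simp add: x g_def)
      have g: "central (g x)" "g x \<in> hom_part n j"
        unfolding gx using wc by (auto intro: central_hcomp hcomp_in_hom_part V_polys)
      have "j > 0"
      proof (rule ccontr)
        assume "\<not> j > 0"
        hence "g x = 0" using no by (simp add: gx hcomp_zero w_def)
        with False show False by simp
      qed
      hence "e \<le> j" using min[OF gV g False] by simp
      moreover obtain c where "c \<noteq> 0" "g x ^ e = pconst c * f ^ j"
        using central_homogeneous_powers[OF g False f(3-5)] by blast
      moreover from this have "expand [:g x:] ^ e = [:[:pconst c:]:] * expand [:f:] ^ j"
        by (intro expand_scaled_power f gV)
      moreover have "[:pconst c:] \<noteq> 0" using \<open>c \<noteq> 0\<close> by simp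
      ultimately show ?thesis by blast
    qed (simp add: expand_0)
  qed
qed

end

subsection \<open>Derivations that lower degrees\<close>

text \<open>
  The index \<open>i0\<close> picks a coefficient of $D f$, as a polynomial in $t$, with nonzero constant term.
\<close>

locale moved_centre = two_presentations n br r d B s
  for n and br :: "'k::{alg_closed_field, field_char_0} mpol \<Rightarrow> 'k mpol \<Rightarrow> 'k mpol" and r d B s +
  fixes f :: "'k mpol" and e i0 :: nat
  assumes e_pos: "e > 0" and f: "f \<in> V" "central f" "f \<in> hom_part n e" "f \<noteq> 0"
    and moved: "lookup (coeff (D [:f:]) i0) 0 \<noteq> 0"
begin

text \<open>
  The coefficient of $t^{i_0}$ is linear over $A$; so $\delta$ is a Poisson derivation of $A$, and
  $\Lambda$ a point derivation at the origin.
\<close>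

definition \<delta> :: "'k mpol \<Rightarrow> 'k mpol" where "\<delta> a = coeff (D [:a:]) i0"

definition \<Lambda> :: "'k mpol \<Rightarrow> 'k" where "\<Lambda> a = lookup (\<delta> a) 0"

lemma \<delta>_mem: "a \<in> V \<Longrightarrow> \<delta> a \<in> V"
  using D_mem[OF const_in_R] by (simp add: \<delta>_def coeffs_in_def)

lemma \<delta>_add: "a \<in> V \<Longrightarrow> b \<in> V \<Longrightarrow> \<delta> (a + b) = \<delta> a + \<delta> b"
  using D_add[OF const_in_R const_in_R, of a b] by (simp add: \<delta>_def)

lemma \<delta>_mult: "a \<in> V \<Longrightarrow> b \<in> V \<Longrightarrow> \<delta> (a * b) = a * \<delta> b + b * \<delta> a"
proof -
  assume ab: "a \<in> V" "b \<in> V"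
  have "[:a * b:] = [:a:] * [:b:]" by simp
  thus ?thesis
    unfolding \<delta>_def by (simp only: D_mult[OF const_in_R const_in_R, OF ab]) simp
qed

lemma \<delta>_pconst: "\<delta> (pconst c) = 0"
  using D_base[OF const_mem] by (simp add: \<delta>_def)

lemma \<delta>_bracket: "a \<in> V \<Longrightarrow> b \<in> V \<Longrightarrow> \<delta> (br a b) = br (\<delta> a) b + br a (\<delta> b)"
proof -
  assume ab: "a \<in> V" "b \<in> V"
  have R: "[:a:] \<in> R" "[:b:] \<in> R" "D [:a:] \<in> R" "D [:b:] \<in> R"
    using ab const_in_R D_mem by blast+
  have "\<delta> (br a b) = coeff (rb (D [:a:]) [:b:]) i0 + coeff (rb [:a:] (D [:b:])) i0"
    unfolding \<delta>_def rb_const[OF ab, symmetric] D_bracket[OF R(1,2)] by simp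
  also have "coeff (rb [:a:] (D [:b:])) i0 = - coeff (rb (D [:b:]) [:a:]) i0"
    unfolding RB.bracket_anti[OF R(1,4)] by simp
  also have "\<dots> = - br (\<delta> b) a" using coeff_rb_const[OF R(4) ab(1)] by (simp add: \<delta>_def)
  also have "\<dots> = br a (\<delta> b)" using V.bracket_anti[OF ab(1) \<delta>_mem[OF ab(2)]] by simp
  finally show ?thesis using coeff_rb_const[OF R(3) ab(2)] by (simp add: \<delta>_def)
qed

lemma \<delta>_scale: "a \<in> V \<Longrightarrow> \<delta> (pconst c * a) = pconst c * \<delta> a"
  using \<delta>_mult[OF pconst_in_V, of a c] by (simp add: \<delta>_pconst)

lemma \<delta>_sum: "(\<And>i. i \<in> I \<Longrightarrow> g i \<in> V) \<Longrightarrow> \<delta> (sum g I) = (\<Sum>i\<in>I. \<delta> (g i))"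
  using \<delta>_pconst[of 0] by (induction I rule: infinite_finite_induct) (simp_all add: \<delta>_add V.sum_mem)

lemma \<Lambda>_mult: "a \<in> V \<Longrightarrow> b \<in> V \<Longrightarrow> \<Lambda> (a * b) = lookup a 0 * \<Lambda> b + lookup b 0 * \<Lambda> a"
  by (simp add: \<Lambda>_def \<delta>_mult lookup_add lookup_0_mult)

lemma \<Lambda>_f: "\<Lambda> f \<noteq> 0"
  using moved by (simp add: \<Lambda>_def \<delta>_def)

lemma single_in_V: "keys m \<subseteq> {..<n} \<Longrightarrow> d dvd mon_deg m \<Longrightarrow> single m c \<in> V"
  by (rule hom_part_in_veronese[OF d_pos, of _ _ "mon_deg m"])
    (auto simp: hom_part_iff_grade single_in_polys grade_single)

lemma single_in_hom_part: "keys m \<subseteq> {..<n} \<Longrightarrow> mon_deg m = k \<Longrightarrow> single m c \<in> hom_part n k"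
  by (auto simp: hom_part_iff_grade single_in_polys grade_single)

lemma keys_add_nat: "keys (a + b) = keys a \<union> keys (b :: nat \<Rightarrow>\<^sub>0 nat)"
  by (auto simp: in_keys_iff lookup_add)

lemma f_keys: "m \<in> keys f \<Longrightarrow> keys m \<subseteq> {..<n} \<and> mon_deg m = e"
  using f(3) by (auto simp: hom_part_def polys_def)

lemma d_dvd_e: "d dvd e"
  using f hcomp_of_hom[OF f(3), of e] by (simp add: mem_V_iff)

lemma \<Lambda>_monomial: obtains m where "m \<in> keys f" "\<Lambda> (single m 1) \<noteq> 0"
proof (rule ccontr)
  note witness = that
  assume "\<not> thesis"
  hence 0: "\<Lambda> (single m 1) = 0" if "m \<in> keys f" for m using witness[OF that] by blast
  have m: "single m c \<in> V" if "m \<in> keys f" for m c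
    using f_keys[OF that] d_dvd_e by (intro single_in_V) auto
  have "\<Lambda> f = \<Lambda> (\<Sum>m\<in>keys f. single m (lookup f m))" by (simp only: mpol_sum[symmetric])
  also have "\<dots> = (\<Sum>m\<in>keys f. \<Lambda> (single m (lookup f m)))"
    unfolding \<Lambda>_def by (subst \<delta>_sum) (simp_all add: m lookup_sum)
  also have "\<dots> = 0"
  proof (intro sum.neutral ballI)
    fix x assume x: "x \<in> keys f"
    have "single x (lookup f x) = pconst (lookup f x) * single x 1"
      by (simp add: pconst_def mult_single)
    thus "\<Lambda> (single x (lookup f x)) = 0"
      using 0[OF x] m[OF x, of 1] by (simp add: \<Lambda>_def \<delta>_scale lookup_pconst_mult)
  qed
  finally show False using \<Lambda>_f by simp
qed

text \<open>
  A point derivation at the origin vanishes on products of two elements of positive degree, hence on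
  all elements of degree at least $2d$.
\<close>

lemma e_eq_d: "e = d"
proof (rule ccontr)
  assume "e \<noteq> d"
  hence ed: "e > d" using dvd_imp_le[OF d_dvd_e e_pos] by simp
  obtain m where m: "m \<in> keys f" "\<Lambda> (single m 1) \<noteq> 0" by (rule \<Lambda>_monomial)
  obtain a b where ab: "m = a + b" "mon_deg a = d"
    using exponent_split[of d m] f_keys[OF m(1)] ed by auto
  have bd: "mon_deg b = e - d" using ab f_keys[OF m(1)] by (auto simp: mon_deg_add)
  have ks: "keys a \<subseteq> {..<n}" "keys b \<subseteq> {..<n}"
    using f_keys[OF m(1)] ab by (auto simp: keys_add_nat)
  have V: "single a 1 \<in> V" "single b 1 \<in> V"
    by (rule single_in_V; simp add: ks ab(2) bd d_dvd_e)+
  have "a \<noteq> 0" "b \<noteq> 0" using ab \<open>mon_deg b = e - d\<close> ed d_pos by auto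
  hence "lookup (single a (1::'k)) 0 = 0" "lookup (single b (1::'k)) 0 = 0"
    by (simp_all add: lookup_single when_def)
  moreover have "single m (1::'k) = single a 1 * single b 1" using ab by (simp add: mult_single)
  ultimately show False using m(2) \<Lambda>_mult[OF V] by simp
qed

text \<open>The component of degree $d$ of $\delta(ab) = \delta(a'b')$.\<close>

lemma exchange:
  assumes "a \<in> hom_part n d" "b \<in> hom_part n d" "a' \<in> hom_part n d" "b' \<in> hom_part n d"
    and eq: "a * b = a' * b'"
  shows "a * pconst (\<Lambda> b) + b * pconst (\<Lambda> a) = a' * pconst (\<Lambda> b') + b' * pconst (\<Lambda> a')"
proof -
  have V: "a \<in> V" "b \<in> V" "a' \<in> V" "b' \<in> V"
    by (rule hom_part_in_veronese[OF d_pos _ dvd_refl], fact)+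
  have *: "hcomp d (x * \<delta> y) = x * pconst (\<Lambda> y)" if "x \<in> hom_part n d" for x y
    using hcomp_hom_mult[OF that, of 0 "\<delta> y"] by (simp add: hcomp_zero \<Lambda>_def)
  have "hcomp d (\<delta> (a * b)) = hcomp d (\<delta> (a' * b'))" by (simp add: eq)
  thus ?thesis using assms(1-4) V by (simp add: \<delta>_mult hcomp_add *)
qed

text \<open>
  For $d \ge 2$ the functional $\Lambda$ vanishes on every monomial $m$ of degree $d$. Write
  $m = x m_0$ and exchange a factor $x$ of $m$ for a factor $w$ of $w^d$. In the relation between
  the derivatives of $m \cdot w^d = w m_0 \cdot x w^{d-1}$ only $\Lambda(m)$ contributes to the
  coefficient of $w^d$, provided that $m_0 \ne w^{d-1}$. One of the two variables $w \ne x$ will do.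
\<close>

lemma d_eq_1: "d = 1"
proof (rule ccontr)
  assume d1: "d \<noteq> 1"
  hence n3: "n = 3" and d2: "d \<ge> 2" using d_cases d_pos by auto
  obtain m where m: "m \<in> keys f" "\<Lambda> (single m 1) \<noteq> 0" by (rule \<Lambda>_monomial)
  have md: "mon_deg m = d" "keys m \<subseteq> {..<3}" using f_keys[OF m(1)] e_eq_d n3 by auto
  hence "m \<noteq> 0" using d2 by auto
  then obtain x where x: "x \<in> keys m" by (metis all_not_in_conv keys_eq_empty)
  hence x3: "x < 3" using md by auto
  define m0 where "m0 = m - single x 1"
  have mx: "m = single x 1 + m0"
    unfolding m0_def using x
    by (intro poly_mapping_eqI) (auto simp: lookup_add lookup_minus lookup_single when_def in_keys_iff)
  have m0: "mon_deg m0 = d - 1" "keys m0 \<subseteq> {..<3}"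
    using md unfolding mx by (auto simp: mon_deg_add keys_add_nat)
  have "\<exists>w. w < 3 \<and> w \<noteq> x \<and> m0 \<noteq> single w (d - 1)"
  proof -
    obtain w1 w2 where w: "w1 < 3" "w2 < 3" "w1 \<noteq> x" "w2 \<noteq> x" "w1 \<noteq> (w2::nat)"
    proof -
      have "x = 0 \<or> x = 1 \<or> x = 2" using x3 by auto
      thus thesis using that[of 1 2] that[of 0 2] that[of 0 1] by auto
    qed
    have "lookup (single w1 (d - 1)) w1 \<noteq> lookup (single w2 (d - 1)) w1"
      using w d2 by (simp add: lookup_single when_def)
    hence "single w1 (d - 1) \<noteq> single w2 (d - 1)" by metis
    thus ?thesis using w by metis
  qed
  then obtain w where w: "w < 3" "w \<noteq> x" "m0 \<noteq> single w (d - 1)" by blast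
  define b where "b = single w d"
  define a' where "a' = single w 1 + m0"
  define b' where "b' = single x 1 + single w (d - 1)"
  have bsplit: "b = single w 1 + single w (d - 1)" using d2 by (simp add: b_def flip: single_add)
  have sum: "m + b = a' + b'" by (simp add: mx a'_def b'_def bsplit add_ac)
  have keys: "keys b \<subseteq> {..<3}" "keys a' \<subseteq> {..<3}" "keys b' \<subseteq> {..<3}"
    using w x3 m0 by (auto simp: b_def a'_def b'_def keys_add_nat split: if_splits)
  have degs: "mon_deg b = d" "mon_deg a' = d" "mon_deg b' = d"
    using m0 d2 by (simp_all add: b_def a'_def b'_def mon_deg_add)
  have hp: "single m (1::'k) \<in> hom_part n d" "single b (1::'k) \<in> hom_part n d"
    "single a' (1::'k) \<in> hom_part n d" "single b' (1::'k) \<in> hom_part n d"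
    by (intro single_in_hom_part; simp only: n3 md keys degs)+
  have "single m (1::'k) * single b 1 = single a' 1 * single b' 1"
    by (simp add: mult_single sum)
  from exchange[OF hp this]
  have eq: "lookup (single m 1 * pconst (\<Lambda> (single b 1)) + single b 1 * pconst (\<Lambda> (single m 1))) b
      = lookup (single a' 1 * pconst (\<Lambda> (single b' 1)) + single b' 1 * pconst (\<Lambda> (single a' 1))) b"
    by simp
  have ne: "m \<noteq> b" "a' \<noteq> b" "b' \<noteq> b"
  proof -
    have b_x: "lookup b x = 0" using w by (simp add: b_def lookup_single when_def)
    show "m \<noteq> b" using b_x x by (auto simp: in_keys_iff)
    show "b' \<noteq> b" using b_x by (auto simp: b'_def lookup_add lookup_single)
    show "a' \<noteq> b" using w(3) unfolding a'_def bsplit by simp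
  qed
  have lk: "lookup (single k 1 * pconst c) b = (if k = b then c else 0)" for k and c :: 'k
    by (simp add: pconst_def mult_single lookup_single when_def)
  show False using eq m(2) ne by (simp add: lookup_add lk)
qed

lemma V_eq_polys: "V = polys n" by (simp add: d_eq_1 veronese_carrier_1 del: One_nat_def)

lemma e_eq_1: "e = 1" using e_eq_d d_eq_1 by simp

text \<open>As $f$ is a linear form, its partial derivatives are the constants $\varphi_k$.\<close>

definition \<phi> :: "nat \<Rightarrow> 'k" where "\<phi> k = lookup (pd k f) 0"

text \<open>
  The constant vector field that takes $x_k$ to $\Lambda(x_k)$, normalised such that it takes $f$ to 1.
\<close>

definition \<mu> :: "nat \<Rightarrow> 'k" where "\<mu> k = \<Lambda> (pvar k) / \<Lambda> f"

lemma pd_f: "pd k f = pconst (\<phi> k)"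
proof -
  have "pd k f \<in> hom_part n 0" using f(3) e_eq_1 by (intro pd_hom_part) simp
  thus ?thesis unfolding \<phi>_def by (rule hom_part_0)
qed

lemma f_linear: "f = (\<Sum>k<n. pconst (\<phi> k) * pvar k)"
  using euler[OF f(3)] e_eq_1 by (simp add: pd_f mult.commute)

lemma \<delta>_formula: "a \<in> polys n \<Longrightarrow> \<delta> a = (\<Sum>k<n. pd k a * \<delta> (pvar k))"
  by (rule derivation_formula) (simp_all add: \<delta>_add \<delta>_mult \<delta>_pconst V_eq_polys)

lemma sum_\<phi>_\<mu>: "(\<Sum>k<n. \<phi> k * \<mu> k) = 1"
proof -
  have "\<delta> f = (\<Sum>k<n. pconst (\<phi> k) * \<delta> (pvar k))"
    using \<delta>_formula[of f] f(1) by (simp add: V_eq_polys pd_f)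
  hence "\<Lambda> f = (\<Sum>k<n. \<phi> k * \<Lambda> (pvar k))"
    by (simp add: \<Lambda>_def lookup_sum lookup_pconst_mult)
  moreover have "\<Lambda> (pvar k) = \<Lambda> f * \<mu> k" for k using \<Lambda>_f by (simp add: \<mu>_def)
  ultimately have "\<Lambda> f * (\<Sum>k<n. \<phi> k * \<mu> k) = \<Lambda> f * 1"
    by (simp add: sum_distrib_left mult.left_commute)
  thus ?thesis using \<Lambda>_f mult_left_cancel by blast
qed

text \<open>
  The constant vector field with coefficients \<open>\<mu>\<close> is the lowest homogeneous part of a Poisson
  derivation; hence it is a Poisson derivation itself.
\<close>

lemma bracket_translation_invariant:
  assumes ij: "i < n" "j < n"
  shows "(\<Sum>k<n. pconst (\<mu> k) * pd k (br (pvar i) (pvar j))) = 0"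
proof -
  let ?\<pi> = "br (pvar i) (pvar j)"
  have xV: "pvar i \<in> V" "pvar j \<in> V" using ij by (simp_all add: V_eq_polys pvar_in_polys)
  have pi: "?\<pi> \<in> polys n" "?\<pi> \<in> hom_part n (Suc (r - 1))"
    using bracket_var_hom[OF ij] r_pos by (auto simp: hom_part_subset)
  have low: "hcomp (r - 1) (br (\<delta> x) (pvar k)) = 0" if "x \<in> V" "k < n" for x k
  proof -
    have "hcomp (r - 1) (br (\<delta> x) (pvar k)) = br (hcomp 0 (\<delta> x)) (pvar k)"
      using r_pos V_polys[OF \<delta>_mem[OF that(1)]] pvar_in_hom_part[OF that(2)]
      by (intro hcomp_bracket_hom_right) auto
    thus ?thesis using that by (simp add: hcomp_zero br_pconst pvar_in_polys)
  qed
  have "br (pvar i) (\<delta> (pvar j)) = - br (\<delta> (pvar j)) (pvar i)"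
    by (intro V.bracket_anti xV \<delta>_mem)
  hence "\<delta> ?\<pi> = br (\<delta> (pvar i)) (pvar j) + - br (\<delta> (pvar j)) (pvar i)"
    using \<delta>_bracket[OF xV] by simp
  hence "hcomp (r - 1) (\<delta> ?\<pi>) = 0"
    using low[OF xV(1) ij(2)] low[OF xV(2) ij(1)]
    by (simp only: hcomp_add) (simp add: hcomp_def grade.hom_uminus grade.hom_minus)
  moreover have "hcomp (r - 1) (\<delta> ?\<pi>) = (\<Sum>k<n. pd k ?\<pi> * pconst (\<Lambda> (pvar k)))"
  proof -
    have "hcomp (r - 1) (pd k ?\<pi> * \<delta> (pvar k)) = pd k ?\<pi> * pconst (\<Lambda> (pvar k))" for k
      using hcomp_hom_mult[OF pd_hom_part[OF pi(2)], of 0 k "\<delta> (pvar k)"]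
      by (simp add: hcomp_zero \<Lambda>_def)
    thus ?thesis unfolding \<delta>_formula[OF pi(1)] hcomp_sum by simp
  qed
  ultimately have 0: "(\<Sum>k<n. pd k ?\<pi> * pconst (\<Lambda> (pvar k))) = 0" by simp
  have "(\<Sum>k<n. pconst (\<mu> k) * pd k ?\<pi>) = pconst (1 / \<Lambda> f) * (\<Sum>k<n. pd k ?\<pi> * pconst (\<Lambda> (pvar k)))"
    unfolding sum_distrib_left
  proof (intro sum.cong refl)
    fix k
    have "pconst (\<mu> k) = pconst (1 / \<Lambda> f) * pconst (\<Lambda> (pvar k))"
      by (simp add: \<mu>_def flip: pconst_mult)
    thus "pconst (\<mu> k) * pd k ?\<pi> = pconst (1 / \<Lambda> f) * (pd k ?\<pi> * pconst (\<Lambda> (pvar k)))"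
      by (simp add: ac_simps)
  qed
  thus ?thesis using 0 by simp
qed

end

subsection \<open>Splitting off the centre\<close>

lemma comm_ring_hom_poly_eval:
  assumes "comm_ring_hom h" shows "comm_ring_hom (\<lambda>q. poly (map_poly h q) a)"
proof -
  interpret h: comm_ring_hom h by fact
  interpret mp: map_poly_comm_ring_hom h ..
  show ?thesis by unfold_locales (simp_all add: mp.hom_add mp.hom_mult)
qed

lemma poly_preimage:
  assumes h0: "\<And>x. h x = 0 \<longleftrightarrow> x = 0" and ex: "\<And>i. \<exists>x. h x = coeff P i"
  shows "\<exists>F. map_poly h F = P"
proof -
  obtain g where g: "\<And>i. h (g i) = coeff P i" using ex by metis
  have "\<forall>\<^sub>\<infinity>i. g i = 0"
    using MOST_coeff_eq_0[of P] by eventually_elim (metis g h0)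
  hence "coeff (Abs_poly g) = g" by (rule Abs_poly_inverse[OF CollectI])
  moreover have "h 0 = 0" using h0 by blast
  ultimately have "map_poly h (Abs_poly g) = P" by (intro poly_eqI) (simp add: coeff_map_poly g)
  thus ?thesis by blast
qed

text \<open>By degrees, $g q(g)$ is not a constant unless it is zero.\<close>

lemma nonconstant_transcendental:
  fixes g :: "'k::field poly poly"
  assumes g: "g \<notin> range const2" and eq: "poly (map_poly const2 q) g = 0"
  shows "q = 0"
proof (rule ccontr)
  assume "q \<noteq> 0"
  have lg: "lexdeg g > 0" using g lexdeg_eq_0 by blast
  have g0: "g \<noteq> 0" using g const2.hom_zero by (metis rangeI)
  have "poly (map_poly const2 q) g \<noteq> 0" using \<open>q \<noteq> 0\<close>
  proof (induction q)
    case (pCons c q)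
    have *: "poly (map_poly const2 (pCons c q)) g = const2 c + g * poly (map_poly const2 q) g"
      by (simp add: const2.map_poly_pCons_hom)
    show ?case
    proof (cases "q = 0")
      case True
      hence "c \<noteq> 0" using pCons by auto
      thus ?thesis unfolding * using True by (simp add: const2_def)
    next
      case False
      hence nz: "poly (map_poly const2 q) g \<noteq> 0" by (rule pCons.IH)
      show ?thesis
      proof
        assume "poly (map_poly const2 (pCons c q)) g = 0"
        hence "g * poly (map_poly const2 q) g = const2 (- c)"
          unfolding * by (simp add: const2.hom_uminus eq_neg_iff_add_eq_0 add.commute)
        moreover have "lexdeg (const2 (- c)) = 0" by (simp add: lexdeg_def const2_def)
        ultimately show False using lexdeg_mult[OF g0 nz] lg by simp
      qed
    qed
  qed simp
  with eq show False by simp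
qed

context two_presentations
begin

lemma RcentralI: "p \<in> R \<Longrightarrow> (\<And>q. q \<in> R \<Longrightarrow> rb p q = 0) \<Longrightarrow> Rcentral p"
  unfolding Rcentral_def by blast

lemma Rcentral_mem: "Rcentral p \<Longrightarrow> p \<in> R" and Rcentral_bracket: "Rcentral p \<Longrightarrow> q \<in> R \<Longrightarrow> rb p q = 0"
  unfolding Rcentral_def by blast+

lemma Rcentral_subring: "subring_set {p. Rcentral p}"
proof (unfold_locales, unfold mem_Collect_eq [of _ Rcentral])
  show "Rcentral 0" "Rcentral 1"
    by (rule RcentralI[OF R.zero_mem RB.bracket_0(1)] RcentralI[OF R.one_mem RB.bracket_1(1)]; assumption)+
next
  fix a b assume ab: "Rcentral a" "Rcentral b"
  note R = Rcentral_mem[OF ab(1)] Rcentral_mem[OF ab(2)]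
  show "Rcentral (a + b)"
  proof (rule RcentralI[OF R.add_mem[OF R]])
    fix q assume "q \<in> R"
    from RB.bracket_add[OF R this] ab this show "rb (a + b) q = 0" by (simp add: Rcentral_bracket)
  qed
  show "Rcentral (a * b)"
  proof (rule RcentralI[OF R.mult_mem[OF R]])
    fix q assume "q \<in> R"
    from RB.bracket_mult[OF R this] ab this show "rb (a * b) q = 0" by (simp add: Rcentral_bracket)
  qed
next
  fix a assume a: "Rcentral a"
  note R = Rcentral_mem[OF a]
  show "Rcentral (- a)"
  proof (rule RcentralI[OF R.uminus_mem[OF R]])
    fix q assume "q \<in> R"
    from RB.bracket_uminus[OF R this] a this show "rb (- a) q = 0" by (simp add: Rcentral_bracket)
  qed
qed

lemma Rcentral_t: "Rcentral [:0, 1:]"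
  unfolding Rcentral_iff using t_in_R central_pconst[of 0] central_pconst[of 1]
  by (auto simp: coeff_pCons coeff_1 split: nat.splits)

lemma Rcentral_pconst: "Rcentral [:pconst c:]"
  by (rule Rcentral_const[OF central_pconst pconst_in_V])

definition evG :: "'k mpol poly \<Rightarrow> 'k poly \<Rightarrow> 'k mpol poly" where
  "evG G q = poly (map_poly (\<lambda>c. [:pconst c:]) q) G"

interpretation evG: comm_ring_hom "evG G" for G
  unfolding evG_def by (rule comm_ring_hom_poly_eval[OF hom_const_pconst])

lemma evG_pCons: "evG G (pCons c q) = [:pconst c:] + G * evG G q"
proof -
  interpret h: comm_ring_hom "\<lambda>c::'k. [:pconst c:]" by (rule hom_const_pconst)
  show ?thesis unfolding evG_def by (simp add: h.map_poly_pCons_hom)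
qed

lemma evG_0: "evG G 0 = 0" by (rule evG.hom_zero)

lemma evG_X: "evG G [:0, 1:] = G" using evG_pCons[of G 0 "[:1:]"] evG.hom_one[of G] by simp

end

context moved_centre
begin

definition evf :: "'k poly \<Rightarrow> 'k mpol" where
  "evf q = poly (map_poly pconst q) f"

interpretation evf: comm_ring_hom evf
  unfolding evf_def by (rule comm_ring_hom_poly_eval[OF pconst.comm_ring_hom_axioms])

lemma evf_pCons: "evf (pCons c q) = pconst c + f * evf q"
  by (simp add: evf_def pconst.map_poly_pCons_hom)

lemma evf_X: "evf [:0, 1:] = f" using evf_pCons[of 0 1] evf.hom_one by simp

lemma evf_monom: "evf (monom c i) = pconst c * f ^ i"
  by (simp add: evf_def pconst.map_poly_hom_monom poly_monom)

lemma f_power_hom: "f ^ j \<in> hom_part n j"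
  using hom_part_power[OF f(3), of j] e_eq_1 by simp

lemma hcomp_evf: "hcomp j (evf q) = pconst (coeff q j) * f ^ j"
proof -
  have "hcomp j (evf q) = (\<Sum>i\<le>degree q. hcomp j (evf (monom (coeff q i) i)))"
    by (subst (1) poly_as_sum_of_monoms[of q, symmetric]) (simp only: evf.hom_sum hcomp_sum)
  also have "\<dots> = (\<Sum>i\<le>degree q. if j = i then pconst (coeff q j) * f ^ j else 0)"
    by (intro sum.cong refl)
      (simp add: evf_monom hcomp_of_hom[OF pconst_mult_in_hom_part[OF f_power_hom]])
  also have "\<dots> = pconst (coeff q j) * f ^ j" by (simp add: coeff_eq_0)
  finally show ?thesis .
qed

lemma evf_eq_0_iff: "evf q = 0 \<longleftrightarrow> q = 0"
proof
  assume q: "evf q = 0"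
  have "coeff q j = 0" for j using hcomp_evf[of j q] f(4) by (simp add: q)
  thus "q = 0" by (intro poly_eqI) simp
qed (simp add: evf.hom_zero)

lemma central_evf: "central (evf q)"
proof (induction q)
  case 0
  show ?case using central_pconst[of 0] by (simp add: evf.hom_zero)
next
  case (pCons c q)
  thus ?case unfolding evf_pCons
    using subring_set.add_mem[OF central_subring] subring_set.mult_mem[OF central_subring]
      central_pconst f(2) by simp
qed

lemma central_imp_evf: assumes a: "central a" shows "\<exists>q. evf q = a"
proof -
  have "\<exists>c. hcomp j a = pconst c * f ^ j" for j
    using central_homogeneous_proportional[OF central_hcomp[OF a] hcomp_in_hom_part[OF central_polys[OF a]]
        central_power[OF f(2)] f_power_hom] f(4) by simp
  then obtain c where c: "\<And>j. hcomp j a = pconst (c j) * f ^ j" by metis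
  have "evf (\<Sum>j\<le>degree (grade a). monom (c j) j)
      = (\<Sum>j\<le>degree (grade a). hcomp j a)"
    by (simp add: evf.hom_sum evf_monom c)
  thus ?thesis using sum_hcomp[of a] by metis
qed

text \<open>
  The isomorphism of $k[z,t]$ onto the centre of $R$ that takes $z$ to $f$ and fixes $t$.
\<close>

definition J :: "'k poly poly \<Rightarrow> 'k mpol poly" where "J = map_poly evf"

lemma comm_ring_hom_J: "comm_ring_hom J"
proof -
  interpret mp: map_poly_comm_ring_hom evf ..
  show ?thesis unfolding J_def by unfold_locales
qed

interpretation J: comm_ring_hom J by (rule comm_ring_hom_J)

lemma J_eq_0_iff: "J w = 0 \<longleftrightarrow> w = 0"
  unfolding J_def by (auto simp: poly_eq_iff coeff_map_poly evf.hom_zero evf_eq_0_iff)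

lemma J_inj: "J w = J z \<longleftrightarrow> w = z"
  using J_eq_0_iff[of "w - z"] by (simp add: J.hom_minus)

lemma J_pCons: "J (pCons q w) = pCons (evf q) (J w)"
  by (simp add: J_def evf.map_poly_pCons_hom)

lemma J_const2: "J (const2 c) = [:pconst c:]"
  by (simp add: const2_def J_pCons evf_pCons evf.hom_zero J.hom_zero)

lemma Rcentral_J: "Rcentral (J w)"
proof -
  have "coeff (J w) i \<in> V" "central (coeff (J w) i)" for i
    using central_evf[of "coeff w i"] central_polys
    by (simp_all add: J_def coeff_map_poly evf.hom_zero V_eq_polys)
  thus ?thesis by (simp add: Rcentral_iff coeffs_in_def)
qed

lemma Rcentral_imp_J: assumes "Rcentral P" shows "\<exists>w. J w = P"
  unfolding J_def using assms central_imp_evf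
  by (intro poly_preimage evf_eq_0_iff) (auto simp: Rcentral_iff)

text \<open>
  The centre $k[f,t]$ of $R$ is $C[s]$ for the centre $C$ of $B$, so cancellation for the affine line
  applies to $C$.
\<close>

lemma centre_of_base_generator:
  obtains G where "G \<in> B" "Rcentral G" "\<And>b. b \<in> B \<Longrightarrow> Rcentral b \<Longrightarrow> \<exists>q. evG G q = b"
    "\<And>q. evG G q = 0 \<Longrightarrow> q = 0"
proof -
  obtain S where S: "J S = s" using Rcentral_imp_J[OF Rcentral_gen] by blast
  define C where "C = {w. J w \<in> B}"
  have poly_J: "J (poly F S) = poly (map_poly J F) s" for F
    using J.poly_map_poly[of F S] S by simp
  have coeffs_J: "coeffs_in C F \<longleftrightarrow> coeffs_in B (map_poly J F)" for F
    by (simp add: coeffs_in_def C_def)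
  interpret C: plane_adjunction C S
  proof
    show "0 \<in> C" "1 \<in> C" by (simp_all add: C_def J.hom_zero J.hom_one zero_mem one_mem)
  next
    fix a b assume "a \<in> C" "b \<in> C"
    thus "a + b \<in> C" "a * b \<in> C" by (simp_all add: C_def J.hom_add J.hom_mult add_mem mult_mem)
  next
    fix a assume "a \<in> C"
    thus "- a \<in> C" by (simp add: C_def J.hom_uminus uminus_mem)
  next
    fix c show "const2 c \<in> C" by (simp add: C_def J_const2 const_mem)
  next
    fix F :: "'k poly poly poly" assume F: "coeffs_in C F" "poly F S = 0"
    have "poly (map_poly J F) s = 0" using poly_J[of F] F(2) by (simp add: J.hom_zero)
    hence "map_poly J F = 0" using F(1) coeffs_J by (intro poly_inj) auto
    show "F = 0"
    proof (rule poly_eqI)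
      fix i
      have "J (coeff F i) = coeff (map_poly J F) i" by simp
      thus "coeff F i = coeff 0 i" using \<open>map_poly J F = 0\<close> by (simp add: J_eq_0_iff)
    qed
  next
    fix w :: "'k poly poly"
    have wR: "J w \<in> R" using Rcentral_J[of w] by (simp add: Rcentral_def)
    have "\<exists>F. map_poly J F = expand (J w)"
      using Rcentral_imp_J[OF Rcentral_expand[OF Rcentral_J]] by (intro poly_preimage J_eq_0_iff)
    then obtain F where F: "map_poly J F = expand (J w)" by blast
    have "coeffs_in C F" using coeffs_J[of F] F expand(1)[OF wR] by simp
    moreover have "poly F S = w" using poly_J[of F] F expand(2)[OF wR] by (simp add: J_inj)
    ultimately show "\<exists>F. coeffs_in C F \<and> poly F S = w" by blast
  qed simp
  obtain g where g: "g \<in> C" "g \<notin> range const2" "\<And>a. a \<in> C \<Longrightarrow> \<exists>q. a = poly (map_poly const2 q) g"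
    using C.base_is_polynomial_ring by blast
  have J_ev: "J (poly (map_poly const2 q) g) = evG (J g) q" for q
  proof (induction q)
    case 0
    show ?case by (simp add: J.hom_zero evG_0)
  next
    case (pCons c q)
    thus ?case by (simp add: const2.map_poly_pCons_hom J.hom_add J.hom_mult J_const2 evG_pCons)
  qed
  show thesis
  proof (rule that)
    show "J g \<in> B" using g(1) by (simp add: C_def)
    show "Rcentral (J g)" by (rule Rcentral_J)
  next
    fix b assume b: "b \<in> B" "Rcentral b"
    then obtain w where w: "J w = b" using Rcentral_imp_J by blast
    with b have "w \<in> C" by (simp add: C_def)
    thus "\<exists>q. evG (J g) q = b" using g(3) w J_ev by metis
  next
    fix q assume "evG (J g) q = 0"
    hence "poly (map_poly const2 q) g = 0" using J_ev[of q] by (simp add: J_eq_0_iff)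
    thus "q = 0" by (rule nonconstant_transcendental[OF g(2)])
  qed
qed

text \<open>
  Write $\mu$ for the vector along which the bracket is invariant, so that $f(\mu) = 1$. Let $G$ generate
  the centre of $B$, and let $F(G)$ and $T(G)$ be the images of $f$ and $t$ in $R/(s) = B$. The
  homomorphism $\psi : A \to B$ sends $x_j$ to its image in $R/(s)$, translated by the central element
  $\mu_j (G - F(G))$; it takes $f$ to $G$, is Poisson by invariance, and is onto because $B$ is
  generated by $G$ and the images of the $x_j$. Its inverse is induced by $\eta : R \to A$ with
  $x_j \mapsto x_j + \mu_j (F(f) - f)$ and $t \mapsto T(f)$, which takes $f$ to $F(f)$. On the centre of $R$
  both $\eta$ and the projection to $B$ factor through $\chi : P(f,t) \mapsto P(F,T)$; since $G$ is
  transcendental, $\chi$ kills $s$, and so does $\eta$.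
\<close>

theorem equiv_if_centre_moved: "\<exists>\<psi>. poisson_equiv B \<psi>"
proof -
  obtain G where G: "G \<in> B" "Rcentral G" "\<And>b. b \<in> B \<Longrightarrow> Rcentral b \<Longrightarrow> \<exists>q. evG G q = b"
    and G_transc: "\<And>q. evG G q = 0 \<Longrightarrow> q = 0"
    using centre_of_base_generator by blast
  interpret ev: comm_ring_hom "evG G"
    unfolding evG_def by (rule comm_ring_hom_poly_eval[OF hom_const_pconst])
  have fR: "[:f:] \<in> R" by (rule const_in_R[OF f(1)])
  have fc: "Rcentral [:f:]" by (rule Rcentral_const[OF f(2,1)])
  obtain F where F: "evG G F = proj [:f:]"
    using G(3)[OF proj_mem[OF fR] Rcentral_proj[OF fc]] by blast
  obtain T where T: "evG G T = proj [:0, 1:]"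
    using G(3)[OF proj_mem[OF t_in_R] Rcentral_proj[OF Rcentral_t]] by blast
  define \<chi> where "\<chi> = (\<lambda>w. poly (map_poly (\<lambda>q. pcompose q F) w) T)"
  have \<chi>_pCons: "\<chi> (pCons q w) = pcompose q F + T * \<chi> w" for q w
    unfolding \<chi>_def by (simp add: pcompose_hom.map_poly_pCons_hom)
  have \<chi>_0: "\<chi> 0 = 0" by (simp add: \<chi>_def)

  have evf_V: "evf q \<in> V" for q using central_polys[OF central_evf] by (simp add: V_eq_polys)
  have proj_evf: "proj [:evf q:] = evG G (pcompose q F)" for q
  proof (induction q)
    case 0
    show ?case using proj_base[OF zero_mem] by (simp add: evf.hom_zero ev.hom_zero)
  next
    case (pCons c q)
    have R: "[:f:] * [:evf q:] \<in> R" by (intro R.mult_mem const_in_R f evf_V)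
    have "[:evf (pCons c q):] = [:pconst c:] + [:f:] * [:evf q:]" by (simp add: evf_pCons)
    hence "proj [:evf (pCons c q):] = proj ([:pconst c:] + [:f:] * [:evf q:])" by (rule arg_cong)
    also have "\<dots> = proj [:pconst c:] + proj [:f:] * proj [:evf q:]"
      by (simp only: proj_add[OF const_in_R[OF pconst_in_V] R] proj_mult[OF fR const_in_R[OF evf_V]])
    also have "\<dots> = [:pconst c:] + evG G F * evG G (pcompose q F)"
      by (simp only: proj_base[OF const_mem] F pCons.IH)
    also have "\<dots> = evG G (pcompose (pCons c q) F)"
      by (simp add: pcompose_pCons ev.hom_add ev.hom_mult evG_pCons evG_0)
    finally show ?case .
  qed
  have J_R: "J w \<in> R" for w using Rcentral_J[of w] by (simp add: Rcentral_def)
  have proj_J: "proj (J w) = evG G (\<chi> w)" for w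
  proof (induction w)
    case 0
    show ?case using proj_base[OF zero_mem] by (simp add: J.hom_zero \<chi>_0 evG_0)
  next
    case (pCons q w)
    show ?case
      unfolding J_pCons \<chi>_pCons proj_pCons[OF evf_V J_R] pCons.IH proj_evf
      by (simp add: ev.hom_add ev.hom_mult T)
  qed

  define \<epsilon> where "\<epsilon> = evalp pconst (\<lambda>j. pvar j + pconst (\<mu> j) * (evf F - f))"
  interpret \<epsilon>: comm_ring_hom \<epsilon>
    unfolding \<epsilon>_def by (rule comm_ring_hom_evalp[OF pconst.comm_ring_hom_axioms])
  have \<epsilon>_pconst: "\<epsilon> (pconst c) = pconst c" for c
    unfolding \<epsilon>_def by (rule evalp_pconst[OF pconst.comm_ring_hom_axioms])
  have \<epsilon>_pvar: "\<epsilon> (pvar j) = pvar j + pconst (\<mu> j) * (evf F - f)" for j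
    unfolding \<epsilon>_def by (rule evalp_pvar[OF pconst.comm_ring_hom_axioms])
  have \<epsilon>_f: "\<epsilon> f = evf F"
  proof -
    have "\<epsilon> f = \<epsilon> (\<Sum>k<n. pconst (\<phi> k) * pvar k)" using f_linear by simp
    also have "\<dots> = (\<Sum>k<n. pconst (\<phi> k) * pvar k + pconst (\<phi> k * \<mu> k) * (evf F - f))"
      by (simp add: \<epsilon>.hom_sum \<epsilon>.hom_mult \<epsilon>_pconst \<epsilon>_pvar pconst_mult distrib_left mult.assoc)
    also have "\<dots> = f + pconst (\<Sum>k<n. \<phi> k * \<mu> k) * (evf F - f)"
      using f_linear by (simp add: sum.distrib pconst.hom_sum sum_distrib_right)
    finally show ?thesis by (simp add: sum_\<phi>_\<mu>)
  qed
  have \<epsilon>_evf: "\<epsilon> (evf q) = evf (pcompose q F)" for q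
    by (induction q)
      (simp_all add: evf.hom_zero \<epsilon>.hom_zero evf_pCons \<epsilon>.hom_add \<epsilon>.hom_mult \<epsilon>_pconst \<epsilon>_f
        pcompose_pCons evf.hom_add evf.hom_mult)
  define \<eta> where "\<eta> = (\<lambda>P. poly (map_poly \<epsilon> P) (evf T))"
  interpret \<eta>: comm_ring_hom \<eta>
    unfolding \<eta>_def by (rule comm_ring_hom_poly_eval[OF \<epsilon>.comm_ring_hom_axioms])
  have \<eta>_pCons: "\<eta> (pCons a P) = \<epsilon> a + evf T * \<eta> P" for a P
    unfolding \<eta>_def by (simp add: \<epsilon>.map_poly_pCons_hom)
  have \<eta>_const: "\<eta> [:a:] = \<epsilon> a" for a using \<eta>_pCons[of a 0] by (simp add: \<eta>.hom_zero)
  have \<eta>_J: "\<eta> (J w) = evf (\<chi> w)" for w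
    by (induction w)
      (simp_all add: J.hom_zero \<eta>.hom_zero \<chi>_0 evf.hom_zero J_pCons \<eta>_pCons \<chi>_pCons \<epsilon>_evf
        evf.hom_add evf.hom_mult)
  have \<eta>_s: "\<eta> s = 0"
  proof -
    obtain S where S: "J S = s" using Rcentral_imp_J[OF Rcentral_gen] by blast
    have "evG G (\<chi> S) = 0" using proj_J[of S] S proj_gen by simp
    hence "\<chi> S = 0" by (rule G_transc)
    thus ?thesis using \<eta>_J[of S] S by (simp add: evf.hom_zero)
  qed
  have \<eta>_G: "\<eta> G = f"
  proof -
    obtain w where w: "J w = G" using Rcentral_imp_J[OF G(2)] by blast
    have "evG G (\<chi> w - [:0, 1:]) = 0"
      using proj_J[of w] w proj_base[OF G(1)] evG_X[of G] by (simp add: ev.hom_minus)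
    hence "\<chi> w - [:0, 1:] = 0" by (rule G_transc)
    hence "\<chi> w = [:0, 1:]" by (simp only: right_minus_eq)
    thus ?thesis using \<eta>_J[of w] w evf_X by simp
  qed
  have \<eta>_proj: "\<eta> (proj p) = \<eta> p" if p: "p \<in> R" for p
  proof -
    obtain q where "p = proj p + s * q" using proj_cong_gen[OF p] by blast
    hence "\<eta> p = \<eta> (proj p + s * q)" by (rule arg_cong)
    thus ?thesis by (simp add: \<eta>.hom_add \<eta>.hom_mult \<eta>_s)
  qed

  define Y where "Y = G - proj [:f:]"
  have YB: "Y \<in> B" unfolding Y_def by (intro diff_mem G(1) proj_mem fR)
  have Yc: "Rcentral Y"
    unfolding Y_def using subring_set.diff_mem[OF Rcentral_subring] G(2) Rcentral_proj[OF fc] by simp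
  define \<psi> where "\<psi> = evalp (\<lambda>c. [:pconst c:]) (\<lambda>j. proj [:pvar j:] + Y * [:pconst (\<mu> j):])"
  interpret \<psi>: comm_ring_hom \<psi>
    unfolding \<psi>_def by (rule comm_ring_hom_evalp[OF hom_const_pconst])
  have \<psi>_pconst: "\<psi> (pconst c) = [:pconst c:]" for c
    unfolding \<psi>_def by (rule evalp_pconst[OF hom_const_pconst])
  have \<psi>_pvar: "\<psi> (pvar j) = proj [:pvar j:] + Y * [:pconst (\<mu> j):]" for j
    unfolding \<psi>_def by (rule evalp_pvar[OF hom_const_pconst])
  have xV: "pvar j \<in> V" "[:pvar j:] \<in> R" if "j < n" for j
    using that const_in_R by (simp_all add: V_eq_polys pvar_in_polys)
  have \<psi>_B: "\<psi> a \<in> B" if "a \<in> polys n" for a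
    using that
  proof (induction a rule: polys_induct)
    case (pvar j)
    thus ?case unfolding \<psi>_pvar by (intro add_mem mult_mem YB const_mem proj_mem xV)
  qed (simp_all add: \<psi>_pconst const_mem \<psi>.hom_add \<psi>.hom_mult add_mem mult_mem)
  have \<psi>_R: "\<psi> a \<in> R" if "a \<in> polys n" for a using \<psi>_B[OF that] by (rule base_R)
  have evalp_proj: "evalp (\<lambda>c. [:pconst c:]) (\<lambda>j. proj [:pvar j:]) a = proj [:a:]" if "a \<in> polys n" for a
    using that
  proof (induction a rule: polys_induct)
    case (pconst c)
    show ?case by (simp add: evalp_pconst[OF hom_const_pconst] proj_base[OF const_mem])
  next
    case (pvar j)
    show ?case by (simp add: evalp_pvar[OF hom_const_pconst])
  next
    case (add p q)
    hence R: "[:p:] \<in> R" "[:q:] \<in> R" using const_in_R by (simp_all add: V_eq_polys)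
    have "proj [:p + q:] = proj [:p:] + proj [:q:]" using proj_add[OF R] by simp
    thus ?case using add.IH by (simp add: evalp_add[OF hom_const_pconst])
  next
    case (mult p q)
    hence R: "[:p:] \<in> R" "[:q:] \<in> R" using const_in_R by (simp_all add: V_eq_polys)
    have "[:p * q:] = [:p:] * [:q:]" by simp
    hence "proj [:p * q:] = proj [:p:] * proj [:q:]" using proj_mult[OF R] by (simp only:)
    thus ?case using mult.IH by (simp add: evalp_mult[OF hom_const_pconst])
  qed
  have \<psi>_pvar_bracket: "\<psi> (br (pvar i) (pvar j)) = rb (\<psi> (pvar i)) (\<psi> (pvar j))"
    if ij: "i < n" "j < n" for i j
  proof -
    let ?\<pi> = "br (pvar i) (pvar j)" and ?X = "\<lambda>k. proj [:pvar k:]" and ?Z = "\<lambda>k. Y * [:pconst (\<mu> k):]"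
    have pi: "?\<pi> \<in> polys n" using ij by (simp add: P.bracket_mem pvar_in_polys)
    have "\<psi> ?\<pi> = evalp (\<lambda>c. [:pconst c:]) ?X ?\<pi>"
      unfolding \<psi>_def
      by (rule evalp_translate[OF hom_const_pconst pi bracket_translation_invariant[OF ij]])
    also have "\<dots> = proj [:?\<pi>:]" by (rule evalp_proj[OF pi])
    also have "\<dots> = rb (?X i) (?X j)"
      unfolding rb_const[OF xV(1) xV(1), OF ij, symmetric] by (intro proj_bracket xV ij)
    finally have 1: "\<psi> ?\<pi> = rb (?X i) (?X j)" .
    have Z: "Rcentral (?Z k)" for k
      using subring_set.mult_mem[OF Rcentral_subring, of Y "[:pconst (\<mu> k):]"] Yc Rcentral_pconst
      by (simp only: mem_Collect_eq)
    have XR: "?X k \<in> R" if "k < n" for k using that xV proj_mem base_R by blast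
    have ZR: "?Z k \<in> R" and Z0: "q \<in> R \<Longrightarrow> rb (?Z k) q = 0" for k q using Z by (auto simp: Rcentral_def)
    have "rb (?X i + ?Z i) (?X j + ?Z j) = rb (?X i) (?X j + ?Z j)"
      using RB.bracket_add[OF XR[OF ij(1)] ZR R.add_mem[OF XR[OF ij(2)] ZR]]
        Z0[OF R.add_mem[OF XR[OF ij(2)] ZR]] by simp
    also have "\<dots> = rb (?X i) (?X j) + rb (?X i) (?Z j)"
      by (rule RB.bracket_add_right[OF XR[OF ij(2)] ZR XR[OF ij(1)]])
    also have "rb (?X i) (?Z j) = 0"
      using RB.bracket_anti[OF XR[OF ij(1)] ZR] Z0[OF XR[OF ij(1)]] by simp
    finally show ?thesis unfolding \<psi>_pvar 1 by simp
  qed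
  have pconst_rb: "rb [:pconst c:] p = 0" if "p \<in> R" for c p
    using Rcentral_pconst that unfolding Rcentral_def by blast
  have \<psi>_pvar_br: "\<psi> (br (pvar i) q) = rb (\<psi> (pvar i)) (\<psi> q)" if i: "i < n" and q: "q \<in> polys n" for i q
    using q
  proof (induction q rule: polys_induct)
    case (pconst c)
    have "rb (\<psi> (pvar i)) [:pconst c:] = 0"
      using RB.bracket_anti[OF \<psi>_R[OF pvar_in_polys[OF i]] const_in_R[OF pconst_in_V]]
        pconst_rb[OF \<psi>_R[OF pvar_in_polys[OF i]]] by simp
    moreover have "br (pvar i) (pconst c) = 0"
      using central_br_right[OF central_pconst pvar_in_polys[OF i]] .
    ultimately show ?case by (simp add: \<psi>_pconst \<psi>.hom_zero)
  next
    case (pvar j)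
    show ?case by (rule \<psi>_pvar_bracket[OF i pvar])
  next
    case (add p q)
    note xi = pvar_in_polys[OF i]
    show ?case
      by (simp only: P.bracket_add_right[OF add.hyps xi] \<psi>.hom_add add.IH
          RB.bracket_add_right[OF \<psi>_R[OF add.hyps(1)] \<psi>_R[OF add.hyps(2)] \<psi>_R[OF xi]])
  next
    case (mult p q)
    note xi = pvar_in_polys[OF i]
    show ?case
      by (simp only: P.bracket_mult_right[OF mult.hyps xi] \<psi>.hom_add \<psi>.hom_mult mult.IH
          RB.bracket_mult_right[OF \<psi>_R[OF mult.hyps(1)] \<psi>_R[OF mult.hyps(2)] \<psi>_R[OF xi]])
  qed
  have \<psi>_br: "\<psi> (br p q) = rb (\<psi> p) (\<psi> q)" if p: "p \<in> polys n" and q: "q \<in> polys n" for p q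
    using p
  proof (induction p rule: polys_induct)
    case (pconst c)
    show ?case using pconst_rb[OF \<psi>_R[OF q]] q by (simp add: br_pconst \<psi>_pconst \<psi>.hom_zero)
  next
    case (pvar i)
    show ?case by (rule \<psi>_pvar_br[OF pvar q])
  next
    case (add p p')
    show ?case
      by (simp only: P.bracket_add[OF add.hyps q] \<psi>.hom_add add.IH
          RB.bracket_add[OF \<psi>_R[OF add.hyps(1)] \<psi>_R[OF add.hyps(2)] \<psi>_R[OF q]])
  next
    case (mult p p')
    show ?case
      by (simp only: P.bracket_mult[OF mult.hyps q] \<psi>.hom_add \<psi>.hom_mult mult.IH
          RB.bracket_mult[OF \<psi>_R[OF mult.hyps(1)] \<psi>_R[OF mult.hyps(2)] \<psi>_R[OF q]])
  qed

  have \<eta>\<psi>: "\<eta> (\<psi> a) = a" if "a \<in> polys n" for a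
    using that
  proof (induction a rule: polys_induct)
    case (pconst c)
    show ?case by (simp only: \<psi>_pconst \<eta>_const \<epsilon>_pconst)
  next
    case (pvar j)
    have \<eta>_Y: "\<eta> Y = f - evf F" unfolding Y_def
      by (simp add: \<eta>.hom_minus \<eta>_G \<eta>_proj[OF fR] \<eta>_const \<epsilon>_f)
    show ?case
      unfolding \<psi>_pvar \<eta>.hom_add \<eta>.hom_mult \<eta>_proj[OF xV(2)[OF pvar]] \<eta>_const \<epsilon>_pvar \<epsilon>_pconst \<eta>_Y
      by (simp add: algebra_simps)
  qed (simp_all add: \<psi>.hom_add \<psi>.hom_mult \<eta>.hom_add \<eta>.hom_mult)

  define A where "A = \<psi> ` polys n"
  have A_ring: "subring_set A"
  proof
    show "0 \<in> A" "1 \<in> A" unfolding A_def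
      using \<psi>.hom_zero \<psi>.hom_one polys.zero_mem polys.one_mem by (metis imageI)+
  next
    fix x y assume "x \<in> A" "y \<in> A"
    then obtain a b where ab: "a \<in> polys n" "b \<in> polys n" "x = \<psi> a" "y = \<psi> b" by (auto simp: A_def)
    have "x + y = \<psi> (a + b)" "x * y = \<psi> (a * b)" using ab by (simp_all add: \<psi>.hom_add \<psi>.hom_mult)
    thus "x + y \<in> A" "x * y \<in> A" unfolding A_def
      using imageI[OF polys.add_mem[OF ab(1,2)], of \<psi>] imageI[OF polys.mult_mem[OF ab(1,2)], of \<psi>]
      by simp_all
  next
    fix x assume "x \<in> A"
    then obtain a where a: "a \<in> polys n" "x = \<psi> a" by (auto simp: A_def)
    have "- x = \<psi> (- a)" using a by (simp add: \<psi>.hom_uminus)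
    thus "- x \<in> A" unfolding A_def using imageI[OF polys.uminus_mem[OF a(1)], of \<psi>] by simp
  qed
  interpret A: subring_set A by (rule A_ring)
  have A_const: "[:pconst c:] \<in> A" for c
    unfolding A_def using \<psi>_pconst[of c] pconst_in_polys by (metis imageI)
  have \<psi>_f: "\<psi> f = G"
  proof -
    have pf: "evalp (\<lambda>c. [:pconst c:]) (\<lambda>j. proj [:pvar j:]) f = proj [:f:]"
      using evalp_proj f(1) by (simp add: V_eq_polys)
    have "\<psi> f = \<psi> (\<Sum>k<n. pconst (\<phi> k) * pvar k)" using f_linear by simp
    also have "\<dots> = (\<Sum>k<n. [:pconst (\<phi> k):] * proj [:pvar k:]) + Y * (\<Sum>k<n. [:pconst (\<phi> k):] * [:pconst (\<mu> k):])"
      by (simp only: \<psi>.hom_sum \<psi>.hom_mult \<psi>_pconst \<psi>_pvar distrib_left sum.distrib sum_distrib_left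
          mult.left_commute)
    also have "(\<Sum>k<n. [:pconst (\<phi> k):] * [:pconst (\<mu> k):]) = [:pconst (\<Sum>k<n. \<phi> k * \<mu> k):]"
      by (rule poly_eqI) (simp add: coeff_sum pconst.hom_sum pconst_mult coeff_pCons mult.commute split: nat.splits)
    also have "\<dots> = 1" by (simp add: sum_\<phi>_\<mu>)
    also have "(\<Sum>k<n. [:pconst (\<phi> k):] * proj [:pvar k:])
        = evalp (\<lambda>c. [:pconst c:]) (\<lambda>j. proj [:pvar j:]) (\<Sum>k<n. pconst (\<phi> k) * pvar k)"
      by (simp only: evalp_sum[OF hom_const_pconst] evalp_mult[OF hom_const_pconst]
          evalp_pconst[OF hom_const_pconst] evalp_pvar[OF hom_const_pconst])
    also have "\<dots> = proj [:f:]" using pf f_linear by simp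
    finally show ?thesis by (simp add: Y_def)
  qed
  have GA: "G \<in> A" unfolding A_def using \<psi>_f f(1) by (metis imageI V_eq_polys)
  have evG_A: "evG G q \<in> A" for q
    by (induction q) (simp_all only: evG_0 evG_pCons A.zero_mem A.add_mem A.mult_mem A_const GA)
  have projA_poly: "proj [:a:] \<in> A" if "a \<in> polys n" for a
    using that
  proof (induction a rule: polys_induct)
    case (pconst c)
    show ?case using proj_base[OF const_mem] A_const by simp
  next
    case (pvar j)
    have "proj [:pvar j:] = \<psi> (pvar j) - Y * [:pconst (\<mu> j):]" by (simp add: \<psi>_pvar)
    moreover have "\<psi> (pvar j) \<in> A" unfolding A_def using pvar pvar_in_polys by blast
    moreover have "Y \<in> A" unfolding Y_def F[symmetric] by (intro A.diff_mem GA evG_A)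
    ultimately show ?case using A.diff_mem A.mult_mem A_const by metis
  next
    case (add p q)
    hence "[:p:] \<in> R" "[:q:] \<in> R" using const_in_R by (simp_all add: V_eq_polys)
    hence "proj [:p + q:] = proj [:p:] + proj [:q:]" using proj_add[of "[:p:]" "[:q:]"] by simp
    thus ?case using add.IH by (simp add: A.add_mem)
  next
    case (mult p q)
    hence R: "[:p:] \<in> R" "[:q:] \<in> R" using const_in_R by (simp_all add: V_eq_polys)
    have "[:p * q:] = [:p:] * [:q:]" by simp
    hence "proj [:p * q:] = proj [:p:] * proj [:q:]" using proj_mult[OF R] by (simp only:)
    thus ?case using mult.IH by (simp add: A.mult_mem)
  qed
  have projA: "proj P \<in> A" if "coeffs_in V P" for P
    using that
  proof (induction P)
    case 0
    show ?case using proj_base[OF zero_mem] A.zero_mem by simp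
  next
    case (pCons a P)
    hence P: "a \<in> V" "coeffs_in V P" by (auto simp: V.coeffs_in_pCons)
    have "proj (pCons a P) = proj [:a:] + evG G T * proj P"
      unfolding T using P by (intro proj_pCons) auto
    thus ?case using pCons.IH[OF P(2)] projA_poly P(1) by (simp add: A.add_mem A.mult_mem evG_A V_eq_polys)
  qed

  have "bij_betw \<psi> V B"
  proof (rule bij_betwI')
    fix p q assume "p \<in> V" "q \<in> V"
    thus "(\<psi> p = \<psi> q) = (p = q)" using \<eta>\<psi> V_eq_polys by metis
  next
    fix p assume "p \<in> V"
    thus "\<psi> p \<in> B" using \<psi>_B V_eq_polys by blast
  next
    fix b assume b: "b \<in> B"
    hence "b \<in> A" using projA[of b] base_R[OF b] proj_base[OF b] by simp
    thus "\<exists>x\<in>V. b = \<psi> x" unfolding A_def V_eq_polys by blast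
  qed
  moreover have "\<psi> (br p q) = rb (\<psi> p) (\<psi> q)" if "p \<in> V" "q \<in> V" for p q
    using \<psi>_br that V_eq_polys by blast
  moreover have "\<psi> (pconst c * p) = [:pconst c:] * \<psi> p" for c p
    by (simp only: \<psi>.hom_mult \<psi>_pconst)
  ultimately show ?thesis
    unfolding poisson_equiv_def using \<psi>.hom_add \<psi>.hom_mult \<psi>.hom_one by blast
qed

end

theorem (in two_presentations) coefficient_rings_equivalent: "\<exists>\<psi>. poisson_equiv B \<psi>"
proof (cases "\<forall>f\<in>V. central f \<longrightarrow> [:f:] \<in> B")
  case True
  thus ?thesis by (intro equiv_if_centre_in_base) blast
next
  case False
  then obtain f0 where f0: "f0 \<in> V" "central f0" "[:f0:] \<notin> B" by blast
  obtain f e where f: "e > 0" "f \<in> V" "central f" "f \<in> hom_part n e" "f \<noteq> 0"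
    "degree (expand [:f:]) > 0"
    "\<And>g j. g \<in> V \<Longrightarrow> central g \<Longrightarrow> g \<in> hom_part n j \<Longrightarrow> g \<noteq> 0 \<Longrightarrow> j > 0 \<Longrightarrow> e \<le> j"
    by (rule least_central_homogeneous[OF f0], rule that)
  have "\<exists>i. lookup (coeff (D [:f:]) i) 0 \<noteq> 0"
    by (rule derivative_has_constant_term[OF f(1-6)]) (rule f(7))
  then obtain i0 where "lookup (coeff (D [:f:]) i0) 0 \<noteq> 0" by blast
  then interpret moved_centre n br r d B s f e i0
    using f by unfold_locales auto
  show ?thesis by (rule equiv_if_centre_moved)
qed

section \<open>Abstract Poisson algebras\<close>

lemma (in abelian_monoid) finsum_single_term:
  fixes A :: "'i set"
  assumes "finite A" "j \<in> A" "g j \<in> carrier G" "\<And>i. i \<in> A \<Longrightarrow> i \<noteq> j \<Longrightarrow> g i = \<zero>"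
  shows "(\<Oplus>i\<in>A. g i) = g j"
proof -
  have "(\<Oplus>i\<in>A. g i) = (\<Oplus>i\<in>A. if j = i then g i else \<zero>)"
    using assms by (intro finsum_cong') auto
  also have "\<dots> = g j"
  proof (rule finsum_singleton[OF assms(2,1)])
    show "g \<in> A \<rightarrow> carrier G" using assms by (metis Pi_I zero_closed)
  qed
  finally show ?thesis .
qed

subsection \<open>Veronese subalgebras as abstract Poisson algebras\<close>

context veronese_poisson
begin

abbreviation A :: "('k, 'k mpol) poisson" where "A \<equiv> veronese n br d"

lemma A_simps:
  "carrier A = V" "x \<otimes>\<^bsub>A\<^esub> y = x * y" "\<one>\<^bsub>A\<^esub> = 1" "\<zero>\<^bsub>A\<^esub> = 0" "x \<oplus>\<^bsub>A\<^esub> y = x + y"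
  "c \<odot>\<^bsub>A\<^esub> x = pconst c * x" "pbracket A = br"
  by (simp_all add: veronese_def poly_alg_def)

lemma poisson_algebra_A: "poisson_algebra A"
proof -
  have field: "cring (ring_of_type_algebra :: 'k ring)" by (rule cring_from_type_algebra)
  have comm_ring: "cring A"
  proof (rule cringI)
    show "abelian_group A"
    proof (rule abelian_groupI)
      fix x assume x: "x \<in> carrier A"
      thus "\<exists>y\<in>carrier A. y \<oplus>\<^bsub>A\<^esub> x = \<zero>\<^bsub>A\<^esub>"
        by (intro bexI[of _ "- x"]) (simp_all add: A_simps V.uminus_mem)
    qed (simp_all add: A_simps V.add_mem V.zero_mem add_ac)
    show "comm_monoid A"
      by (rule comm_monoidI) (simp_all add: A_simps V.mult_mem V.one_mem mult_ac)
  qed (simp add: A_simps distrib_right)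
  show ?thesis
  proof (rule poisson_algebra.intro)
    show "algebra (ring_of_type_algebra :: 'k ring) A"
      by (rule algebraI[OF field comm_ring])
        (simp_all add: A_simps ring_of_type_algebra_def V.mult_mem pconst_in_V pconst_add pconst_mult
          distrib_left distrib_right mult.assoc)
    show "poisson_algebra_axioms A"
    proof (rule poisson_algebra_axioms.intro)
      fix x y z assume "x \<in> carrier A" "y \<in> carrier A" "z \<in> carrier A"
      hence V: "x \<in> V" "y \<in> V" "z \<in> V" and p: "x \<in> polys n" "y \<in> polys n" "z \<in> polys n"
        by (simp_all add: A_simps V_polys)
      show "pbracket A (x \<oplus>\<^bsub>A\<^esub> y) z = pbracket A x z \<oplus>\<^bsub>A\<^esub> pbracket A y z"
        "pbracket A x (y \<oplus>\<^bsub>A\<^esub> z) = pbracket A x y \<oplus>\<^bsub>A\<^esub> pbracket A x z"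
        "pbracket A (x \<otimes>\<^bsub>A\<^esub> y) z = x \<otimes>\<^bsub>A\<^esub> pbracket A y z \<oplus>\<^bsub>A\<^esub> pbracket A x z \<otimes>\<^bsub>A\<^esub> y"
        "pbracket A x (y \<otimes>\<^bsub>A\<^esub> z) = y \<otimes>\<^bsub>A\<^esub> pbracket A x z \<oplus>\<^bsub>A\<^esub> pbracket A x y \<otimes>\<^bsub>A\<^esub> z"
        using V by (simp_all add: A_simps V.bracket_add V.bracket_add_right V.bracket_mult
            V.bracket_mult_right mult.commute)
      show "pbracket A x (pbracket A y z) \<oplus>\<^bsub>A\<^esub> pbracket A y (pbracket A z x)
          \<oplus>\<^bsub>A\<^esub> pbracket A z (pbracket A x y) = \<zero>\<^bsub>A\<^esub>"
        using poisson_algebra.bracket_jacobi[OF poisson, of x y z] p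
        unfolding A_simps by (simp add: poly_alg_def)
    next
      fix c x y assume "x \<in> carrier A" "y \<in> carrier A"
      hence V: "x \<in> V" "y \<in> V" by (simp_all add: A_simps)
      show "pbracket A x y \<in> carrier A" using V by (simp add: A_simps V.bracket_mem)
      have left: "br (pconst c * u) v = pconst c * br u v" if "u \<in> V" "v \<in> V" for u v
        using that by (simp add: scale_left V_polys)
      show "pbracket A (c \<odot>\<^bsub>A\<^esub> x) y = c \<odot>\<^bsub>A\<^esub> pbracket A x y" using left V by (simp add: A_simps)
      have "br x (pconst c * y) = - br (pconst c * y) x"
        by (intro V.bracket_anti V V.mult_mem pconst_in_V)
      also have "\<dots> = pconst c * br x y" using left[OF V(2,1)] V.bracket_anti[OF V] by simp
      finally show "pbracket A x (c \<odot>\<^bsub>A\<^esub> y) = c \<odot>\<^bsub>A\<^esub> pbracket A x y" by (simp add: A_simps)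
    next
      fix x assume "x \<in> carrier A"
      thus "pbracket A x x = \<zero>\<^bsub>A\<^esub>" by (simp add: A_simps alternating V_polys)
    qed
  qed
qed

lemma finsum_A:
  assumes "finite S" "\<And>i. i \<in> S \<Longrightarrow> g i \<in> V" shows "finsum A g S = sum g S"
proof -
  interpret A: poisson_algebra A by (rule poisson_algebra_A)
  show ?thesis using assms
  proof (induction S rule: finite_induct)
    case (insert x S)
    thus ?case by (subst A.finsum_insert) (auto simp: A_simps)
  qed (simp add: A_simps)
qed

end

subsection \<open>Pulling back a competitor\<close>

text \<open>
  An abstract competitor $Q$ with a Poisson isomorphism $\Phi$ from $A[t]$ to $Q[s]$.
\<close>

locale poly_isomorphism = veronese_poisson n br r d + Q: poisson_algebra Q
  for n and br :: "'k::{alg_closed_field, field_char_0} mpol \<Rightarrow> 'k mpol \<Rightarrow> 'k mpol" and r d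
    and Q :: "('k, 'b) poisson" (structure) +
  fixes \<Phi> :: "(nat \<Rightarrow> 'k mpol) \<Rightarrow> nat \<Rightarrow> 'b"
  assumes \<Phi>: "\<Phi> \<in> poisson_iso (poisson_poly (veronese n br d)) (poisson_poly Q)"
begin

abbreviation R :: "'k mpol poly set" where "R \<equiv> {P. coeffs_in V P}"
abbreviation rb :: "'k mpol poly \<Rightarrow> 'k mpol poly \<Rightarrow> 'k mpol poly" where "rb \<equiv> lift_bracket br"

sublocale RB: poisson_subring R rb by (rule V.poisson_subring_lift)

lemma up_A: "f \<in> up A \<longleftrightarrow> (\<exists>P. coeffs_in V P \<and> f = coeff P)"
proof safe
  assume f: "f \<in> up A"
  then obtain N where N: "UnivPoly.bound 0 N f" and V: "\<And>i. f i \<in> V"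
    by (auto simp: up_def A_simps)
  have "eventually (\<lambda>i. f i = 0) cofinite"
    unfolding MOST_nat using bound.bound[OF N] by auto
  hence "coeff (Abs_poly f) = f" by (intro Abs_poly_inverse) simp
  with V show "\<exists>P. coeffs_in V P \<and> f = coeff P"
    by (intro exI[of _ "Abs_poly f"]) (simp add: coeffs_in_def)
next
  fix P assume P: "coeffs_in V P"
  have "UnivPoly.bound 0 (degree P) (coeff P)" by (rule bound.intro) (simp add: coeff_eq_0)
  thus "coeff P \<in> up A" using P by (auto simp: up_def A_simps coeffs_in_def)
qed

definition h :: "'k mpol poly \<Rightarrow> nat \<Rightarrow> 'b" where "h P = \<Phi> (coeff P)"

lemma \<Phi>_props:
  "bij_betw \<Phi> (up A) (up Q)"
  "\<And>f g. f \<in> up A \<Longrightarrow> g \<in> up A \<Longrightarrow>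
     \<Phi> (f \<otimes>\<^bsub>UP A\<^esub> g) = \<Phi> f \<otimes>\<^bsub>UP Q\<^esub> \<Phi> g \<and> \<Phi> (f \<oplus>\<^bsub>UP A\<^esub> g) = \<Phi> f \<oplus>\<^bsub>UP Q\<^esub> \<Phi> g"
  "\<Phi> \<one>\<^bsub>UP A\<^esub> = \<one>\<^bsub>UP Q\<^esub>"
  "\<And>c f. f \<in> up A \<Longrightarrow> \<Phi> (\<lambda>i. pconst c * f i) = (\<lambda>i. c \<odot> \<Phi> f i)"
  "\<And>f g. f \<in> up A \<Longrightarrow> g \<in> up A \<Longrightarrow>
     \<Phi> (\<lambda>k. \<Oplus>\<^bsub>A\<^esub>i\<in>{..k}. br (f i) (g (k - i))) = (\<lambda>k. \<Oplus>i\<in>{..k}. pbracket Q (\<Phi> f i) (\<Phi> g (k - i)))"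
proof -
  have carrier: "carrier (poisson_poly A) = up A" "carrier (poisson_poly Q) = up Q"
    by (simp_all add: poisson_poly_def UP_def)
  have iso: "\<Phi> \<in> ring_iso (poisson_poly A) (poisson_poly Q)"
    and sm: "\<And>c x. x \<in> up A \<Longrightarrow> \<Phi> (c \<odot>\<^bsub>poisson_poly A\<^esub> x) = c \<odot>\<^bsub>poisson_poly Q\<^esub> \<Phi> x"
    and brk: "\<And>x y. x \<in> up A \<Longrightarrow> y \<in> up A \<Longrightarrow>
      \<Phi> (pbracket (poisson_poly A) x y) = pbracket (poisson_poly Q) (\<Phi> x) (\<Phi> y)"
    using \<Phi> by (auto simp: poisson_iso_def carrier)
  note E = ring_iso_memE[OF iso, unfolded carrier]
  show "bij_betw \<Phi> (up A) (up Q)" by (rule E(5))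
  show "\<Phi> \<one>\<^bsub>UP A\<^esub> = \<one>\<^bsub>UP Q\<^esub>" using E(4) by (simp add: poisson_poly_def)
  show "\<Phi> (f \<otimes>\<^bsub>UP A\<^esub> g) = \<Phi> f \<otimes>\<^bsub>UP Q\<^esub> \<Phi> g \<and> \<Phi> (f \<oplus>\<^bsub>UP A\<^esub> g) = \<Phi> f \<oplus>\<^bsub>UP Q\<^esub> \<Phi> g"
    if "f \<in> up A" "g \<in> up A" for f g
    using E(2,3)[OF that] by (simp add: poisson_poly_def)
  show "\<Phi> (\<lambda>i. pconst c * f i) = (\<lambda>i. c \<odot> \<Phi> f i)" if "f \<in> up A" for c f
    using sm[OF that] by (simp add: poisson_poly_def A_simps)
  show "\<Phi> (\<lambda>k. \<Oplus>\<^bsub>A\<^esub>i\<in>{..k}. br (f i) (g (k - i))) = (\<lambda>k. \<Oplus>i\<in>{..k}. pbracket Q (\<Phi> f i) (\<Phi> g (k - i)))"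
    if "f \<in> up A" "g \<in> up A" for f g
    using brk[OF that] by (simp add: poisson_poly_def A_simps)
qed

lemma coeff_up: "coeffs_in V P \<Longrightarrow> coeff P \<in> up A" using up_A by blast

lemma h_bij: "bij_betw h R (up Q)"
proof -
  have "bij_betw coeff R (up A)"
    by (rule bij_betwI') (auto simp: up_A coeff_inject)
  thus ?thesis unfolding h_def using bij_betw_trans[OF _ \<Phi>_props(1)] by (simp add: o_def)
qed

lemma h_up: "P \<in> R \<Longrightarrow> h P \<in> up Q" using h_bij by (auto simp: bij_betw_def)

lemma h_inj: "P \<in> R \<Longrightarrow> P' \<in> R \<Longrightarrow> h P = h P' \<Longrightarrow> P = P'"
  using h_bij unfolding bij_betw_def inj_on_def by blast

lemma up_Q: "q \<in> up Q \<longleftrightarrow> (\<forall>i. q i \<in> carrier Q) \<and> (\<exists>N. \<forall>i>N. q i = \<zero>)"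
  by (auto simp: up_def UnivPoly.bound_def)

lemma h_closed: "P \<in> R \<Longrightarrow> h P i \<in> carrier Q" using h_up up_Q by blast

lemma h_add: assumes "P \<in> R" "P' \<in> R" shows "h (P + P') = (\<lambda>i. h P i \<oplus> h P' i)"
proof -
  have c: "coeff P \<in> up A" "coeff P' \<in> up A" using assms coeff_up by auto
  have "coeff P \<oplus>\<^bsub>UP A\<^esub> coeff P' = coeff (P + P')" using c by (auto simp: UP_def A_simps)
  thus ?thesis using \<Phi>_props(2)[OF c] h_up[OF assms(1)] h_up[OF assms(2)]
    by (simp add: h_def UP_def)
qed

lemma h_mult: assumes "P \<in> R" "P' \<in> R" shows "h (P * P') = (\<lambda>k. \<Oplus>i\<in>{..k}. h P i \<otimes> h P' (k - i))"
proof -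
  have c: "coeff P \<in> up A" "coeff P' \<in> up A" using assms coeff_up by auto
  have "(\<Oplus>\<^bsub>A\<^esub>i\<in>{..k}. coeff P i * coeff P' (k - i)) = coeff (P * P') k" for k
    using assms by (subst finsum_A) (auto simp: coeff_mult coeffs_in_def intro: V.mult_mem)
  hence "coeff P \<otimes>\<^bsub>UP A\<^esub> coeff P' = coeff (P * P')" using c by (auto simp: UP_def A_simps)
  thus ?thesis using \<Phi>_props(2)[OF c] h_up[OF assms(1)] h_up[OF assms(2)]
    by (simp add: h_def UP_def)
qed

lemma h_one: "h 1 = (\<lambda>i. if i = 0 then \<one> else \<zero>)"
proof -
  have "coeff (1 :: 'k mpol poly) = \<one>\<^bsub>UP A\<^esub>" by (auto simp: UP_def A_simps coeff_1)
  thus ?thesis using \<Phi>_props(3) by (simp add: h_def UP_def)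
qed

lemma h_scale: assumes "P \<in> R" shows "h ([:pconst c:] * P) = (\<lambda>i. c \<odot> h P i)"
proof -
  have "coeff ([:pconst c:] * P) = (\<lambda>i. pconst c * coeff P i)" by auto
  thus ?thesis using \<Phi>_props(4)[of "coeff P" c] coeff_up assms by (simp add: h_def)
qed

lemma h_bracket: assumes "P \<in> R" "P' \<in> R"
  shows "h (rb P P') = (\<lambda>k. \<Oplus>i\<in>{..k}. pbracket Q (h P i) (h P' (k - i)))"
proof -
  have c: "coeff P \<in> up A" "coeff P' \<in> up A" using assms coeff_up by auto
  have "(\<Oplus>\<^bsub>A\<^esub>i\<in>{..k}. br (coeff P i) (coeff P' (k - i))) = coeff (rb P P') k" for k
    using assms by (subst finsum_A) (auto simp: V.coeff_lift_bracket coeffs_in_def intro: V.bracket_mem)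
  hence "coeff (rb P P') = (\<lambda>k. \<Oplus>\<^bsub>A\<^esub>i\<in>{..k}. br (coeff P i) (coeff P' (k - i)))" by auto
  thus ?thesis using \<Phi>_props(5)[OF c] by (simp add: h_def)
qed

lemma scale_closed: "x \<in> carrier Q \<Longrightarrow> c \<odot> x \<in> carrier Q"
  using Q.smult_closed[of c x] by (simp add: ring_of_type_algebra_def)

lemma scale_zero: "x \<in> carrier Q \<Longrightarrow> 0 \<odot> x = \<zero>" "c \<odot> \<zero> = \<zero>"
  using Q.smult_l_null[of x] Q.smult_r_null[of c] by (simp_all add: ring_of_type_algebra_def)

lemma h_zero: "h 0 = (\<lambda>i. \<zero>)"
  using h_scale[OF RB.one_mem, of 0] h_closed[OF RB.one_mem] by (simp add: scale_zero)

lemma Q_bracket_zero: "x \<in> carrier Q \<Longrightarrow> pbracket Q \<zero> x = \<zero>" "x \<in> carrier Q \<Longrightarrow> pbracket Q x \<zero> = \<zero>"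
  using Q.bracket_scale_left[of \<zero> x 0] Q.bracket_scale_right[of x \<zero> 0] Q.bracket_closed
  by (simp_all add: scale_zero)

lemma Q_bracket_one: assumes x: "x \<in> carrier Q" shows "pbracket Q \<one> x = \<zero>"
proof -
  let ?b = "pbracket Q \<one> x"
  have b: "?b \<in> carrier Q" using x by (simp add: Q.bracket_closed)
  have "?b = ?b \<oplus> ?b" using Q.bracket_leibniz_left[of \<one> \<one> x] x b by simp
  thus ?thesis using b Q.add.r_cancel_one' by metis
qed

definition const_seq :: "'b \<Rightarrow> nat \<Rightarrow> 'b" where "const_seq b = (\<lambda>i. if i = 0 then b else \<zero>)"

definition var_seq :: "nat \<Rightarrow> 'b" where "var_seq = (\<lambda>i. if i = 1 then \<one> else \<zero>)"

text \<open>
  The preimages of constants and of the variable in $Q[s]$ turn the isomorphism into a second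
  presentation of $A[t]$ inside the type of its elements.
\<close>

definition \<iota> :: "'b \<Rightarrow> 'k mpol poly" where "\<iota> b = inv_into R h (const_seq b)"

definition s :: "'k mpol poly" where "s = inv_into R h var_seq"

definition B :: "'k mpol poly set" where "B = \<iota> ` carrier Q"

lemma const_seq_up: "b \<in> carrier Q \<Longrightarrow> const_seq b \<in> up Q"
  by (auto simp: up_Q const_seq_def)

lemma \<iota>: assumes "b \<in> carrier Q" shows \<iota>_R: "\<iota> b \<in> R" and h_\<iota>: "h (\<iota> b) = const_seq b"
  using const_seq_up[OF assms] h_bij unfolding \<iota>_def bij_betw_def
  by (metis inv_into_into, metis f_inv_into_f)

lemma s_R: "s \<in> R" and h_s: "h s = var_seq"
proof -
  have "var_seq \<in> up Q" by (auto simp: up_Q var_seq_def intro!: exI[of _ 1])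
  thus "s \<in> R" "h s = var_seq" using h_bij unfolding s_def bij_betw_def
    by (metis inv_into_into, metis f_inv_into_f)
qed

lemma \<iota>_eqI: "P \<in> R \<Longrightarrow> b \<in> carrier Q \<Longrightarrow> h P = const_seq b \<Longrightarrow> P = \<iota> b"
  using h_inj \<iota>_R h_\<iota> by metis

lemma \<iota>_zero: "\<iota> \<zero> = 0"
  using \<iota>_eqI[of 0 \<zero>] RB.zero_mem h_zero by (simp add: const_seq_def)

lemma \<iota>_inj: "b \<in> carrier Q \<Longrightarrow> c \<in> carrier Q \<Longrightarrow> \<iota> b = \<iota> c \<Longrightarrow> b = c"
  using h_\<iota> unfolding const_seq_def by metis

lemma \<iota>_add: assumes bc: "b \<in> carrier Q" "c \<in> carrier Q" shows "\<iota> b + \<iota> c = \<iota> (b \<oplus> c)"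
proof (rule \<iota>_eqI[OF RB.add_mem[OF \<iota>_R \<iota>_R], OF bc])
  show "h (\<iota> b + \<iota> c) = const_seq (b \<oplus> c)"
    unfolding h_add[OF \<iota>_R \<iota>_R, OF bc] h_\<iota>[OF bc(1)] h_\<iota>[OF bc(2)] by (auto simp: const_seq_def)
qed (use bc in simp)

lemma \<iota>_mult: assumes bc: "b \<in> carrier Q" "c \<in> carrier Q" shows "\<iota> b * \<iota> c = \<iota> (b \<otimes> c)"
proof (rule \<iota>_eqI[OF RB.mult_mem[OF \<iota>_R \<iota>_R], OF bc])
  show "h (\<iota> b * \<iota> c) = const_seq (b \<otimes> c)"
  proof
    fix k
    have "h (\<iota> b * \<iota> c) k = (\<Oplus>i\<in>{..k}. const_seq b i \<otimes> const_seq c (k - i))"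
      by (simp only: h_mult[OF \<iota>_R \<iota>_R, OF bc] h_\<iota>[OF bc(1)] h_\<iota>[OF bc(2)])
    also have "\<dots> = const_seq b 0 \<otimes> const_seq c (k - 0)"
      using bc by (intro Q.finsum_single_term) (auto simp: const_seq_def)
    finally show "h (\<iota> b * \<iota> c) k = const_seq (b \<otimes> c) k" using bc by (simp add: const_seq_def)
  qed
qed (use bc in simp)

lemma \<iota>_bracket: assumes bc: "b \<in> carrier Q" "c \<in> carrier Q" shows "rb (\<iota> b) (\<iota> c) = \<iota> (pbracket Q b c)"
proof (rule \<iota>_eqI[OF RB.bracket_mem[OF \<iota>_R \<iota>_R], OF bc])
  show "h (rb (\<iota> b) (\<iota> c)) = const_seq (pbracket Q b c)"
  proof
    fix k
    have "h (rb (\<iota> b) (\<iota> c)) k = (\<Oplus>i\<in>{..k}. pbracket Q (const_seq b i) (const_seq c (k - i)))"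
      by (simp only: h_bracket[OF \<iota>_R \<iota>_R, OF bc] h_\<iota>[OF bc(1)] h_\<iota>[OF bc(2)])
    also have "\<dots> = pbracket Q (const_seq b 0) (const_seq c (k - 0))"
      using bc by (intro Q.finsum_single_term) (auto simp: const_seq_def Q.bracket_closed Q_bracket_zero)
    finally show "h (rb (\<iota> b) (\<iota> c)) k = const_seq (pbracket Q b c) k"
      using bc by (simp add: const_seq_def Q_bracket_zero)
  qed
qed (use bc in \<open>simp add: Q.bracket_closed\<close>)

lemma \<iota>_scale: assumes b: "b \<in> carrier Q" shows "[:pconst c:] * \<iota> b = \<iota> (c \<odot> b)"
proof (rule \<iota>_eqI)
  have "[:pconst c:] \<in> R" by (simp add: V.coeffs_in_pCons V.coeffs_in_0 pconst_in_V)
  thus "[:pconst c:] * \<iota> b \<in> R" by (intro RB.mult_mem \<iota>_R b)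
  show "h ([:pconst c:] * \<iota> b) = const_seq (c \<odot> b)"
    unfolding h_scale[OF \<iota>_R[OF b]] h_\<iota>[OF b] by (auto simp: const_seq_def scale_zero)
qed (use b scale_closed in blast)

lemma \<iota>_one: "\<iota> \<one> = 1"
  using \<iota>_eqI[OF RB.one_mem, of \<one>] h_one by (simp add: const_seq_def)

lemma const_in_B: "[:pconst c:] \<in> B"
proof -
  have "[:pconst c:] = \<iota> (c \<odot> \<one>)" using \<iota>_scale[of \<one> c] by (simp add: \<iota>_one)
  thus ?thesis unfolding B_def using scale_closed by blast
qed

lemma B_subring: "subring_set B"
proof
  show "0 \<in> B" "1 \<in> B" unfolding B_def using \<iota>_zero \<iota>_one by (metis Q.zero_closed Q.one_closed imageI)+
next
  fix x y assume "x \<in> B" "y \<in> B"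
  thus "x + y \<in> B" "x * y \<in> B" unfolding B_def by (auto simp: \<iota>_add \<iota>_mult)
next
  fix x assume "x \<in> B"
  then obtain b where b: "b \<in> carrier Q" "x = \<iota> b" unfolding B_def by blast
  have "- x = [:pconst (-1):] * x" by (simp add: pconst.hom_uminus)
  also have "\<dots> = \<iota> ((-1) \<odot> b)" using \<iota>_scale[OF b(1)] b(2) by simp
  finally show "- x \<in> B" unfolding B_def using b scale_closed by blast
qed

lemma B_R: "x \<in> B \<Longrightarrow> x \<in> R" unfolding B_def using \<iota>_R by blast

lemma h_s_mult: assumes "P \<in> R" shows "h (s * P) k = (case k of 0 \<Rightarrow> \<zero> | Suc l \<Rightarrow> h P l)"
proof -
  have eq: "h (s * P) k = (\<Oplus>i\<in>{..k}. var_seq i \<otimes> h P (k - i))"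
    by (simp only: h_mult[OF s_R assms] h_s)
  have hc: "h P i \<in> carrier Q" for i by (rule h_closed[OF assms])
  show ?thesis
  proof (cases k)
    case 0
    thus ?thesis unfolding eq using hc by (simp add: var_seq_def)
  next
    case (Suc l)
    have "(\<Oplus>i\<in>{..k}. var_seq i \<otimes> h P (k - i)) = var_seq 1 \<otimes> h P (k - 1)"
      using Suc hc by (intro Q.finsum_single_term) (auto simp: var_seq_def)
    thus ?thesis unfolding eq using Suc hc by (simp add: var_seq_def)
  qed
qed

lemma poly_in_R: "coeffs_in B F \<Longrightarrow> poly F s \<in> R"
  using B_R by (intro RB.poly_mem s_R) (auto simp: coeffs_in_def)

lemma \<iota>_h_poly: assumes "coeffs_in B F" shows "\<iota> (h (poly F s) i) = coeff F i"
  using assms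
proof (induction F arbitrary: i)
  case 0
  show ?case by (simp add: h_zero \<iota>_zero)
next
  case (pCons a F)
  interpret B: subring_set B by (rule B_subring)
  have aB: "a \<in> B" and F: "coeffs_in B F" using pCons.prems by (simp_all add: B.coeffs_in_pCons)
  obtain b where b: "b \<in> carrier Q" "a = \<iota> b" using aB unfolding B_def by blast
  have FR: "poly F s \<in> R" by (rule poly_in_R[OF F])
  have "h (poly (pCons a F) s) i = h a i \<oplus> h (s * poly F s) i"
    using h_add[OF B_R[OF aB] RB.mult_mem[OF s_R FR]] by simp
  also have "\<dots> = (case i of 0 \<Rightarrow> b | Suc l \<Rightarrow> h (poly F s) l)"
    using b h_closed[OF FR] unfolding h_s_mult[OF FR] b(2) h_\<iota>[OF b(1)]
    by (auto simp: const_seq_def split: nat.splits)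
  finally show ?case using b pCons.IH[OF F] by (auto split: nat.splits simp: coeff_pCons)
qed

lemma two_presentations_B: "two_presentations n br r d B s"
proof -
  interpret B: subring_set B by (rule B_subring)
  interpret fa: free_adjunction B R s
  proof
    fix F assume F: "coeffs_in B F"
    show "poly F s \<in> R" by (rule poly_in_R[OF F])
    show "F = 0" if "poly F s = 0"
    proof (rule poly_eqI)
      fix i show "coeff F i = coeff 0 i" using \<iota>_h_poly[OF F, of i] that by (simp add: h_zero \<iota>_zero)
    qed
  next
    fix P assume P: "P \<in> R"
    define F where "F = Abs_poly (\<lambda>i. \<iota> (h P i))"
    obtain N where N: "\<And>i. i > N \<Longrightarrow> h P i = \<zero>" using h_up[OF P] up_Q by blast
    have "eventually (\<lambda>i. \<iota> (h P i) = 0) cofinite"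
      unfolding MOST_nat by (intro exI[of _ N]) (simp add: N \<iota>_zero)
    hence cF: "coeff F i = \<iota> (h P i)" for i unfolding F_def by (subst Abs_poly_inverse) simp_all
    have F: "coeffs_in B F" unfolding coeffs_in_def cF B_def using h_closed[OF P] by blast
    have "h (poly F s) i = h P i" for i
      by (rule \<iota>_inj[OF h_closed[OF poly_in_R[OF F]] h_closed[OF P]]) (simp add: \<iota>_h_poly[OF F] cF)
    hence "poly F s = P" by (intro h_inj[OF poly_in_R[OF F] P]) auto
    with F show "\<exists>F. coeffs_in B F \<and> poly F s = P" by blast
  qed
  show ?thesis
  proof (unfold_locales)
    show "[:pconst c:] \<in> B" for c by (rule const_in_B)
    show "rb b b' \<in> B" if "b \<in> B" "b' \<in> B" for b b'
      using that Q.bracket_closed unfolding B_def by (auto simp: \<iota>_bracket)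
    fix p assume "coeffs_in V p"
    hence p: "p \<in> R" by simp
    have "h (rb s p) = h 0"
    proof
      fix k
      have "pbracket Q (var_seq i) (h p (k - i)) = \<zero>" for i
        using h_closed[OF p] by (simp add: var_seq_def Q_bracket_zero Q_bracket_one)
      thus "h (rb s p) k = h 0 k" by (simp add: h_bracket[OF s_R p] h_s h_zero del: mem_Collect_eq)
    qed
    thus "rb s p = 0" by (intro h_inj[OF RB.bracket_mem[OF s_R p] RB.zero_mem])
  qed
qed

theorem isomorphic: "poisson_isomorphic A Q"
proof -
  obtain \<psi> where \<psi>: "poisson_equiv B \<psi>"
    using two_presentations.coefficient_rings_equivalent[OF two_presentations_B] by blast
  have bij: "bij_betw \<psi> V B" and one: "\<psi> 1 = 1"
    and hom: "\<And>p q. p \<in> V \<Longrightarrow> q \<in> V \<Longrightarrow> \<psi> (p + q) = \<psi> p + \<psi> q"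
      "\<And>p q. p \<in> V \<Longrightarrow> q \<in> V \<Longrightarrow> \<psi> (p * q) = \<psi> p * \<psi> q"
      "\<And>p q. p \<in> V \<Longrightarrow> q \<in> V \<Longrightarrow> \<psi> (br p q) = rb (\<psi> p) (\<psi> q)"
      "\<And>c p. p \<in> V \<Longrightarrow> \<psi> (pconst c * p) = [:pconst c:] * \<psi> p"
    using \<psi> unfolding poisson_equiv_def by auto
  have bij\<iota>: "bij_betw \<iota> (carrier Q) B"
    unfolding B_def bij_betw_def using \<iota>_inj by (auto intro: inj_onI)
  define \<theta> where "\<theta> = inv_into (carrier Q) \<iota> \<circ> \<psi>"
  have bij\<theta>: "bij_betw \<theta> V (carrier Q)"
    unfolding \<theta>_def by (rule bij_betw_trans[OF bij bij_betw_inv_into[OF bij\<iota>]])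
  have mem: "\<theta> p \<in> carrier Q" if "p \<in> V" for p using bij\<theta> that by (auto simp: bij_betw_def)
  have \<iota>\<theta>: "\<iota> (\<theta> p) = \<psi> p" if "p \<in> V" for p
    using that bij bij\<iota> unfolding \<theta>_def by (simp add: bij_betw_def) (metis f_inv_into_f imageI)
  have eqI: "\<theta> p = b" if "p \<in> V" "b \<in> carrier Q" "\<psi> p = \<iota> b" for p b
    by (rule \<iota>_inj) (use that mem \<iota>\<theta> in auto)
  have "\<theta> \<in> poisson_iso A Q"
    unfolding poisson_iso_def
  proof (intro CollectI conjI allI ballI ring_iso_memI)
    fix p q assume "p \<in> carrier A" "q \<in> carrier A"
    hence pq: "p \<in> V" "q \<in> V" by (simp_all add: A_simps)
    show "\<theta> (p \<otimes>\<^bsub>A\<^esub> q) = \<theta> p \<otimes> \<theta> q" unfolding A_simps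
      by (rule eqI) (use pq mem in \<open>simp_all add: V.mult_mem hom \<iota>_mult[symmetric] \<iota>\<theta>\<close>)
    show "\<theta> (p \<oplus>\<^bsub>A\<^esub> q) = \<theta> p \<oplus> \<theta> q" unfolding A_simps
      by (rule eqI) (use pq mem in \<open>simp_all add: V.add_mem hom \<iota>_add[symmetric] \<iota>\<theta>\<close>)
    show "\<theta> (pbracket A p q) = pbracket Q (\<theta> p) (\<theta> q)" unfolding A_simps
      by (rule eqI) (use pq mem in \<open>simp_all add: V.bracket_mem Q.bracket_closed hom \<iota>_bracket[symmetric] \<iota>\<theta>\<close>)
  next
    fix c p assume "p \<in> carrier A"
    hence p: "p \<in> V" by (simp add: A_simps)
    show "\<theta> (c \<odot>\<^bsub>A\<^esub> p) = c \<odot> \<theta> p" unfolding A_simps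
      by (rule eqI)
        (use p mem hom(4)[OF p] \<iota>_scale[OF mem[OF p]] in \<open>simp_all add: V.mult_mem pconst_in_V scale_closed \<iota>\<theta>\<close>)
  next
    show "\<theta> \<one>\<^bsub>A\<^esub> = \<one>" unfolding A_simps
      by (rule eqI) (simp_all add: V.one_mem one \<iota>_one)
    show "bij_betw \<theta> (carrier A) (carrier Q)" unfolding A_simps by (rule bij\<theta>)
    show "\<theta> p \<in> carrier Q" if "p \<in> carrier A" for p using that mem by (simp add: A_simps)
  qed
  thus ?thesis unfolding poisson_isomorphic_def by blast
qed

end

section \<open>Cancellation\<close>

theorem (in veronese_poisson) cancellative:
  "poisson_cancellative TYPE('b) (veronese n br d)"
  unfolding poisson_cancellative_def
proof (intro conjI allI impI)
  show "poisson_algebra (veronese n br d)" by (rule poisson_algebra_A)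
  fix Q :: "('k, 'b) poisson"
  assume Q: "poisson_algebra Q"
    and "poisson_isomorphic (poisson_poly (veronese n br d)) (poisson_poly Q)"
  then obtain \<Phi> where "\<Phi> \<in> poisson_iso (poisson_poly (veronese n br d)) (poisson_poly Q)"
    by (auto simp: poisson_isomorphic_def)
  then interpret poly_isomorphism n br r d Q \<Phi>
    using Q by (intro poly_isomorphism.intro poly_isomorphism_axioms.intro veronese_poisson_axioms)
  show "poisson_isomorphic (veronese n br d) Q" by (rule isomorphic)
qed

lemma veronese_1: "veronese n br 1 = poly_alg n br"
  by (simp add: veronese_def poly_alg_def veronese_carrier_1 del: One_nat_def)

text \<open>
  If all brackets of variables vanished, then so would all Lie brackets of basis vectors, because the
  coefficients of a linear form determine the element of the Lie algebra.
\<close>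

lemma (in lie_algebra) kostant_kirillov_homogeneous:
  fixes b :: "nat \<Rightarrow> 'g"
  assumes "nonabelian" and basis: "ordered_basis n b" and kk: "kostant_kirillov n b br"
  shows "i < n \<Longrightarrow> j < n \<Longrightarrow> br (pvar i) (pvar j) \<in> hom_part n 1"
    and "\<exists>p\<in>polys n. \<exists>q\<in>polys n. br p q \<noteq> 0"
proof -
  have br: "br (pvar i) (pvar j) = linear_form n b (lie (b i) (b j))" if "i < n" "j < n" for i j
    using kk that by (simp add: kostant_kirillov_def)
  show "br (pvar i) (pvar j) \<in> hom_part n 1" if "i < n" "j < n" for i j
    unfolding br[OF that] linear_form_def
    by (intro hom_part_sum pconst_mult_in_hom_part pvar_in_hom_part) simp
  have ind: "independent (b ` {..<n})" and sp: "span (b ` {..<n}) = UNIV" and inj: "inj_on b {..<n}"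
    using basis by (simp_all add: ordered_basis_def)
  have form_0: "v = 0" if v: "linear_form n b v = 0" for v
  proof -
    have rep: "representation (b ` {..<n}) v (b i) = 0" if i: "i < n" for i
    proof -
      have single_inj: "single k (1::nat) = single i 1 \<longleftrightarrow> k = i" for k
        by (metis lookup_single_eq lookup_single_not_eq zero_neq_one)
      have "lookup (linear_form n b v) (single i 1)
          = (\<Sum>k<n. if k = i then representation (b ` {..<n}) v (b i) else 0)"
        unfolding linear_form_def lookup_sum lookup_pconst_mult
        by (intro sum.cong refl) (simp add: pvar_def lookup_single when_def single_inj[simplified])
      thus ?thesis using v i by simp
    qed
    have "v = (\<Sum>w\<in>b ` {..<n}. scale (representation (b ` {..<n}) v w) w)"
      using sum_representation_eq[OF ind, of v "b ` {..<n}"] sp by simp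
    also have "\<dots> = 0" using rep by (intro sum.neutral) auto
    finally show ?thesis .
  qed
  show "\<exists>p\<in>polys n. \<exists>q\<in>polys n. br p q \<noteq> 0"
  proof (rule ccontr)
    assume "\<not> ?thesis"
    hence "br (pvar i) (pvar j) = 0" if "i < n" "j < n" for i j using that pvar_in_polys by blast
    hence 0: "lie x y = 0" if "x \<in> b ` {..<n}" "y \<in> b ` {..<n}" for x y
      using that br form_0 by auto
    have lie_0: "lie 0 w = 0" "lie w 0 = 0" for w
      using lie_scale_left[of 0 0 w] lie_scale_right[of w 0 0] by simp_all
    have 1: "lie x y = 0" if x: "x \<in> b ` {..<n}" for x y
    proof -
      have "y \<in> span (b ` {..<n})" using sp by simp
      thus ?thesis
        by (induction rule: span_induct_alt) (simp_all add: lie_0 lie_add_right lie_scale_right 0[OF x])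
    qed
    have "lie x y = 0" for x y
    proof -
      have "x \<in> span (b ` {..<n})" using sp by simp
      thus ?thesis
        by (induction rule: span_induct_alt) (simp_all add: lie_0 lie_add_left lie_scale_left 1)
    qed
    with \<open>nonabelian\<close> show False by (simp add: nonabelian_def)
  qed
qed

theorem theorem1p1:
  shows
    "(\<forall>br :: 'k::{alg_closed_field, field_char_0} mpol \<Rightarrow> 'k mpol \<Rightarrow> 'k mpol.
        poisson_algebra (poly_alg 3 br) \<and> quadratic_bracket 3 br \<and> nontrivial_bracket 3 br \<longrightarrow>
          (\<forall>d\<ge>1. poisson_cancellative TYPE('b) (veronese 3 br d)) \<and>
          poisson_cancellative TYPE('b) (poly_alg 3 br)) \<and>
     (\<forall>(scale :: 'k \<Rightarrow> 'g::ab_group_add \<Rightarrow> 'g) lie n b br.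
        lie_algebra scale lie \<and> lie_algebra.nonabelian lie \<and>
        lie_algebra.ordered_basis scale n b \<and> n \<le> 3 \<and>
        lie_algebra.kostant_kirillov scale lie n b br \<longrightarrow>
          poisson_cancellative TYPE('b) (poly_alg n br))"
proof (intro conjI allI impI; elim conjE)
  fix br :: "'k mpol \<Rightarrow> 'k mpol \<Rightarrow> 'k mpol"
  assume br: "poisson_algebra (poly_alg 3 br)" "quadratic_bracket 3 br" "nontrivial_bracket 3 br"
  have cancel: "poisson_cancellative TYPE('b) (veronese 3 br d)" if "d \<ge> 1" for d
  proof -
    have "veronese_poisson 3 br 2 d"
      using br that
      by (intro veronese_poisson.intro homogeneous_poisson.intro poly_poisson.intro
          homogeneous_poisson_axioms.intro veronese_poisson_axioms.intro)
        (auto simp: quadratic_bracket_def nontrivial_bracket_def)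
    thus ?thesis by (rule veronese_poisson.cancellative)
  qed
  show "poisson_cancellative TYPE('b) (veronese 3 br d)" if "1 \<le> d" for d by (rule cancel[OF that])
  show "poisson_cancellative TYPE('b) (poly_alg 3 br)" using cancel[of 1] by (simp only: veronese_1)
next
  fix scale :: "'k \<Rightarrow> 'g \<Rightarrow> 'g" and lie n b and br :: "'k mpol \<Rightarrow> 'k mpol \<Rightarrow> 'k mpol"
  assume lie: "lie_algebra scale lie" and *: "lie_algebra.nonabelian lie"
    "lie_algebra.ordered_basis scale n b" "n \<le> 3" "lie_algebra.kostant_kirillov scale lie n b br"
  interpret lie_algebra scale lie by fact
  have "poisson_algebra (poly_alg n br)" using *(4) by (simp add: kostant_kirillov_def)
  hence "veronese_poisson n br 1 1"
    using kostant_kirillov_homogeneous[OF *(1,2,4)] *(3)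
    by (intro veronese_poisson.intro homogeneous_poisson.intro poly_poisson.intro
          homogeneous_poisson_axioms.intro veronese_poisson_axioms.intro) auto
  from veronese_poisson.cancellative[OF this]
  show "poisson_cancellative TYPE('b) (poly_alg n br)" by (simp only: veronese_1)
qed

end
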